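(* If $G=\operatorname{SO}_{2l+1}(\mathbb C)$, then semisimple elements of $\tilde G=\operatorname{Spin}_{2l+1}(\mathbb C)$ are conjugate in $\tilde G$ up to a multiple of an element in $Z(\tilde G)$ if and only if they are conjugate in $\operatorname{GL}(V(\lambda_k))$ up to a constant for $k=1,\dots,l$.
   Context: $V(\lambda_1),\dots,V(\lambda_l)$ are the fundamental representations of $\tilde G$ and $Z(\tilde G)$ is its center. "$s_1,s_2$ are conjugate in $\tilde G$ up to a multiple of an element in $Z(\tilde G)$" means $s_1$ is conjugate in $\tilde G$ to $cs_2$ for some $c\in Z(\tilde G)$. "Conjugate in $\operatorname{GL}(V)$ up to a constant" means that the image of $s_1$ in $\operatorname{GL}(V)$ is conjugate to $t$ times the image of $s_2$ for some $t\in\mathbb C^*$ (which may depend on $V$). *)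

theory Defs
  imports Complex_Main "Jordan_Normal_Form.VS_Connect"
begin

section \<open>The Clifford algebra of the quadratic form \<open>x\<^sub>0\<^sup>2 + \<dots> + x\<^bsub>n-1\<^esub>\<^sup>2\<close> over the complex numbers\<close>

text \<open>
  An element is given by its coefficients in the basis
  \<open>e\<^sub>S = e\<^bsub>i1\<^esub> e\<^bsub>i2\<^esub> \<dots> e\<^bsub>ir\<^esub>\<close>, where \<open>S = {i1 < i2 < \<dots> < ir}\<close> is a subset of
  \<open>{0, \<dots>, n - 1}\<close>; the relations are \<open>e\<^sub>i\<^sup>2 = 1\<close> and \<open>e\<^sub>i e\<^sub>j = - e\<^sub>j e\<^sub>i\<close> for \<open>i \<noteq> j\<close>.
\<close>

type_synonym clifford = "nat set \<Rightarrow> complex"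

definition cliff :: "nat \<Rightarrow> clifford set" where
  "cliff n = {x. \<forall>S. x S \<noteq> 0 \<longrightarrow> S \<subseteq> {..<n}}"

text \<open>
  \<open>e\<^sub>S e\<^sub>T = cliff_sign S T \<cdot> e\<^bsub>sym_diff S T\<^esub>\<close>: sorting the factors costs one sign for every
  inversion, and equal neighbours then cancel.
\<close>

definition cliff_sign :: "nat set \<Rightarrow> nat set \<Rightarrow> complex" where
  "cliff_sign S T = (-1) ^ card {(i, j). i \<in> S \<and> j \<in> T \<and> j < i}"

text \<open>
  In the product the coefficient of \<open>e\<^sub>U\<close> collects the pairs \<open>(S, T)\<close> with \<open>sym_diff S T = U\<close>,
  that is, \<open>T = sym_diff S U\<close>.
\<close>

definition cliff_mult :: "nat \<Rightarrow> clifford \<Rightarrow> clifford \<Rightarrow> clifford" where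
  "cliff_mult n x y =
     (\<lambda>U. \<Sum>S\<in>Pow {..<n}. cliff_sign S (sym_diff S U) * x S * y (sym_diff S U))"

definition cliff_one :: clifford where
  "cliff_one = (\<lambda>S. if S = {} then 1 else 0)"

definition cliff_even :: "nat \<Rightarrow> clifford set" where
  "cliff_even n = {x \<in> cliff n. \<forall>S. x S \<noteq> 0 \<longrightarrow> even (card S)}"

definition cliff_vectors :: "nat \<Rightarrow> clifford set" where
  "cliff_vectors n = {x. \<forall>S. x S \<noteq> 0 \<longrightarrow> (\<exists>i<n. S = {i})}"

text \<open>
  The anti-automorphism that fixes all vectors; it reverses the order of the factors of \<open>e\<^sub>S\<close>.
\<close>

definition cliff_rev :: "clifford \<Rightarrow> clifford" where
  "cliff_rev x = (\<lambda>S. (-1) ^ (card S choose 2) * x S)"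


section \<open>The group \<open>Spin\<^bsub>2l+1\<^esub>\<close>\<close>

definition spin_set :: "nat \<Rightarrow> clifford set" where
  "spin_set n = {x \<in> cliff_even n. cliff_mult n x (cliff_rev x) = cliff_one \<and>
     (\<forall>v\<in>cliff_vectors n. cliff_mult n (cliff_mult n x v) (cliff_rev x) \<in> cliff_vectors n)}"

definition Spin :: "nat \<Rightarrow> clifford monoid" where
  "Spin l = \<lparr>carrier = spin_set (2 * l + 1), mult = cliff_mult (2 * l + 1), one = cliff_one\<rparr>"

definition group_center :: "('a, 'b) monoid_scheme \<Rightarrow> 'a set" where
  "group_center G = {c \<in> carrier G. \<forall>g\<in>carrier G. c \<otimes>\<^bsub>G\<^esub> g = g \<otimes>\<^bsub>G\<^esub> c}"

definition conj_up_to_center :: "('a, 'b) monoid_scheme \<Rightarrow> 'a \<Rightarrow> 'a \<Rightarrow> bool" where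
  "conj_up_to_center G a b \<longleftrightarrow>
     (\<exists>c\<in>group_center G. \<exists>g\<in>carrier G. a = g \<otimes>\<^bsub>G\<^esub> (c \<otimes>\<^bsub>G\<^esub> b) \<otimes>\<^bsub>G\<^esub> inv\<^bsub>G\<^esub> g)"


section \<open>Rational representations\<close>

text \<open>
  \<open>Spin l\<close> is Zariski closed in the even Clifford algebra, so its regular functions are
  the restrictions of polynomials in the coefficients.
\<close>

inductive polynomial_fun :: "(clifford \<Rightarrow> complex) \<Rightarrow> bool" where
  const: "polynomial_fun (\<lambda>x. c)"
| coeff: "polynomial_fun (\<lambda>x. x S)"
| add: "polynomial_fun f \<Longrightarrow> polynomial_fun g \<Longrightarrow> polynomial_fun (\<lambda>x. f x + g x)"
| mult: "polynomial_fun f \<Longrightarrow> polynomial_fun g \<Longrightarrow> polynomial_fun (\<lambda>x. f x * g x)"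

abbreviation GL :: "nat \<Rightarrow> complex mat monoid" where
  "GL N \<equiv> units_of (ring_mat TYPE(complex) N ())"

definition rational_rep :: "nat \<Rightarrow> nat \<Rightarrow> (clifford \<Rightarrow> complex mat) \<Rightarrow> bool" where
  "rational_rep l N \<rho> \<longleftrightarrow> \<rho> \<in> hom (Spin l) (GL N) \<and>
     (\<forall>i<N. \<forall>j<N. \<exists>f. polynomial_fun f \<and> (\<forall>x\<in>carrier (Spin l). \<rho> x $$ (i, j) = f x))"

definition irreducible_rep :: "nat \<Rightarrow> nat \<Rightarrow> (clifford \<Rightarrow> complex mat) \<Rightarrow> bool" where
  "irreducible_rep l N \<rho> \<longleftrightarrow> rational_rep l N \<rho> \<and> N > 0 \<and>
     (\<forall>W. subspace class_ring W (module_vec TYPE(complex) N) \<and>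
          (\<forall>x\<in>carrier (Spin l). \<forall>w\<in>W. \<rho> x *\<^sub>v w \<in> W)
        \<longrightarrow> W = {0\<^sub>v N} \<or> W = carrier_vec N)"

text \<open>
  An element of a linear algebraic group is semisimple iff it acts diagonalizably in every
  rational representation (equivalently, in one faithful rational representation).
\<close>

definition diagonalizable_mat :: "complex mat \<Rightarrow> bool" where
  "diagonalizable_mat A \<longleftrightarrow> (\<exists>D. similar_mat A D \<and> diagonal_mat D)"

definition semisimple_element :: "nat \<Rightarrow> clifford \<Rightarrow> bool" where
  "semisimple_element l s \<longleftrightarrow> s \<in> carrier (Spin l) \<and>
     (\<forall>N \<rho>. rational_rep l N \<rho> \<longrightarrow> diagonalizable_mat (\<rho> s))"


section \<open>Fundamental representations\<close>

text \<open>
  For \<open>j < l\<close> the vectors \<open>p\<^sub>j = (e\<^bsub>2j\<^esub> + \<i> e\<^bsub>2j+1\<^esub>) / 2\<close> and \<open>m\<^sub>j = (e\<^bsub>2j\<^esub> - \<i> e\<^bsub>2j+1\<^esub>) / 2\<close> are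
  isotropic, with \<open>p\<^sub>j m\<^sub>j + m\<^sub>j p\<^sub>j = 1\<close>; all other pairs among the \<open>p\<^sub>j\<close>, \<open>m\<^sub>j\<close> and \<open>e\<^bsub>2l\<^esub>\<close>
  are orthogonal.
\<close>

definition iso_p :: "nat \<Rightarrow> clifford" where
  "iso_p j = (\<lambda>S. if S = {2 * j} then 1 / 2 else if S = {2 * j + 1} then \<i> / 2 else 0)"

definition iso_m :: "nat \<Rightarrow> clifford" where
  "iso_m j = (\<lambda>S. if S = {2 * j} then 1 / 2 else if S = {2 * j + 1} then - \<i> / 2 else 0)"

definition last_vec :: "nat \<Rightarrow> clifford" where
  "last_vec l = (\<lambda>S. if S = {2 * l} then 1 else 0)"

text \<open>
  The one-parameter subgroups \<open>h\<^sub>j(z) = z p\<^sub>j m\<^sub>j + z\<^sup>-\<^sup>1 m\<^sub>j p\<^sub>j\<close>, \<open>j < l\<close>, commute and generate a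
  maximal torus. Conjugation by \<open>h\<^sub>j(z)\<close> multiplies \<open>p\<^sub>j\<close> by \<open>z\<^sup>2\<close>, \<open>m\<^sub>j\<close> by \<open>z\<^sup>-\<^sup>2\<close> and fixes the
  other basis vectors. Hence, if \<open>\<epsilon>\<^sub>j\<close> (with \<open>j\<close> counted from 0) is the weight of \<open>p\<^sub>j\<close> in
  \<open>\<complex>\<^bsup>2l+1\<^esup>\<close>, then \<open>h\<^sub>j\<close> is the coroot of the short root \<open>\<epsilon>\<^sub>j\<close>.
\<close>

definition torus_elem :: "nat \<Rightarrow> nat \<Rightarrow> complex \<Rightarrow> clifford" where
  "torus_elem l j z =
     (\<lambda>S. z * cliff_mult (2 * l + 1) (iso_p j) (iso_m j) S
        + inverse z * cliff_mult (2 * l + 1) (iso_m j) (iso_p j) S)"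

text \<open>
  Root vectors for the positive roots \<open>\<epsilon>\<^sub>i - \<epsilon>\<^sub>j\<close>, \<open>\<epsilon>\<^sub>i + \<epsilon>\<^sub>j\<close> (\<open>i < j\<close>) and \<open>\<epsilon>\<^sub>i\<close>, the Lie algebra
  of \<open>Spin l\<close> being spanned by the products of two orthogonal vectors.
\<close>

definition positive_root_vectors :: "nat \<Rightarrow> clifford set" where
  "positive_root_vectors l =
     {cliff_mult (2 * l + 1) (iso_p i) (iso_m j) | i j. i < j \<and> j < l} \<union>
     {cliff_mult (2 * l + 1) (iso_p i) (iso_p j) | i j. i < j \<and> j < l} \<union>
     {cliff_mult (2 * l + 1) (iso_p i) (last_vec l) | i. i < l}"

text \<open>
  All these root vectors have square zero, so \<open>exp (a X) = 1 + a X\<close>.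
\<close>

definition root_elem :: "clifford \<Rightarrow> complex \<Rightarrow> clifford" where
  "root_elem X a = (\<lambda>S. cliff_one S + a * X S)"

text \<open>
  With the simple roots \<open>\<epsilon>\<^sub>0 - \<epsilon>\<^sub>1, \<dots>, \<epsilon>\<^bsub>l-2\<^esub> - \<epsilon>\<^bsub>l-1\<^esub>, \<epsilon>\<^bsub>l-1\<^esub>\<close> the fundamental weights are
  \<open>\<lambda>\<^sub>k = \<epsilon>\<^sub>0 + \<dots> + \<epsilon>\<^bsub>k-1\<^esub>\<close> for \<open>k < l\<close> and \<open>\<lambda>\<^sub>l = (\<epsilon>\<^sub>0 + \<dots> + \<epsilon>\<^bsub>l-1\<^esub>) / 2\<close>. The value of
  \<open>fundamental_weight l k j\<close> is the exponent \<open>\<langle>\<lambda>\<^sub>k, h\<^sub>j\<rangle>\<close> in \<open>\<lambda>\<^sub>k(h\<^sub>j(z)) = z ^ \<langle>\<lambda>\<^sub>k, h\<^sub>j\<rangle>\<close>.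
\<close>

definition fundamental_weight :: "nat \<Rightarrow> nat \<Rightarrow> nat \<Rightarrow> nat" where
  "fundamental_weight l k j = (if k = l then 1 else if j < k then 2 else 0)"

definition highest_weight_vector ::
    "nat \<Rightarrow> nat \<Rightarrow> (clifford \<Rightarrow> complex mat) \<Rightarrow> nat \<Rightarrow> complex vec \<Rightarrow> bool" where
  "highest_weight_vector l N \<rho> k v \<longleftrightarrow> v \<in> carrier_vec N \<and> v \<noteq> 0\<^sub>v N \<and>
     (\<forall>X\<in>positive_root_vectors l. \<forall>a. \<rho> (root_elem X a) *\<^sub>v v = v) \<and>
     (\<forall>j<l. \<forall>z. z \<noteq> 0 \<longrightarrow> \<rho> (torus_elem l j z) *\<^sub>v v = (z ^ fundamental_weight l k j) \<cdot>\<^sub>v v)"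

text \<open>
  \<open>\<rho>\<close> is (a matrix form of) the irreducible representation \<open>V(\<lambda>\<^sub>k)\<close>. This determines
  \<open>\<rho>\<close> on \<open>Spin l\<close> only up to isomorphism.
\<close>

definition fundamental_rep :: "nat \<Rightarrow> nat \<Rightarrow> nat \<Rightarrow> (clifford \<Rightarrow> complex mat) \<Rightarrow> bool" where
  "fundamental_rep l k N \<rho> \<longleftrightarrow> irreducible_rep l N \<rho> \<and> (\<exists>v. highest_weight_vector l N \<rho> k v)"

definition conj_up_to_constant :: "complex mat \<Rightarrow> complex mat \<Rightarrow> bool" where
  "conj_up_to_constant A B \<longleftrightarrow> (\<exists>t. t \<noteq> 0 \<and> similar_mat A (t \<cdot>\<^sub>m B))"

text \<open>
  As \<open>V(\<lambda>\<^sub>k)\<close> is unique up to isomorphism, the condition below does not depend on the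
  matrix form; it is required for all of them.
\<close>

definition conj_in_GL_fundamental :: "nat \<Rightarrow> nat \<Rightarrow> clifford \<Rightarrow> clifford \<Rightarrow> bool" where
  "conj_in_GL_fundamental l k s\<^sub>1 s\<^sub>2 \<longleftrightarrow>
     (\<forall>N \<rho>. fundamental_rep l k N \<rho> \<longrightarrow> conj_up_to_constant (\<rho> s\<^sub>1) (\<rho> s\<^sub>2))"

end

theory Submission
  imports Defs "Jordan_Normal_Form.Schur_Decomposition" "Jordan_Normal_Form.Spectral_Radius"
    "HOL-Library.Function_Algebras"
begin

text \<open>
If \<open>s\<^sub>1\<close> is conjugate to \<open>c s\<^sub>2\<close> with \<open>c\<close> central, then in an irreducible representation Schur's lemma
turns \<open>c\<close> into a nonzero scalar (\<open>irreducible_central_scalar\<close>), and the images of \<open>s\<^sub>1\<close> and \<open>s\<^sub>2\<close> are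
conjugate up to that scalar. This is one direction. The converse is deduced from the condition for
\<open>k = 1\<close>.

For \<open>l \<ge> 2\<close> the representation \<open>V(\<lambda>\<^sub>1)\<close> is the vector representation on \<open>\<complex>\<^sup>n\<close>, \<open>n = 2l + 1\<close>, where \<open>x\<close>
sends a vector \<open>v\<close> to \<open>x v x\<^sup>*\<close> with \<open>x\<^sup>*\<close> the reversal of \<open>x\<close>. Let \<open>S\<^sub>1\<close>, \<open>S\<^sub>2\<close> be the images of the two
elements, and let \<open>S\<^sub>1\<close> be similar to \<open>t S\<^sub>2\<close>.

\<^item> The matrices \<open>S\<^sub>i\<close> are orthogonal and diagonalizable, hence similar to their inverses. Inverting
the relation shows that \<open>t\<^sup>2 S\<^sub>2\<close> is similar to \<open>S\<^sub>2\<close>. Determinants give \<open>(t\<^sup>n)\<^sup>2 = 1\<close>, and as \<open>n\<close> is odd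
\<open>t\<close> differs from \<open>t\<^sup>n\<close> by an even power of \<open>t\<close>. So \<open>t\<close> may be replaced by the sign \<open>e = t\<^sup>n\<close>
(\<open>orth_mat_similar_up_to_constant\<close>).

\<^item> Similar complex orthogonal matrices are similar through an orthogonal matrix. If \<open>S\<^sub>1 = X (e S\<^sub>2) X\<^sup>-\<^sup>1\<close>,
then the Gram matrix of the columns of \<open>X\<close> commutes with \<open>S\<^sub>2\<close>; it has a square root \<open>C\<close> that is a polynomial in
it, and \<open>P = X C\<^sup>-\<^sup>1\<close> is orthogonal and still conjugates (\<open>similar_orth_mats_orthogonally_similar\<close>).

\<^item> Every orthogonal matrix is, up to sign, the image of some \<open>g\<close> in the spin group. As \<open>n\<close> is odd, the
volume element \<open>\<omega> = e\<^sub>0 \<dots> e\<^bsub>n-1\<^esub>\<close> commutes with all vectors, so for a unit vector \<open>u\<close> the even element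
\<open>u \<omega>\<close> acts as the half-turn about \<open>u\<close>, which is the negative of a reflection; and reflections
generate the orthogonal group (\<open>orth_mat_lifts_to_spin\<close>).

\<^item> Hence \<open>s\<^sub>1 = c g s\<^sub>2 g\<^sup>-\<^sup>1\<close> where \<open>c\<close> acts on vectors as the scalar \<open>\<plusminus>1\<close>. Such a \<open>c\<close> commutes or
anticommutes with every vector, so it commutes with the even Clifford algebra and is central
(\<open>vector_rep_scalar_imp_commutes_even\<close>).

For \<open>l = 1\<close> the representation \<open>V(\<lambda>\<^sub>1)\<close> is the spin representation. Explicit matrices identify the
spin group with \<open>SL\<^sub>2(\<complex>)\<close>; determinants force \<open>t = \<plusminus>1\<close>, which is the image of a central element, and
the conjugating matrix can be rescaled to have determinant 1 (\<open>spin3_rep_conj_imp_conj_up_to_center\<close>).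
\<close>

section \<open>Similarity of complex orthogonal matrices\<close>

text \<open>
A square root of the indeterminate modulo \<open>q\<close> is lifted to a square root modulo \<open>(x - a) q\<close> by
correcting it with a multiple \<open>c q\<close>. The condition on \<open>c\<close> is the vanishing at \<open>a\<close> of an expression
quadratic in \<open>c\<close>. It can be solved over the complex numbers, because a vanishing leading
coefficient \<open>q(a)\<close> makes the square of the given root at \<open>a\<close> equal to \<open>a \<noteq> 0\<close>.
\<close>

lemma sqrt_modulo_split_poly:
  assumes "\<forall>a\<in>set as. a \<noteq> 0"
  shows "\<exists>p::complex poly. (\<Prod>a\<leftarrow>as. [:- a, 1:]) dvd p ^ 2 - [:0, 1:]"
  using assms
proof (induction as)
  case Nil
  show ?case by simp
next
  case (Cons a as)
  define q where "q = (\<Prod>a\<leftarrow>as. [:- a, 1:])"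
  obtain p h where ph: "p ^ 2 - [:0, 1:] = q * h"
    using Cons unfolding q_def dvd_def by auto
  have a: "a \<noteq> 0" using Cons by simp
  have pa: "poly p a ^ 2 - a = poly q a * poly h a"
    using arg_cong[OF ph, of "\<lambda>f. poly f a"] by simp
  have "\<exists>c. poly h a + 2 * c * poly p a + c ^ 2 * poly q a = 0"
  proof (cases "poly q a = 0")
    case True
    with pa a have "poly p a \<noteq> 0" by auto
    then show ?thesis using True by (intro exI[of _ "- poly h a / (2 * poly p a)"]) simp
  next
    case False
    \<comment> \<open>a quarter of the discriminant is \<open>p(a)\<^sup>2 - q(a) h(a) = a\<close>\<close>
    let ?c = "(csqrt a - poly p a) / poly q a"
    have "poly q a * (poly h a + 2 * ?c * poly p a + ?c ^ 2 * poly q a)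
        = poly q a * poly h a + 2 * (csqrt a - poly p a) * poly p a + (csqrt a - poly p a) ^ 2"
      using False by (simp add: field_simps power2_eq_square)
    also have "\<dots> = poly q a * poly h a - poly p a ^ 2 + csqrt a ^ 2"
      by (simp add: algebra_simps power2_eq_square)
    also have "\<dots> = 0" using pa by (simp add: algebra_simps)
    finally show ?thesis using False by (metis mult_eq_0_iff)
  qed
  then obtain c where "poly (h + [:2 * c:] * p + [:c ^ 2:] * q) a = 0" by auto
  then have "[:- a, 1:] dvd h + [:2 * c:] * p + [:c ^ 2:] * q"
    by (rule poly_eq_0_iff_dvd[THEN iffD1])
  then have "q * [:- a, 1:] dvd q * (h + [:2 * c:] * p + [:c ^ 2:] * q)"
    by (rule mult_dvd_mono[OF dvd_refl])
  also have "[:2 * c:] = 2 * [:c:]" by (simp add: numeral_poly)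
  also have "[:c ^ 2:] = [:c:] * [:c:]" by (simp add: power2_eq_square)
  also have "q * (h + 2 * [:c:] * p + [:c:] * [:c:] * q) = (p ^ 2 - [:0, 1:]) + 2 * [:c:] * p * q + [:c:] * [:c:] * q * q"
    unfolding ph by (simp only: algebra_simps)
  also have "\<dots> = (p + [:c:] * q) ^ 2 - [:0, 1:]"
    unfolding power2_eq_square by (simp only: algebra_simps mult_2)
  finally show ?case unfolding q_def by (auto simp: mult.commute)
qed

text \<open>
Evaluation of a polynomial at a square matrix by Horner's scheme.
\<close>

definition poly_mat :: "complex poly \<Rightarrow> complex mat \<Rightarrow> complex mat" where
  "poly_mat p A = fold_coeffs (\<lambda>a M. a \<cdot>\<^sub>m 1\<^sub>m (dim_row A) + A * M) p (0\<^sub>m (dim_row A) (dim_row A))"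

lemma poly_mat_0: "A \<in> carrier_mat n n \<Longrightarrow> poly_mat 0 A = 0\<^sub>m n n"
  by (simp add: poly_mat_def)

lemma poly_mat_pCons:
  "A \<in> carrier_mat n n \<Longrightarrow> poly_mat (pCons a p) A = a \<cdot>\<^sub>m 1\<^sub>m n + A * poly_mat p A"
  by (cases "p = 0 \<and> a = 0") (auto simp: poly_mat_def)

lemma poly_mat_carrier [simp]: "A \<in> carrier_mat n n \<Longrightarrow> poly_mat p A \<in> carrier_mat n n"
  by (induction p) (auto simp: poly_mat_0 poly_mat_pCons)

lemma poly_mat_add:
  assumes A: "A \<in> carrier_mat n n"
  shows "poly_mat (p + q) A = poly_mat p A + poly_mat q A"
proof (induction p q rule: poly_induct2)
  case (pCons a p b q)
  note [simp] = carrier_matD[OF poly_mat_carrier[OF A]]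
  have "A * (poly_mat p A + poly_mat q A) = A * poly_mat p A + A * poly_mat q A"
    using A by (intro mult_add_distrib_mat[where n = n and nr = n and nc = n]) auto
  moreover have "A * poly_mat p A \<in> carrier_mat n n" "A * poly_mat q A \<in> carrier_mat n n"
    using A by auto
  ultimately show ?case using A pCons
    by (simp add: poly_mat_pCons) (intro eq_matI, auto simp: algebra_simps)
qed (use A in \<open>auto simp: poly_mat_0\<close>)

lemma poly_mat_smult:
  assumes A: "A \<in> carrier_mat n n"
  shows "poly_mat (Polynomial.smult c p) A = c \<cdot>\<^sub>m poly_mat p A"
proof (induction p)
  case (pCons a p)
  note [simp] = carrier_matD[OF poly_mat_carrier[OF A]]
  have "A * (c \<cdot>\<^sub>m poly_mat p A) = c \<cdot>\<^sub>m (A * poly_mat p A)"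
    using A by (intro mult_smult_distrib[where n = n and nr = n and nc = n]) auto
  moreover have "A * poly_mat p A \<in> carrier_mat n n" using A by auto
  ultimately show ?case using A pCons
    by (simp add: poly_mat_pCons) (intro eq_matI, auto simp: algebra_simps)
qed (use A in \<open>auto simp: poly_mat_0\<close>)

lemma poly_mat_mult:
  assumes A: "A \<in> carrier_mat n n"
  shows "poly_mat (p * q) A = poly_mat p A * poly_mat q A"
proof (induction p)
  case (pCons a p)
  note [simp] = carrier_matD[OF poly_mat_carrier[OF A]]
  have "(a \<cdot>\<^sub>m 1\<^sub>m n + A * poly_mat p A) * poly_mat q A
     = a \<cdot>\<^sub>m 1\<^sub>m n * poly_mat q A + A * poly_mat p A * poly_mat q A"
    using A by (intro add_mult_distrib_mat[where n = n and nr = n and nc = n]) auto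
  also have "a \<cdot>\<^sub>m 1\<^sub>m n * poly_mat q A = a \<cdot>\<^sub>m poly_mat q A"
    using A by (metis left_mult_one_mat one_carrier_mat poly_mat_carrier mult_smult_assoc_mat)
  also have "A * poly_mat p A * poly_mat q A = A * (poly_mat p A * poly_mat q A)"
    using A by (intro assoc_mult_mat[where n\<^sub>1 = n and n\<^sub>2 = n and n\<^sub>3 = n and n\<^sub>4 = n]) auto
  finally show ?case using A pCons
    by (simp add: poly_mat_pCons poly_mat_add[OF A] poly_mat_smult[OF A])
      (intro eq_matI, auto)
qed (simp add: poly_mat_0[OF A] left_mult_zero_mat[OF poly_mat_carrier[OF A]])

lemma poly_mat_commute:
  assumes A: "A \<in> carrier_mat n n" and M: "M \<in> carrier_mat n n" and c: "A * M = M * A"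
  shows "poly_mat p A * M = M * poly_mat p A"
proof (induction p)
  case (pCons a p)
  let ?P = "poly_mat p A"
  note massoc = assoc_mult_mat[where n\<^sub>1 = n and n\<^sub>2 = n and n\<^sub>3 = n and n\<^sub>4 = n]
  have "(a \<cdot>\<^sub>m 1\<^sub>m n + A * ?P) * M = a \<cdot>\<^sub>m 1\<^sub>m n * M + A * ?P * M"
    using A M by (intro add_mult_distrib_mat[where n = n and nr = n and nc = n]) auto
  also have "A * ?P * M = A * (?P * M)"
    using A M by (intro massoc) auto
  also have "\<dots> = A * M * ?P" unfolding pCons
    using A M by (intro massoc[symmetric]) auto
  also have "\<dots> = M * (A * ?P)" unfolding c
    using A M by (intro massoc) auto
  also have "a \<cdot>\<^sub>m 1\<^sub>m n * M = M * (a \<cdot>\<^sub>m 1\<^sub>m n)"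
    using M by (metis left_mult_one_mat mult_smult_assoc_mat mult_smult_distrib one_carrier_mat right_mult_one_mat)
  also have "M * (a \<cdot>\<^sub>m 1\<^sub>m n) + M * (A * ?P) = M * (a \<cdot>\<^sub>m 1\<^sub>m n + A * ?P)"
    using A M by (intro mult_add_distrib_mat[where n = n and nr = n and nc = n, symmetric]) auto
  finally show ?case using A by (simp add: poly_mat_pCons)
qed (use A M in \<open>auto simp: poly_mat_0\<close>)

lemma poly_mat_transpose:
  assumes A: "A \<in> carrier_mat n n"
  shows "transpose_mat (poly_mat p A) = poly_mat p (transpose_mat A)"
proof (induction p)
  case (pCons a p)
  note [simp] = carrier_matD[OF poly_mat_carrier[OF A]]
  let ?P = "poly_mat p A"
  have "A * ?P = ?P * A" using poly_mat_commute[OF A A] by simp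
  then have 1: "transpose_mat (A * ?P) = transpose_mat A * transpose_mat ?P"
    using transpose_mult[OF poly_mat_carrier[OF A] A] by simp
  have "transpose_mat (a \<cdot>\<^sub>m 1\<^sub>m n + A * ?P) = a \<cdot>\<^sub>m 1\<^sub>m n + transpose_mat (A * ?P)"
    using A by (intro eq_matI) (auto simp: one_mat_def)
  then show ?case using A pCons 1 by (simp add: poly_mat_pCons[where n = n])
qed (use A in \<open>auto simp: poly_mat_0[where n = n]\<close>)

lemma poly_mat_conjugate:
  assumes "U \<in> carrier_mat n n" "P \<in> carrier_mat n n" "Q \<in> carrier_mat n n"
    and PQ: "P * Q = 1\<^sub>m n" "Q * P = 1\<^sub>m n"
  shows "poly_mat p (P * U * Q) = P * poly_mat p U * Q"
proof (induction p)
  case (pCons a p)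
  define M where "M = poly_mat p U"
  have M: "M \<in> carrier_mat n n" using assms by (simp add: M_def)
  have cancel: "Q * (P * X) = X" if "X \<in> carrier_mat n n" for X
    using assms that by (simp flip: assoc_mult_mat[where n\<^sub>1 = n and n\<^sub>2 = n and n\<^sub>3 = n and n\<^sub>4 = n])
  have 1: "P * U * Q * (P * M * Q) = P * (U * M) * Q"
    using assms(1-3) M by (simp add: assoc_mult_mat[where n\<^sub>1 = n and n\<^sub>2 = n and n\<^sub>3 = n and n\<^sub>4 = n]
        cancel[OF mult_carrier_mat[OF M assms(3)]])
  have "P * (a \<cdot>\<^sub>m 1\<^sub>m n + U * M) * Q = (P * (a \<cdot>\<^sub>m 1\<^sub>m n) + P * (U * M)) * Q"
    using assms M by (subst mult_add_distrib_mat) auto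
  also have "\<dots> = P * (a \<cdot>\<^sub>m 1\<^sub>m n) * Q + P * (U * M) * Q"
    using assms M by (subst add_mult_distrib_mat) auto
  also have "P * (a \<cdot>\<^sub>m 1\<^sub>m n) * Q = a \<cdot>\<^sub>m 1\<^sub>m n"
    using assms by (metis PQ mult_smult_assoc_mat mult_smult_distrib one_carrier_mat right_mult_one_mat)
  finally have 2: "P * (a \<cdot>\<^sub>m 1\<^sub>m n + U * M) * Q = a \<cdot>\<^sub>m 1\<^sub>m n + P * (U * M) * Q" .
  show ?case using assms pCons[folded M_def] 1 2 by (simp add: poly_mat_pCons[where n = n] flip: M_def)
qed (use assms in \<open>auto simp: poly_mat_0[where n = n]\<close>)

text \<open>
The factor for the diagonal entry \<open>j\<close> maps the span of the first \<open>j + 1\<close> unit vectors into the span of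
the first \<open>j\<close>, so multiplying the factors up to \<open>j\<close> kills these vectors one dimension at a time.
\<close>

lemma poly_mat_upper_triangular_annihilates:
  assumes U: "U \<in> carrier_mat n n" and ut: "upper_triangular U"
    and "j \<le> n" and "v \<in> carrier_vec n" and "\<forall>i<n. j \<le> i \<longrightarrow> v $ i = 0"
  shows "poly_mat (\<Prod>a\<leftarrow>map (\<lambda>i. U $$ (i, i)) [0..<j]. [:- a, 1:]) U *\<^sub>v v = 0\<^sub>v n"
  using assms(3-)
proof (induction j arbitrary: v)
  case 0
  then have "v = 0\<^sub>v n" by (intro eq_vecI) auto
  then show ?case using poly_mat_carrier[OF U, of 1]
    by (intro eq_vecI) (auto simp: scalar_prod_def)
next
  case (Suc j)
  let ?q = "\<Prod>a\<leftarrow>map (\<lambda>i. U $$ (i, i)) [0..<j]. [:- a, 1:]"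
  let ?u = "U $$ (j, j)"
  define w where "w = U *\<^sub>v v - ?u \<cdot>\<^sub>v v"
  have w: "w \<in> carrier_vec n" using U Suc.prems by (auto simp: w_def)
  have lin: "poly_mat [:- ?u, 1:] U = U - ?u \<cdot>\<^sub>m 1\<^sub>m n"
    using U by (simp add: poly_mat_pCons[where n = n] poly_mat_0[where n = n]) (intro eq_matI, auto)
  have wz: "w $ i = 0" if "i < n" "j \<le> i" for i
  proof -
    have "(U *\<^sub>v v) $ i = (\<Sum>k<n. U $$ (i, k) * v $ k)"
      using U Suc.prems that by (auto simp: scalar_prod_def lessThan_atLeast0)
    also have "\<dots> = (\<Sum>k<n. if k = i then ?u * v $ i else 0)"
    proof (intro sum.cong refl)
      fix k assume "k \<in> {..<n}"
      then show "U $$ (i, k) * v $ k = (if k = i then ?u * v $ i else 0)"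
        using that Suc.prems(3) upper_triangularD[OF ut, of k i] U
        by (cases k i rule: linorder_cases; cases "i = j") auto
    qed
    finally show ?thesis using that Suc.prems by (auto simp: w_def)
  qed
  have "poly_mat (\<Prod>a\<leftarrow>map (\<lambda>i. U $$ (i, i)) [0..<Suc j]. [:- a, 1:]) U
      = poly_mat ?q U * poly_mat [:- ?u, 1:] U"
    unfolding poly_mat_mult[OF U, symmetric] by (simp add: algebra_simps)
  also have "\<dots> *\<^sub>v v = poly_mat ?q U *\<^sub>v (poly_mat [:- ?u, 1:] U *\<^sub>v v)"
    using Suc.prems by (intro assoc_mult_mat_vec[OF poly_mat_carrier[OF U] poly_mat_carrier[OF U]]) auto
  also have "poly_mat [:- ?u, 1:] U *\<^sub>v v = w"
    unfolding lin w_def using U Suc.prems by (subst minus_mult_distrib_mat_vec) auto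
  also have "poly_mat ?q U *\<^sub>v w = 0\<^sub>v n"
    using Suc w wz by auto
  finally show ?case .
qed

text \<open>
By Schur triangularization the matrix may be taken upper triangular; the roots are then its diagonal
entries, which are nonzero together with the determinant.
\<close>

lemma split_poly_annihilates:
  assumes B: "B \<in> carrier_mat n n" and "det B \<noteq> 0"
  shows "\<exists>as. (\<forall>a\<in>set as. a \<noteq> 0) \<and> poly_mat (\<Prod>a\<leftarrow>as. [:- a, 1:]) B = 0\<^sub>m n n"
proof -
  obtain es where "char_poly B = (\<Prod>a\<leftarrow>es. [:- a, 1:])"
    using char_poly_factorized[OF B] by auto
  then obtain U where "upper_triangular U" "similar_mat B U"
    using schur_decomposition_exists[OF B] by auto
  then obtain P Q where wit: "similar_mat_wit B U P Q" by (auto simp: similar_mat_def)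
  note d = similar_mat_witD2[OF B wit]
  let ?as = "map (\<lambda>i. U $$ (i, i)) [0..<n]"
  define M where "M = poly_mat (\<Prod>a\<leftarrow>?as. [:- a, 1:]) U"
  have M: "M \<in> carrier_mat n n" unfolding M_def by (rule poly_mat_carrier[OF d(5)])
  have "M = 0\<^sub>m n n"
  proof (rule eq_matI)
    fix i j assume ij: "i < dim_row (0\<^sub>m n n)" "j < dim_col (0\<^sub>m n n)"
    have "M *\<^sub>v unit_vec n j = 0\<^sub>v n"
      using poly_mat_upper_triangular_annihilates[OF d(5) \<open>upper_triangular U\<close>, of n "unit_vec n j"]
      by (auto simp: M_def)
    moreover have "(M *\<^sub>v unit_vec n j) $ i = M $$ (i, j)"
      using ij M by (auto simp: mult_mat_vec_def)
    ultimately show "M $$ (i, j) = 0\<^sub>m n n $$ (i, j)" using ij by auto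
  qed (use M in auto)
  then have "poly_mat (\<Prod>a\<leftarrow>?as. [:- a, 1:]) B = 0\<^sub>m n n"
    using d poly_mat_conjugate[OF d(5,6,7,1,2)] by (simp add: M_def)
  moreover have "det B = det U"
    using \<open>similar_mat B U\<close> by (rule det_similar)
  then have "0 \<notin> set (diag_mat U)"
    using upper_triangular_imp_det_eq_0_iff[OF d(5) \<open>upper_triangular U\<close>] \<open>det B \<noteq> 0\<close> by simp
  then have "\<forall>a\<in>set ?as. a \<noteq> 0" using d(5) by (auto simp: diag_mat_def)
  ultimately show ?thesis by blast
qed

text \<open>
Being a polynomial in \<open>B\<close>, the square root commutes with everything that commutes with \<open>B\<close> and is
symmetric if \<open>B\<close> is.
\<close>

lemma matrix_sqrt_polynomial:
  assumes B: "B \<in> carrier_mat n n" and "det B \<noteq> 0"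
  shows "\<exists>p. poly_mat p B * poly_mat p B = B"
proof -
  obtain as where as: "\<forall>a\<in>set as. a \<noteq> 0" "poly_mat (\<Prod>a\<leftarrow>as. [:- a, 1:]) B = 0\<^sub>m n n"
    using split_poly_annihilates[OF assms] by auto
  obtain p h where "p ^ 2 - [:0, 1:] = (\<Prod>a\<leftarrow>as. [:- a, 1:]) * h"
    using sqrt_modulo_split_poly[OF as(1)] by (auto simp: dvd_def)
  then have "p * p = (\<Prod>a\<leftarrow>as. [:- a, 1:]) * h + [:0, 1:]"
    by (simp add: power2_eq_square algebra_simps)
  then have "poly_mat p B * poly_mat p B = 0\<^sub>m n n * poly_mat h B + poly_mat [:0, 1:] B"
    by (metis poly_mat_mult[OF B] poly_mat_add[OF B] as(2))
  also have "\<dots> = B"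
    unfolding left_mult_zero_mat[OF poly_mat_carrier[OF B]]
    using B by (simp add: poly_mat_pCons[where n = n] poly_mat_0[where n = n])
      (intro eq_matI, auto)
  finally show ?thesis by blast
qed

text \<open>
Orthogonality with respect to the bilinear form \<open>\<Sum>i. x\<^sub>i y\<^sub>i\<close>, without complex conjugation.
\<close>

definition orth_mat :: "nat \<Rightarrow> complex mat \<Rightarrow> bool" where
  "orth_mat n P \<longleftrightarrow> P \<in> carrier_mat n n \<and> transpose_mat P * P = 1\<^sub>m n"

lemma orth_matD:
  assumes "orth_mat n P"
  shows "P \<in> carrier_mat n n" "transpose_mat P \<in> carrier_mat n n"
    "transpose_mat P * P = 1\<^sub>m n" "P * transpose_mat P = 1\<^sub>m n"
  using assms mat_mult_left_right_inverse[of "transpose_mat P" n P]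
  by (auto simp: orth_mat_def)

lemma orth_mat_mult:
  assumes "orth_mat n P" "orth_mat n Q"
  shows "orth_mat n (P * Q)"
proof -
  note p = orth_matD[OF assms(1)] and q = orth_matD[OF assms(2)]
  have "transpose_mat (P * Q) * (P * Q) = transpose_mat Q * (transpose_mat P * (P * Q))"
    using p q by (simp add: transpose_mult[OF p(1) q(1)] assoc_mult_mat[OF q(2) p(2) mult_carrier_mat[OF p(1) q(1)]])
  also have "transpose_mat P * (P * Q) = transpose_mat P * P * Q"
    using assoc_mult_mat[OF p(2,1) q(1)] by simp
  finally show ?thesis using p q by (simp add: orth_mat_def)
qed

text \<open>
This is the polar decomposition \<open>X = P C\<close> of a conjugating matrix \<open>X\<close>, with \<open>C\<close> a square root of
\<open>G = X\<^sup>T X\<close>. Orthogonality of \<open>A\<close> and \<open>B\<close> makes \<open>G\<close> commute with \<open>B\<close>, so \<open>C\<close> commutes with \<open>B\<close> as well and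
the orthogonal factor \<open>P\<close> alone conjugates \<open>B\<close> to \<open>A\<close>.
\<close>

lemma similar_orth_mats_orthogonally_similar:
  assumes A: "orth_mat n A" and B: "orth_mat n B" and "similar_mat A B"
  shows "\<exists>P. orth_mat n P \<and> A = P * B * transpose_mat P"
proof -
  obtain X Y where wit: "similar_mat_wit A B X Y" using assms(3) by (auto simp: similar_mat_def)
  note a = orth_matD[OF A] and b = orth_matD[OF B]
  note d = similar_mat_witD2[OF a(1) wit]
  note massoc = assoc_mult_mat[where n\<^sub>1 = n and n\<^sub>2 = n and n\<^sub>3 = n and n\<^sub>4 = n]
  define X' Y' where X': "X' = transpose_mat X" and Y': "Y' = transpose_mat Y"
  have c: "X' \<in> carrier_mat n n" "Y' \<in> carrier_mat n n" using d by (auto simp: X' Y')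
  define G where "G = X' * X"
  have G: "G \<in> carrier_mat n n" using c d by (auto simp: G_def)
  have XY': "X' * Y' = 1\<^sub>m n"
    unfolding X' Y' transpose_mult[OF d(7,6), symmetric] d(2) by simp
  let ?B' = "transpose_mat B"
  have At: "transpose_mat A = Y' * (?B' * X')"
    unfolding d(3) X' Y'
    using transpose_mult[OF mult_carrier_mat[OF d(6) d(5)] d(7)] transpose_mult[OF d(6) d(5)] by simp
  have "X' * (transpose_mat A * A) * X = X' * X" using a c d by simp
  also have "X' * (transpose_mat A * A) * X = X' * Y' * (?B' * (G * B)) * (Y * X)"
    unfolding At unfolding d(3) G_def using b(1,2) c d(5-7) by (simp add: massoc)
  also have "\<dots> = ?B' * (G * B)"
    unfolding XY' d(2) using b G by simp
  finally have "?B' * (G * B) = G" by (simp add: G_def)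
  then have "B * (?B' * (G * B)) = B * G" by simp
  also have "B * (?B' * (G * B)) = B * ?B' * (G * B)"
    by (rule massoc[OF b(1,2) mult_carrier_mat[OF G b(1)], symmetric])
  finally have GB: "G * B = B * G" using b G by simp
  have GYY: "G * (Y * Y') = 1\<^sub>m n"
  proof -
    have "G * (Y * Y') = X' * (X * Y) * Y'" unfolding G_def using c d(5-7) by (simp add: massoc)
    then show ?thesis unfolding d(1) using c XY' by simp
  qed
  \<comment> \<open>\<open>Y Y\<^sup>T\<close> is the inverse of \<open>G\<close>\<close>
  have YY: "Y * Y' \<in> carrier_mat n n" using c d by auto
  have "det G * det (Y * Y') = 1"
    using det_mult[OF G YY] GYY by simp
  then have "det G \<noteq> 0" by auto
  then obtain p where p: "poly_mat p G * poly_mat p G = G"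
    using matrix_sqrt_polynomial[OF G] by auto
  define C where "C = poly_mat p G"
  have C: "C \<in> carrier_mat n n" unfolding C_def by (rule poly_mat_carrier[OF G])
  have CC: "C * C = G" using p by (simp add: C_def)
  have "transpose_mat G = G"
    unfolding G_def X' using transpose_mult[of "transpose_mat X" n n X n] d(6) by simp
  then have Ct: "transpose_mat C = C"
    unfolding C_def using poly_mat_transpose[OF G] by simp
  have CB: "C * B = B * C"
    unfolding C_def by (rule poly_mat_commute[OF G b(1) GB])
  define D where "D = C * (Y * Y')"
  have D: "D \<in> carrier_mat n n" using C YY by (auto simp: D_def)
  have CD: "C * D = 1\<^sub>m n"
    unfolding D_def massoc[OF C C YY, symmetric] CC by (rule GYY)
  have DC: "D * C = 1\<^sub>m n" by (rule mat_mult_left_right_inverse[OF C D CD])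
  define P where "P = X * D"
  have P: "P \<in> carrier_mat n n" using d D by (auto simp: P_def)
  define D' where "D' = transpose_mat D"
  have D': "D' \<in> carrier_mat n n" using D by (simp add: D'_def)
  have Pt: "transpose_mat P = D' * X'"
    unfolding P_def D'_def X' by (rule transpose_mult[OF d(6) D])
  have D'C: "D' * C = 1\<^sub>m n"
    using transpose_mult[OF C D] CD Ct by (simp add: D'_def)
  have "transpose_mat P * P = D' * C * (C * D)"
  proof -
    have "transpose_mat P * P = D' * (X' * X) * D"
      unfolding Pt unfolding P_def using D D' c d(5-7) by (simp add: massoc)
    also have "\<dots> = D' * (C * C) * D" using CC by (simp add: G_def)
    finally show ?thesis using D D' C by (simp add: massoc)
  qed
  then have PP: "transpose_mat P * P = 1\<^sub>m n" using CD D'C by simp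
  have "P * (C * Y) = X * (D * C) * Y"
    unfolding P_def using D C d(5-7) by (simp add: massoc)
  then have PCY: "P * (C * Y) = 1\<^sub>m n" using DC d by simp
  have CY: "C * Y \<in> carrier_mat n n" using C d by auto
  have P': "transpose_mat P \<in> carrier_mat n n" using P by simp
  have "transpose_mat P * (P * (C * Y)) = C * Y"
    unfolding massoc[OF P' P CY, symmetric] PP by (rule left_mult_one_mat[OF CY])
  then have PtCY: "transpose_mat P = C * Y"
    using PCY P' by simp
  have "P * B * transpose_mat P = X * D * (B * C) * Y"
    unfolding PtCY unfolding P_def using D C b d(5-7) by (simp add: massoc)
  also have "\<dots> = X * (D * C) * B * Y"
    unfolding CB[symmetric] using D C b d(5-7) by (simp add: massoc)
  also have "\<dots> = A" unfolding DC d(3) using d(5-7) by simp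
  finally show ?thesis using P PP by (auto simp: orth_mat_def)
qed

lemma similar_mat_inverse:
  fixes A A' C C' :: "complex mat"
  assumes "similar_mat A C" and A: "A \<in> carrier_mat n n" "A' \<in> carrier_mat n n" "A * A' = 1\<^sub>m n"
    and C: "C' \<in> carrier_mat n n" "C * C' = 1\<^sub>m n"
  shows "similar_mat A' C'"
proof -
  obtain X Y where wit: "similar_mat_wit A C X Y" using assms(1) by (auto simp: similar_mat_def)
  note d = similar_mat_witD2[OF A(1) wit]
  note massoc = assoc_mult_mat[where n\<^sub>1 = n and n\<^sub>2 = n and n\<^sub>3 = n and n\<^sub>4 = n]
  have "Y * (X * Z) = Z" if "Z \<in> carrier_mat n n" for Z
    unfolding massoc[OF d(7,6) that, symmetric] d(2) using that by simp
  then have "A * (X * C' * Y) = X * (C * C') * Y"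
    unfolding d(3) using d(5-7) C(1) by (simp add: massoc)
  then have 1: "A * (X * C' * Y) = 1\<^sub>m n" using C d by simp
  have A'A: "A' * A = 1\<^sub>m n" by (rule mat_mult_left_right_inverse[OF A])
  have W: "X * C' * Y \<in> carrier_mat n n" using C d by auto
  have "A' * (A * (X * C' * Y)) = X * C' * Y"
    unfolding massoc[OF A(2,1) W, symmetric] A'A by (rule left_mult_one_mat[OF W])
  then have "A' = X * C' * Y" using 1 A by simp
  then have "similar_mat_wit A' C' X Y"
    using A C d by (intro similar_mat_witI[where n = n]) auto
  then show ?thesis by (auto simp: similar_mat_def)
qed

lemma diagonalizable_similar_transpose:
  assumes A: "A \<in> carrier_mat n n" and "diagonalizable_mat A"
  shows "similar_mat A (transpose_mat A)"
proof -
  obtain D where D: "similar_mat A D" "diagonal_mat D"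
    using assms(2) by (auto simp: diagonalizable_mat_def)
  obtain X Y where wit: "similar_mat_wit A D X Y" using D(1) by (auto simp: similar_mat_def)
  note d = similar_mat_witD2[OF A wit]
  have "transpose_mat D = D"
    using D(2) d(5) by (intro eq_matI) (auto simp: diagonal_mat_def, metis)
  then have "transpose_mat A = transpose_mat Y * D * transpose_mat X"
    unfolding d(3)
    using transpose_mult[OF mult_carrier_mat[OF d(6) d(5)] d(7)] transpose_mult[OF d(6) d(5)] d(5-7)
    by (simp add: assoc_mult_mat[where n\<^sub>1 = n and n\<^sub>2 = n and n\<^sub>3 = n and n\<^sub>4 = n])
  moreover have "transpose_mat Y * transpose_mat X = 1\<^sub>m n" "transpose_mat X * transpose_mat Y = 1\<^sub>m n"
    unfolding transpose_mult[OF d(6,7), symmetric] transpose_mult[OF d(7,6), symmetric] d(1,2) by simp_all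
  ultimately have "similar_mat_wit (transpose_mat A) D (transpose_mat Y) (transpose_mat X)"
    using A d(5-7) by (intro similar_mat_witI[where n = n]) auto
  then have "similar_mat (transpose_mat A) D" by (auto simp: similar_mat_def)
  then show ?thesis using D(1) similar_mat_sym similar_mat_trans by blast
qed

text \<open>
The inverse of an orthogonal matrix is its transpose, to which it is similar when diagonalizable.
Inverting the given relation therefore yields that \<open>t B\<close> is similar to \<open>t\<^sup>-\<^sup>1 B\<close>, and all even powers of
\<open>t\<close> may be dropped. What remains of \<open>t\<close> is \<open>t\<^sup>n\<close>, whose square is 1 by comparing determinants.
\<close>

lemma orth_mat_similar_up_to_constant:
  assumes A: "orth_mat n A" and B: "orth_mat n B" and "odd n"
    and dA: "diagonalizable_mat A" and dB: "diagonalizable_mat B"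
    and "t \<noteq> 0" and sim: "similar_mat A (t \<cdot>\<^sub>m B)"
  shows "\<exists>e. (e = 1 \<or> e = - 1) \<and> similar_mat A (e \<cdot>\<^sub>m B)"
proof -
  note a = orth_matD[OF A] and b = orth_matD[OF B]
  have [simp]: "c \<cdot>\<^sub>m (d \<cdot>\<^sub>m B) = (c * d) \<cdot>\<^sub>m B" for c d
    by (intro eq_matI) auto
  have [simp]: "1 \<cdot>\<^sub>m B = B" by (intro eq_matI) auto
  have "similar_mat (transpose_mat A) (inverse t \<cdot>\<^sub>m transpose_mat B)" (is "similar_mat _ ?B'")
  proof (rule similar_mat_inverse[OF sim a(1,2,4)])
    show "t \<cdot>\<^sub>m B * (inverse t \<cdot>\<^sub>m transpose_mat B) = 1\<^sub>m n"
    proof -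
      have "t \<cdot>\<^sub>m B * (inverse t \<cdot>\<^sub>m transpose_mat B) = t \<cdot>\<^sub>m (inverse t \<cdot>\<^sub>m (B * transpose_mat B))"
        using b(1,2) by (simp add: mult_smult_distrib[where n = n and nr = n and nc = n]
            mult_smult_assoc_mat[where n = n and nr = n and nc = n])
          (intro eq_matI, auto)
      then show ?thesis unfolding b(4) using \<open>t \<noteq> 0\<close> by (intro eq_matI) (auto simp: one_mat_def)
    qed
  qed (use b in auto)
  moreover have "similar_mat ?B' (inverse t \<cdot>\<^sub>m B)"
    using similar_mat_smult[OF diagonalizable_similar_transpose[OF b(1) dB]] similar_mat_sym by blast
  ultimately have "similar_mat (t \<cdot>\<^sub>m B) (inverse t \<cdot>\<^sub>m B)"
    using sim diagonalizable_similar_transpose[OF a(1) dA] similar_mat_sym similar_mat_trans by blast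
  from similar_mat_smult[OF this, of t] have t2: "similar_mat (t ^ 2 \<cdot>\<^sub>m B) B"
    using \<open>t \<noteq> 0\<close> by (simp add: power2_eq_square)
  have pow: "similar_mat (t ^ (2 * k) \<cdot>\<^sub>m B) B" for k
  proof (induction k)
    case 0
    then show ?case using similar_mat_refl[OF b(1)] by simp
  next
    case (Suc k)
    have "similar_mat (t ^ 2 \<cdot>\<^sub>m (t ^ (2 * k) \<cdot>\<^sub>m B)) (t ^ 2 \<cdot>\<^sub>m B)"
      by (rule similar_mat_smult[OF Suc])
    then show ?case using t2 similar_mat_trans by (auto simp: power2_eq_square mult_ac)
  qed
  have det1: "det M * det M = 1" if "orth_mat n M" for M
    using det_mult[OF orth_matD(2,1)[OF that]] det_transpose[OF orth_matD(1)[OF that]]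
      orth_matD(3)[OF that] by simp
  have "det A = t ^ n * det B" using det_similar[OF sim] b by simp
  then have "t ^ n * t ^ n * (det B * det B) = det A * det A" by simp
  then have e: "t ^ n * t ^ n = 1" using det1 A B by simp
  obtain k where k: "n + 1 = 2 * k" using \<open>odd n\<close> by (metis even_plus_one_iff dvdE odd_even_add odd_one)
  have "similar_mat (t ^ n * t \<cdot>\<^sub>m B) B" using pow[of k] k by (metis Suc_eq_plus1 power_Suc2)
  from similar_mat_smult[OF this, of "t ^ n"]
  have "similar_mat (t \<cdot>\<^sub>m B) (t ^ n \<cdot>\<^sub>m B)" using e by (simp flip: mult.assoc)
  then have "similar_mat A (t ^ n \<cdot>\<^sub>m B)" using sim similar_mat_trans by blast
  moreover have "t ^ n = 1 \<or> t ^ n = - 1" using e by (metis square_eq_1_iff)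
  ultimately show ?thesis by blast
qed

section \<open>The Clifford algebra\<close>

lemma sum_fun_apply: "(\<Sum>i\<in>A. f i) x = (\<Sum>i\<in>A. f i x)"
  for f :: "'i \<Rightarrow> 'a \<Rightarrow> 'b::comm_monoid_add"
  by (induction A rule: infinite_finite_induct) auto

lemma minus_one_power_card_sym_diff:
  assumes "finite A" "finite B"
  shows "(- 1 :: 'a::ring_1) ^ card (sym_diff A B) = (- 1) ^ card A * (- 1) ^ card B"
proof -
  have "card A = card (A - B) + card (A \<inter> B)" "card B = card (B - A) + card (A \<inter> B)"
    using assms by (simp_all add: card_Diff_subset_Int card_mono Int_commute)
  moreover have "card (sym_diff A B) = card (A - B) + card (B - A)"
    using assms by (intro card_Un_disjoint) auto
  ultimately have "card A + card B = card (sym_diff A B) + 2 * card (A \<inter> B)" by simp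
  then show ?thesis by (simp flip: power_add) (simp add: power_add power_mult)
qed

lemma finite_inversions: "finite S \<Longrightarrow> finite {(i :: nat, j). i \<in> S \<and> j \<in> T \<and> j < i}"
  by (rule finite_subset[of _ "SIGMA i:S. {..<i}"]) auto

text \<open>
The sign is bimultiplicative with respect to symmetric difference. This replaces all sorting
arguments: associativity of the product and the reversal law are consequences.
\<close>

lemma cliff_sign_sym_diff_left:
  assumes "finite S" "finite T"
  shows "cliff_sign (sym_diff S T) U = cliff_sign S U * cliff_sign T U"
proof -
  have "{(i, j). i \<in> sym_diff S T \<and> j \<in> U \<and> j < i}
      = sym_diff {(i, j). i \<in> S \<and> j \<in> U \<and> j < i} {(i, j). i \<in> T \<and> j \<in> U \<and> j < i}"
    by auto
  then show ?thesis
    unfolding cliff_sign_def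
    by (simp only: minus_one_power_card_sym_diff[OF finite_inversions[OF assms(1)] finite_inversions[OF assms(2)]])
qed

lemma cliff_sign_sym_diff_right:
  assumes "finite S"
  shows "cliff_sign S (sym_diff T U) = cliff_sign S T * cliff_sign S U"
proof -
  have "{(i, j). i \<in> S \<and> j \<in> sym_diff T U \<and> j < i}
      = sym_diff {(i, j). i \<in> S \<and> j \<in> T \<and> j < i} {(i, j). i \<in> S \<and> j \<in> U \<and> j < i}"
    by auto
  then show ?thesis
    unfolding cliff_sign_def
    by (simp only: minus_one_power_card_sym_diff[OF finite_inversions[OF assms] finite_inversions[OF assms]])
qed

lemma cliff_sign_square [simp]: "cliff_sign S T * cliff_sign S T = 1"
  by (simp add: cliff_sign_def flip: power_mult_distrib)

lemma cliff_sign_square' [simp]: "cliff_sign S T * (cliff_sign S T * z) = z"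
  by (simp flip: mult.assoc)

lemma cliff_sign_empty [simp]: "cliff_sign {} T = 1" "cliff_sign S {} = 1"
  by (simp_all add: cliff_sign_def)

text \<open>
The sign of the reversal of \<open>e\<^sub>S\<close> is the sign of the pair \<open>(S, S)\<close>, so reversal obeys the same
bimultiplicative calculus.
\<close>

lemma cliff_sign_self:
  assumes "finite S"
  shows "cliff_sign S S = (- 1) ^ (card S choose 2)"
proof -
  have "card {(i, j). i \<in> S \<and> j \<in> S \<and> j < i} = card S choose 2"
    using assms
  proof (induction S rule: finite_linorder_max_induct)
    case (insert b A)
    have "{(i, j). i \<in> insert b A \<and> j \<in> insert b A \<and> j < i}
        = {(i, j). i \<in> A \<and> j \<in> A \<and> j < i} \<union> {b} \<times> A" (is "_ = ?P \<union> ?Q")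
      using insert.hyps by (auto dest: order.strict_trans)
    moreover have "card (?P \<union> ?Q) = card ?P + card ?Q"
      using insert.hyps finite_inversions[of A A] by (intro card_Un_disjoint) auto
    moreover have "card (insert b A) = Suc (card A)" using insert.hyps by auto
    moreover have "Suc (card A) choose 2 = (card A choose 2) + card A"
      by (simp add: numeral_2_eq_2)
    ultimately show ?case using insert.IH by (simp add: card_cartesian_product)
  qed simp
  then show ?thesis by (simp add: cliff_sign_def)
qed

definition cscale :: "complex \<Rightarrow> clifford \<Rightarrow> clifford" where
  "cscale c x = (\<lambda>S. c * x S)"

lemma cscale_apply [simp]: "cscale c x S = c * x S"
  by (simp add: cscale_def)

lemma cscale_simps [simp]:
  "cscale 1 x = x" "cscale 0 x = 0" "cscale c 0 = 0" "cscale c (cscale d x) = cscale (c * d) x"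
  by (auto simp: fun_eq_iff)

lemma cscale_add: "cscale c (x + y) = cscale c x + cscale c y" "cscale (c + d) x = cscale c x + cscale d x"
  by (auto simp: fun_eq_iff algebra_simps)

definition basis_elem :: "nat set \<Rightarrow> clifford" where
  "basis_elem S = (\<lambda>T. if T = S then 1 else 0)"

lemma cliff_one_eq_basis_elem: "cliff_one = basis_elem {}"
  by (simp add: cliff_one_def basis_elem_def)

text \<open>
The even part for \<open>p = True\<close> and the odd part for \<open>p = False\<close>; products then follow the single rule
\<open>mult_parity\<close>.
\<close>

definition cliff_parity :: "nat \<Rightarrow> bool \<Rightarrow> clifford set" where
  "cliff_parity n p = {x \<in> cliff n. \<forall>S. x S \<noteq> 0 \<longrightarrow> (even (card S) \<longleftrightarrow> p)}"

text \<open>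
Multiplication is associative and bilinear, with left unit, on arbitrary coefficient functions; only
the right unit law needs an element of \<open>cliff n\<close>. The locale fixes the dimension so that the product can
be written as an infix operator.
\<close>

locale clifford_algebra =
  fixes n :: nat
begin

abbreviation cmul (infixl "\<star>" 70) where "x \<star> y \<equiv> cliff_mult n x y"

lemma sym_diff_cancel [simp]: "sym_diff A (sym_diff A B) = B"
  by auto

lemma finite_Pow_n: "S \<in> Pow {..<n} \<Longrightarrow> finite S"
  using finite_subset by auto

lemma bij_sym_diff: "R \<in> Pow {..<n} \<Longrightarrow> bij_betw (sym_diff R) (Pow {..<n}) (Pow {..<n})"
  by (rule bij_betwI[where g = "sym_diff R"]) auto

lemma mult_assoc: "(x \<star> y) \<star> z = x \<star> (y \<star> z)"
proof
  fix U
  let ?N = "Pow {..<n}"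
  have "((x \<star> y) \<star> z) U = (\<Sum>S\<in>?N. \<Sum>R\<in>?N. cliff_sign S (sym_diff S U) *
      (cliff_sign R (sym_diff R S) * x R * y (sym_diff R S)) * z (sym_diff S U))"
    by (simp add: cliff_mult_def sum_distrib_left sum_distrib_right)
  also have "\<dots> = (\<Sum>R\<in>?N. \<Sum>S\<in>?N. cliff_sign S (sym_diff S U) *
      (cliff_sign R (sym_diff R S) * x R * y (sym_diff R S)) * z (sym_diff S U))"
    by (rule sum.swap)
  also have "\<dots> = (\<Sum>R\<in>?N. \<Sum>Q\<in>?N. cliff_sign R (sym_diff R U) * x R *
      (cliff_sign Q (sym_diff Q (sym_diff R U)) * y Q * z (sym_diff Q (sym_diff R U))))"
    (is "sum ?lhs ?N = sum ?rhs ?N")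
  proof (rule sum.cong[OF refl])
    fix R assume R: "R \<in> ?N"
    have "(\<Sum>S\<in>?N. cliff_sign S (sym_diff S U) *
      (cliff_sign R (sym_diff R S) * x R * y (sym_diff R S)) * z (sym_diff S U))
      = (\<Sum>Q\<in>?N. cliff_sign (sym_diff R Q) (sym_diff (sym_diff R Q) U) *
      (cliff_sign R (sym_diff R (sym_diff R Q)) * x R * y (sym_diff R (sym_diff R Q))) * z (sym_diff (sym_diff R Q) U))"
      by (rule sum.reindex_bij_betw[OF bij_sym_diff[OF R], symmetric])
    also have "\<dots> = (\<Sum>Q\<in>?N. cliff_sign R (sym_diff R U) * x R *
      (cliff_sign Q (sym_diff Q (sym_diff R U)) * y Q * z (sym_diff Q (sym_diff R U))))"
    proof (intro sum.cong refl)
      fix Q assume Q: "Q \<in> ?N"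
      define W where "W = sym_diff Q (sym_diff R U)"
      have W: "sym_diff (sym_diff R Q) U = W" "sym_diff R U = sym_diff Q W" by (auto simp: W_def)
      have "finite Q" "finite R" using Q R finite_Pow_n by auto
      then show "cliff_sign (sym_diff R Q) (sym_diff (sym_diff R Q) U) *
          (cliff_sign R (sym_diff R (sym_diff R Q)) * x R * y (sym_diff R (sym_diff R Q))) * z (sym_diff (sym_diff R Q) U)
        = cliff_sign R (sym_diff R U) * x R *
          (cliff_sign Q (sym_diff Q (sym_diff R U)) * y Q * z (sym_diff Q (sym_diff R U)))"
        unfolding sym_diff_cancel W(1) unfolding W(2) sym_diff_cancel
        by (simp add: cliff_sign_sym_diff_left cliff_sign_sym_diff_right)
    qed
    finally show "?lhs R = ?rhs R" .
  qed
  also have "\<dots> = (x \<star> (y \<star> z)) U"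
    by (simp add: cliff_mult_def sum_distrib_left)
  finally show "((x \<star> y) \<star> z) U = (x \<star> (y \<star> z)) U" .
qed

lemma mult_add_left: "(x + y) \<star> z = x \<star> z + y \<star> z"
  by (auto simp: fun_eq_iff cliff_mult_def algebra_simps sum.distrib)

lemma mult_add_right: "x \<star> (y + z) = x \<star> y + x \<star> z"
  by (auto simp: fun_eq_iff cliff_mult_def algebra_simps sum.distrib)

lemma mult_diff_left: "(x - y) \<star> z = x \<star> z - y \<star> z"
  by (auto simp: fun_eq_iff cliff_mult_def algebra_simps sum_subtractf)

lemma mult_cscale [simp]: "cscale c x \<star> y = cscale c (x \<star> y)" "x \<star> cscale c y = cscale c (x \<star> y)"
  by (auto simp: fun_eq_iff cliff_mult_def algebra_simps sum_distrib_left)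

lemma mult_zero [simp]: "0 \<star> y = 0" "y \<star> 0 = 0"
  by (auto simp: fun_eq_iff cliff_mult_def)

lemma mult_sum_left: "(\<Sum>i\<in>A. f i) \<star> y = (\<Sum>i\<in>A. f i \<star> y)"
  using sum_comp_morphism[of "\<lambda>z. z \<star> y" f A] by (simp add: mult_add_left comp_def)

lemma mult_sum_right: "y \<star> (\<Sum>i\<in>A. f i) = (\<Sum>i\<in>A. y \<star> f i)"
  using sum_comp_morphism[of "\<lambda>z. y \<star> z" f A] by (simp add: mult_add_right comp_def)

lemma basis_elem_mult:
  assumes "S \<subseteq> {..<n}"
  shows "(basis_elem S \<star> y) U = cliff_sign S (sym_diff S U) * y (sym_diff S U)"
proof -
  have "(basis_elem S \<star> y) U = (\<Sum>R\<in>Pow {..<n}. if R = S then cliff_sign S (sym_diff S U) * y (sym_diff S U) else 0)"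
    unfolding cliff_mult_def by (intro sum.cong) (auto simp: basis_elem_def)
  then show ?thesis using assms by simp
qed

lemma basis_elem_mult_basis_elem:
  assumes "S \<subseteq> {..<n}"
  shows "basis_elem S \<star> basis_elem T = cscale (cliff_sign S T) (basis_elem (sym_diff S T))"
proof
  fix U
  have "sym_diff S U = T \<longleftrightarrow> U = sym_diff S T" by auto
  then show "(basis_elem S \<star> basis_elem T) U = cscale (cliff_sign S T) (basis_elem (sym_diff S T)) U"
    unfolding basis_elem_mult[OF assms] by (cases "U = sym_diff S T") (auto simp: basis_elem_def)
qed

lemma one_mult [simp]: "cliff_one \<star> y = y"
  by (simp add: fun_eq_iff cliff_one_eq_basis_elem basis_elem_mult)

lemma mult_one [simp]:
  assumes "x \<in> cliff n"
  shows "x \<star> cliff_one = x"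
proof
  fix U
  have "(x \<star> cliff_one) U = (\<Sum>S\<in>Pow {..<n}. if S = U then x U else 0)"
    unfolding cliff_mult_def by (intro sum.cong) (auto simp: cliff_one_def)
  also have "\<dots> = x U" using assms by (auto simp: cliff_def)
  finally show "(x \<star> cliff_one) U = x U" .
qed

lemma cliff_outside: "x \<in> cliff n \<Longrightarrow> \<not> S \<subseteq> {..<n} \<Longrightarrow> x S = 0"
  unfolding cliff_def by blast

lemma parity_cliff: "x \<in> cliff_parity n p \<Longrightarrow> x \<in> cliff n"
  by (simp add: cliff_parity_def)

lemma mult_cliff:
  assumes "x \<in> cliff n" "y \<in> cliff n"
  shows "x \<star> y \<in> cliff n"
proof -
  have "(x \<star> y) U = 0" if "\<not> U \<subseteq> {..<n}" for U
    unfolding cliff_mult_def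
  proof (intro sum.neutral ballI)
    fix S assume "S \<in> Pow {..<n}"
    then have "\<not> sym_diff S U \<subseteq> {..<n}" using that by auto
    then show "cliff_sign S (sym_diff S U) * x S * y (sym_diff S U) = 0"
      using assms by (auto simp: cliff_def)
  qed
  then show ?thesis by (auto simp: cliff_def)
qed

lemma mult_parity:
  assumes x: "x \<in> cliff_parity n p" and y: "y \<in> cliff_parity n q"
  shows "x \<star> y \<in> cliff_parity n (p = q)"
proof -
  have "even (card U) \<longleftrightarrow> p = q" if U: "(x \<star> y) U \<noteq> 0" for U
  proof -
    obtain S where S: "S \<in> Pow {..<n}" "cliff_sign S (sym_diff S U) * x S * y (sym_diff S U) \<noteq> 0"
      using U unfolding cliff_mult_def by (meson sum.neutral)
    have "(x \<star> y) \<in> cliff n" using assms mult_cliff parity_cliff by blast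
    then have "U \<subseteq> {..<n}" using U by (auto simp: cliff_def)
    then have fin: "finite S" "finite (sym_diff S U)" using S(1) finite_subset[of _ "{..<n}"] by auto
    have "even (card S) = p" "even (card (sym_diff S U)) = q"
      using S x y by (auto simp: cliff_parity_def)
    moreover have "(- 1 :: int) ^ card U = (- 1) ^ card S * (- 1) ^ card (sym_diff S U)"
      using minus_one_power_card_sym_diff[OF fin, where ?'a = int] by simp
    ultimately show ?thesis
      by (cases "even (card U)"; cases "even (card S)"; cases "even (card (sym_diff S U))") auto
  qed
  then show ?thesis using assms mult_cliff by (auto simp: cliff_parity_def)
qed

lemma rev_apply: "finite S \<Longrightarrow> cliff_rev x S = cliff_sign S S * x S"
  by (simp add: cliff_rev_def cliff_sign_self)

lemma rev_cliff: "x \<in> cliff n \<Longrightarrow> cliff_rev x \<in> cliff n"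
  by (auto simp: cliff_def cliff_rev_def)

lemma rev_parity: "x \<in> cliff_parity n p \<Longrightarrow> cliff_rev x \<in> cliff_parity n p"
  by (auto simp: cliff_parity_def rev_cliff) (auto simp: cliff_rev_def)

lemma rev_rev [simp]: "cliff_rev (cliff_rev x) = x"
  by (simp add: cliff_rev_def fun_eq_iff flip: power_mult_distrib mult.assoc)

lemma rev_linear [simp]:
  "cliff_rev (x + y) = cliff_rev x + cliff_rev y"
  "cliff_rev (x - y) = cliff_rev x - cliff_rev y"
  "cliff_rev (cscale c x) = cscale c (cliff_rev x)"
  by (auto simp: fun_eq_iff cliff_rev_def algebra_simps)

lemma rev_one [simp]: "cliff_rev cliff_one = cliff_one"
  by (auto simp: fun_eq_iff cliff_rev_def cliff_one_def numeral_2_eq_2)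

lemma rev_vector: "x \<in> cliff_vectors n \<Longrightarrow> cliff_rev x = x"
proof
  fix S assume x: "x \<in> cliff_vectors n"
  show "cliff_rev x S = x S"
  proof (cases "x S = 0")
    case False
    then obtain i where "S = {i}" using x by (auto simp: cliff_vectors_def)
    then show ?thesis by (simp add: cliff_rev_def numeral_2_eq_2)
  qed (simp add: cliff_rev_def)
qed

lemma rev_mult:
  assumes x: "x \<in> cliff n" and y: "y \<in> cliff n"
  shows "cliff_rev (x \<star> y) = cliff_rev y \<star> cliff_rev x"
proof
  fix U
  show "cliff_rev (x \<star> y) U = (cliff_rev y \<star> cliff_rev x) U"
  proof (cases "U \<subseteq> {..<n}")
    case False
    have "cliff_rev (x \<star> y) \<in> cliff n" "cliff_rev y \<star> cliff_rev x \<in> cliff n"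
      using x y by (auto intro: rev_cliff mult_cliff)
    with False show ?thesis by (simp only: cliff_outside not_False_eq_True)
  next
    case True
    then have U: "U \<in> Pow {..<n}" by simp
    have fU: "finite U" using finite_Pow_n[OF U] .
    have "(cliff_rev y \<star> cliff_rev x) U = (\<Sum>S\<in>Pow {..<n}.
        cliff_sign (sym_diff U S) (sym_diff (sym_diff U S) U) *
        cliff_rev y (sym_diff U S) * cliff_rev x (sym_diff (sym_diff U S) U))"
      unfolding cliff_mult_def by (rule sum.reindex_bij_betw[OF bij_sym_diff[OF U], symmetric])
    also have "\<dots> = (\<Sum>S\<in>Pow {..<n}. cliff_sign U U * (cliff_sign S (sym_diff S U) * x S * y (sym_diff S U)))"
    proof (intro sum.cong refl)
      fix S assume S: "S \<in> Pow {..<n}"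
      define T where "T = sym_diff S U"
      have eq: "sym_diff U S = T" "sym_diff T U = S" "U = sym_diff S T" by (auto simp: T_def)
      have fS: "finite S" and fT: "finite T" using S fU finite_Pow_n by (auto simp: T_def)
      have "cliff_sign U U = cliff_sign S S * cliff_sign S T * (cliff_sign T S * cliff_sign T T)"
        unfolding eq(3) using fS fT by (simp add: cliff_sign_sym_diff_left cliff_sign_sym_diff_right)
      then show "cliff_sign (sym_diff U S) (sym_diff (sym_diff U S) U) *
        cliff_rev y (sym_diff U S) * cliff_rev x (sym_diff (sym_diff U S) U) =
        cliff_sign U U * (cliff_sign S (sym_diff S U) * x S * y (sym_diff S U))"
        unfolding eq(1,2) T_def[symmetric] using fS fT by (simp add: rev_apply mult_ac)
    qed
    also have "\<dots> = cliff_rev (x \<star> y) U"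
      using fU by (simp add: rev_apply cliff_mult_def sum_distrib_left)
    finally show ?thesis by simp
  qed
qed

text \<open>
The coefficient at the empty set is a trace. It recovers the bilinear form on vectors
(\<open>trace_vec_elem_mult\<close>), which makes the vector representation orthogonal.
\<close>

lemma trace_mult_commute: "(x \<star> y) {} = (y \<star> x) {}"
  by (simp add: cliff_mult_def mult_ac)

lemma basis_elem_cliff: "S \<subseteq> {..<n} \<Longrightarrow> basis_elem S \<in> cliff n"
  by (auto simp: cliff_def basis_elem_def)

lemma one_cliff: "cliff_one \<in> cliff n"
  by (simp add: cliff_one_eq_basis_elem basis_elem_cliff)

lemma basis_elem_expansion: "x \<in> cliff n \<Longrightarrow> x = (\<Sum>S\<in>Pow {..<n}. cscale (x S) (basis_elem S))"
proof
  fix T assume "x \<in> cliff n"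
  then show "x T = (\<Sum>S\<in>Pow {..<n}. cscale (x S) (basis_elem S)) T"
    by (auto simp: sum_fun_apply basis_elem_def cliff_def if_distrib cong: if_cong)
qed

text \<open>
In the left regular representation, by matrices indexed by the subsets of \<open>{0, \<dots>, n - 1}\<close>, the
claim is that one-sided inverses of square matrices are two-sided.
\<close>

lemma left_inverse_imp_right_inverse:
  assumes x: "x \<in> cliff n" and y: "y \<in> cliff n" and xy: "x \<star> y = cliff_one"
  shows "y \<star> x = cliff_one"
proof -
  let ?N = "Pow {..<n}" and ?m = "card (Pow {..<n})"
  obtain f where f: "bij_betw f {0..<?m} ?N"
    using ex_bij_betw_nat_finite[of ?N] by auto
  define L where "L x = mat ?m ?m (\<lambda>(i, j). (x \<star> basis_elem (f j)) (f i))" for x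
  have L: "L x \<in> carrier_mat ?m ?m" for x by (simp add: L_def)
  have fN: "f i \<subseteq> {..<n}" if "i < ?m" for i using bij_betwE[OF f] that by auto
  have Lmult: "L (a \<star> b) = L a * L b" if "a \<in> cliff n" "b \<in> cliff n" for a b
  proof (rule eq_matI)
    fix i j assume "i < dim_row (L a * L b)" "j < dim_col (L a * L b)"
    then have ij: "i < ?m" "j < ?m" by (auto simp: L_def)
    have b: "b \<star> basis_elem (f j) \<in> cliff n" using that fN[OF ij(2)] by (intro mult_cliff basis_elem_cliff)
    have "(L a * L b) $$ (i, j) = (\<Sum>k = 0..<?m. (a \<star> basis_elem (f k)) (f i) * (b \<star> basis_elem (f j)) (f k))"
      using ij by (simp add: L_def scalar_prod_def)
    also have "\<dots> = (\<Sum>S\<in>?N. (a \<star> basis_elem S) (f i) * (b \<star> basis_elem (f j)) S)"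
      by (rule sum.reindex_bij_betw[OF f])
    also have "\<dots> = (a \<star> (\<Sum>S\<in>?N. cscale ((b \<star> basis_elem (f j)) S) (basis_elem S))) (f i)"
      by (simp add: mult_sum_right sum_fun_apply mult_ac)
    also have "(\<Sum>S\<in>?N. cscale ((b \<star> basis_elem (f j)) S) (basis_elem S)) = b \<star> basis_elem (f j)"
      using basis_elem_expansion[OF b] by simp
    finally show "L (a \<star> b) $$ (i, j) = (L a * L b) $$ (i, j)"
      using ij by (simp add: L_def mult_assoc)
  qed (simp_all add: L_def)
  have L1: "L cliff_one = 1\<^sub>m ?m"
    using f by (intro eq_matI) (auto simp: L_def basis_elem_def bij_betw_def inj_on_def)
  have "L x * L y = 1\<^sub>m ?m" using Lmult[OF x y] xy L1 by simp
  then have "L y * L x = 1\<^sub>m ?m" by (rule mat_mult_left_right_inverse[OF L L])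
  then have eq: "L (y \<star> x) = L cliff_one" using Lmult[OF y x] L1 by simp
  obtain j where j: "j < ?m" "f j = {}"
    using f unfolding bij_betw_def by (metis Pow_bottom atLeastLessThan_iff imageE)
  have yx: "y \<star> x \<in> cliff n" using x y by (rule mult_cliff[rotated])
  show ?thesis
  proof
    fix U
    show "(y \<star> x) U = cliff_one U"
    proof (cases "U \<subseteq> {..<n}")
      case True
      then obtain i where i: "i < ?m" "f i = U"
        using f unfolding bij_betw_def by (metis PowI atLeastLessThan_iff imageE)
      have "L (y \<star> x) $$ (i, j) = (y \<star> x) U" "L cliff_one $$ (i, j) = cliff_one U"
        using i j yx by (simp_all add: L_def one_cliff flip: cliff_one_eq_basis_elem)
      then show ?thesis using eq by simp
    next
      case False
      then show ?thesis by (simp only: cliff_outside[OF yx] cliff_outside[OF one_cliff] not_False_eq_True)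
    qed
  qed
qed

end

section \<open>Vectors and the vector representation\<close>

lemma mat_eq_by_action:
  fixes A B :: "complex mat"
  assumes A: "A \<in> carrier_mat n n" and B: "B \<in> carrier_mat n n"
    and eq: "\<And>v. v \<in> carrier_vec n \<Longrightarrow> A *\<^sub>v v = B *\<^sub>v v"
  shows "A = B"
proof (rule eq_matI)
  fix i j assume "i < dim_row B" "j < dim_col B"
  then have ij: "i < n" "j < n" using B by auto
  have "(A *\<^sub>v unit_vec n j) $ i = (B *\<^sub>v unit_vec n j) $ i" by (simp add: eq)
  then show "A $$ (i, j) = B $$ (i, j)" using A B ij by simp
qed (use A B in auto)

text \<open>
The vector \<open>\<Sum>i. v\<^sub>i e\<^sub>i\<close> of the Clifford algebra; \<open>coords\<close> is the inverse map.
\<close>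

definition vec_elem :: "complex vec \<Rightarrow> clifford" where
  "vec_elem v = (\<Sum>i<dim_vec v. cscale (v $ i) (basis_elem {i}))"

definition coords :: "nat \<Rightarrow> clifford \<Rightarrow> complex vec" where
  "coords n x = vec n (\<lambda>i. x {i})"

text \<open>
The matrix of \<open>v \<mapsto> x v x\<^sup>*\<close> in the basis \<open>e\<^sub>0, \<dots>, e\<^bsub>n-1\<^esub>\<close>, where \<open>x\<^sup>*\<close> is the reversal of \<open>x\<close>.
\<close>

definition vector_rep :: "nat \<Rightarrow> clifford \<Rightarrow> complex mat" where
  "vector_rep n x = mat n n (\<lambda>(i, j). cliff_mult n (cliff_mult n x (basis_elem {j})) (cliff_rev x) {i})"

lemma vector_rep_carrier [simp]: "vector_rep n x \<in> carrier_mat n n"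
  by (simp add: vector_rep_def)

lemma vector_rep_dim [simp]: "dim_row (vector_rep n x) = n" "dim_col (vector_rep n x) = n"
  by (simp_all add: vector_rep_def)

lemma vec_elem_apply: "vec_elem v S = (\<Sum>i<dim_vec v. if S = {i} then v $ i else 0)"
  by (auto simp: vec_elem_def sum_fun_apply basis_elem_def intro!: sum.cong)

lemma vec_elem_singleton: "vec_elem v {i} = (if i < dim_vec v then v $ i else 0)"
proof -
  have "vec_elem v {i} = (\<Sum>j<dim_vec v. if j = i then v $ i else 0)"
    unfolding vec_elem_apply by (intro sum.cong) auto
  then show ?thesis by simp
qed

lemma vec_elem_nonsingleton: "\<nexists>i. i < dim_vec v \<and> S = {i} \<Longrightarrow> vec_elem v S = 0"
  unfolding vec_elem_apply by (rule sum.neutral) (auto split: if_split)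

lemma vec_elem_smult: "vec_elem (c \<cdot>\<^sub>v v) = cscale c (vec_elem v)"
  by (rule ext) (auto simp: vec_elem_apply sum_distrib_left intro!: sum.cong)

lemma vec_elem_diff: "v \<in> carrier_vec n \<Longrightarrow> w \<in> carrier_vec n \<Longrightarrow> vec_elem (v - w) = vec_elem v - vec_elem w"
  by (rule ext) (auto simp: vec_elem_apply simp flip: sum_subtractf intro!: sum.cong)

lemma vec_elem_vectors: "v \<in> carrier_vec n \<Longrightarrow> vec_elem v \<in> cliff_vectors n"
  using vec_elem_nonsingleton[of v] unfolding cliff_vectors_def carrier_vec_def by blast

lemma coords_vec_elem: "v \<in> carrier_vec n \<Longrightarrow> coords n (vec_elem v) = v"
  by (intro eq_vecI) (auto simp: coords_def vec_elem_singleton)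

lemma coords_carrier [simp]: "coords n x \<in> carrier_vec n"
  by (simp add: coords_def)

lemma vec_elem_coords:
  assumes "x \<in> cliff_vectors n"
  shows "vec_elem (coords n x) = x"
proof
  fix S
  show "vec_elem (coords n x) S = x S"
  proof (cases "\<exists>i<n. S = {i}")
    case True
    then show ?thesis by (auto simp: vec_elem_singleton coords_def)
  next
    case False
    then have "x S = 0" using assms by (auto simp: cliff_vectors_def)
    moreover have "vec_elem (coords n x) S = 0"
      using False by (intro vec_elem_nonsingleton) (auto simp: coords_def)
    ultimately show ?thesis by simp
  qed
qed

lemma vec_elem_unit_vec: "j < n \<Longrightarrow> vec_elem (unit_vec n j) = basis_elem {j}"
proof
  fix S assume j: "j < n"
  have "vec_elem (unit_vec n j) S = (\<Sum>i<n. if i = j then (if S = {j} then 1 else 0) else 0)"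
    unfolding vec_elem_apply by (intro sum.cong) (auto simp: unit_vec_def)
  also have "\<dots> = basis_elem {j} S" using j by (simp add: basis_elem_def)
  finally show "vec_elem (unit_vec n j) S = basis_elem {j} S" .
qed

context clifford_algebra
begin

lemma vectors_parity: "x \<in> cliff_vectors n \<Longrightarrow> x \<in> cliff_parity n False"
  by (fastforce simp: cliff_vectors_def cliff_parity_def cliff_def)

lemma vectors_cliff: "x \<in> cliff_vectors n \<Longrightarrow> x \<in> cliff n"
  by (rule parity_cliff[OF vectors_parity])

lemma vec_elem_cliff: "v \<in> carrier_vec n \<Longrightarrow> vec_elem v \<in> cliff n"
  by (rule vectors_cliff[OF vec_elem_vectors])

lemma basis_elem_anticommute:
  assumes "i < n" "j < n"
  shows "basis_elem {i} \<star> basis_elem {j} + basis_elem {j} \<star> basis_elem {i} = cscale (if i = j then 2 else 0) cliff_one"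
proof -
  have sgn: "cliff_sign {a} {b} = (if b < a then - 1 else 1)" for a b
  proof -
    have "{(i, j). i \<in> {a} \<and> j \<in> {b} \<and> j < i} = (if b < a then {(a, b)} else {})" by auto
    then show ?thesis by (simp add: cliff_sign_def)
  qed
  have "sym_diff {i} {j} = sym_diff {j} {i}" by auto
  then show ?thesis
    using assms by (cases "i = j") (auto simp: basis_elem_mult_basis_elem sgn cliff_one_eq_basis_elem fun_eq_iff)
qed

lemma vec_elem_mult: "v \<in> carrier_vec n \<Longrightarrow> vec_elem v \<star> y = (\<Sum>i<n. cscale (v $ i) (basis_elem {i} \<star> y))"
  by (simp add: vec_elem_def mult_sum_left)

lemma mult_vec_elem: "v \<in> carrier_vec n \<Longrightarrow> y \<star> vec_elem v = (\<Sum>i<n. cscale (v $ i) (y \<star> basis_elem {i}))"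
  by (simp add: vec_elem_def mult_sum_right)

lemma cscale_sum: "cscale c (\<Sum>i\<in>A. f i) = (\<Sum>i\<in>A. cscale c (f i))"
  by (simp add: fun_eq_iff sum_fun_apply sum_distrib_left)

text \<open>
The Clifford relation for arbitrary vectors.
\<close>

lemma vec_elem_anticommute:
  assumes v: "v \<in> carrier_vec n" and w: "w \<in> carrier_vec n"
  shows "vec_elem v \<star> vec_elem w + vec_elem w \<star> vec_elem v = cscale (2 * (v \<bullet> w)) cliff_one"
proof -
  have "vec_elem v \<star> vec_elem w = (\<Sum>i<n. cscale (v $ i) (basis_elem {i} \<star> vec_elem w))"
    by (rule vec_elem_mult[OF v])
  also have "\<dots> = (\<Sum>i<n. \<Sum>j<n. cscale (v $ i * w $ j) (basis_elem {i} \<star> basis_elem {j}))"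
    by (simp add: mult_vec_elem[OF w] cscale_sum)
  finally have 1: "vec_elem v \<star> vec_elem w = (\<Sum>i<n. \<Sum>j<n. cscale (v $ i * w $ j) (basis_elem {i} \<star> basis_elem {j}))" .
  have "vec_elem w \<star> vec_elem v = (\<Sum>i<n. cscale (v $ i) (vec_elem w \<star> basis_elem {i}))"
    by (rule mult_vec_elem[OF v])
  also have "\<dots> = (\<Sum>i<n. \<Sum>j<n. cscale (v $ i * w $ j) (basis_elem {j} \<star> basis_elem {i}))"
    by (simp add: vec_elem_mult[OF w] cscale_sum)
  finally have "vec_elem v \<star> vec_elem w + vec_elem w \<star> vec_elem v
      = (\<Sum>i<n. \<Sum>j<n. cscale (v $ i * w $ j) (basis_elem {i} \<star> basis_elem {j} + basis_elem {j} \<star> basis_elem {i}))"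
    using 1 by (simp add: cscale_add sum.distrib)
  also have "\<dots> = (\<Sum>i<n. \<Sum>j<n. cscale (if i = j then 2 * (v $ i * w $ i) else 0) cliff_one)"
    by (intro sum.cong refl) (auto simp: basis_elem_anticommute)
  also have "\<dots> = cscale (\<Sum>i<n. \<Sum>j<n. if i = j then 2 * (v $ i * w $ i) else 0) cliff_one"
    by (rule ext) (simp only: sum_fun_apply cscale_apply sum_distrib_right)
  also have "(\<Sum>i<n. \<Sum>j<n. if i = j then 2 * (v $ i * w $ i) else 0) = 2 * (v \<bullet> w)"
    using w by (simp add: scalar_prod_def sum_distrib_left lessThan_atLeast0)
  finally show ?thesis .
qed

lemma vec_elem_square:
  assumes "v \<in> carrier_vec n"
  shows "vec_elem v \<star> vec_elem v = cscale (v \<bullet> v) cliff_one"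
proof
  fix S
  show "(vec_elem v \<star> vec_elem v) S = cscale (v \<bullet> v) cliff_one S"
    using fun_cong[OF vec_elem_anticommute[OF assms assms], of S] by simp
qed

lemma trace_vec_elem_mult:
  assumes v: "v \<in> carrier_vec n" and w: "w \<in> carrier_vec n"
  shows "(vec_elem v \<star> vec_elem w) {} = v \<bullet> w"
  using fun_cong[OF vec_elem_anticommute[OF assms], of "{}"] trace_mult_commute[of "vec_elem v" "vec_elem w"]
  by (simp add: cliff_one_def)

lemma vector_rep_mult_vec:
  assumes v: "v \<in> carrier_vec n"
  shows "vector_rep n x *\<^sub>v v = coords n (x \<star> vec_elem v \<star> cliff_rev x)"
proof (rule eq_vecI)
  fix i assume "i < dim_vec (coords n (x \<star> vec_elem v \<star> cliff_rev x))"
  then have i: "i < n" by (simp add: coords_def)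
  have "(vector_rep n x *\<^sub>v v) $ i = (\<Sum>j<n. (x \<star> basis_elem {j} \<star> cliff_rev x) {i} * v $ j)"
    using v i by (simp add: vector_rep_def scalar_prod_def lessThan_atLeast0)
  also have "\<dots> = (x \<star> vec_elem v \<star> cliff_rev x) {i}"
    by (simp add: mult_vec_elem[OF v] mult_sum_left sum_fun_apply mult_ac)
  finally show "(vector_rep n x *\<^sub>v v) $ i = coords n (x \<star> vec_elem v \<star> cliff_rev x) $ i"
    using i by (simp add: coords_def)
qed (simp add: coords_def)

lemma spin_setD:
  assumes "x \<in> spin_set n"
  shows "x \<in> cliff_parity n True" "x \<in> cliff n" "cliff_rev x \<in> cliff n"
    "x \<star> cliff_rev x = cliff_one" "cliff_rev x \<star> x = cliff_one"
    "\<And>y. x \<star> (cliff_rev x \<star> y) = y" "\<And>y. cliff_rev x \<star> (x \<star> y) = y"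
    "v \<in> cliff_vectors n \<Longrightarrow> x \<star> v \<star> cliff_rev x \<in> cliff_vectors n"
proof -
  show p: "x \<in> cliff_parity n True" using assms by (auto simp: spin_set_def cliff_even_def cliff_parity_def)
  then show c: "x \<in> cliff n" by (rule parity_cliff)
  then show c': "cliff_rev x \<in> cliff n" by (rule rev_cliff)
  show 1: "x \<star> cliff_rev x = cliff_one" using assms by (auto simp: spin_set_def)
  show 2: "cliff_rev x \<star> x = cliff_one" by (rule left_inverse_imp_right_inverse[OF c c' 1])
  show "x \<star> (cliff_rev x \<star> y) = y" for y by (simp add: 1 flip: mult_assoc)
  show "cliff_rev x \<star> (x \<star> y) = y" for y by (simp add: 2 flip: mult_assoc)
  show "v \<in> cliff_vectors n \<Longrightarrow> x \<star> v \<star> cliff_rev x \<in> cliff_vectors n"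
    using assms by (auto simp: spin_set_def)
qed

lemma spin_setI:
  assumes "x \<in> cliff_parity n True" "x \<star> cliff_rev x = cliff_one"
    "\<And>v. v \<in> carrier_vec n \<Longrightarrow> x \<star> vec_elem v \<star> cliff_rev x \<in> cliff_vectors n"
  shows "x \<in> spin_set n"
proof -
  have "x \<star> v \<star> cliff_rev x \<in> cliff_vectors n" if "v \<in> cliff_vectors n" for v
    using assms(3)[OF coords_carrier[of n v]] unfolding vec_elem_coords[OF that] .
  moreover have "x \<in> cliff_even n"
    using assms(1) unfolding cliff_even_def cliff_parity_def by blast
  ultimately show ?thesis using assms(2) unfolding spin_set_def by blast
qed

lemma vec_elem_vector_rep:
  assumes "x \<in> spin_set n" "v \<in> carrier_vec n"
  shows "vec_elem (vector_rep n x *\<^sub>v v) = x \<star> vec_elem v \<star> cliff_rev x"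
  using assms by (simp add: vector_rep_mult_vec vec_elem_coords spin_setD(8) vec_elem_vectors)

lemma vector_rep_mult:
  assumes x: "x \<in> spin_set n" and y: "y \<in> spin_set n"
  shows "vector_rep n (x \<star> y) = vector_rep n x * vector_rep n y"
proof (rule mat_eq_by_action[of _ n])
  fix v :: "complex vec" assume v: "v \<in> carrier_vec n"
  have "vector_rep n x *\<^sub>v (vector_rep n y *\<^sub>v v) = coords n (x \<star> (y \<star> vec_elem v \<star> cliff_rev y) \<star> cliff_rev x)"
    using vector_rep_mult_vec[of "vector_rep n y *\<^sub>v v" x] vec_elem_vector_rep[OF y v] mult_mat_vec_carrier[OF vector_rep_carrier v]
    by simp
  also have "x \<star> (y \<star> vec_elem v \<star> cliff_rev y) \<star> cliff_rev x = x \<star> y \<star> vec_elem v \<star> cliff_rev (x \<star> y)"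
    using spin_setD(2)[OF x] spin_setD(2)[OF y] by (simp add: rev_mult mult_assoc)
  finally show "vector_rep n (x \<star> y) *\<^sub>v v = vector_rep n x * vector_rep n y *\<^sub>v v"
    using vector_rep_mult_vec[OF v, of "x \<star> y"] assoc_mult_mat_vec[OF vector_rep_carrier vector_rep_carrier v, of x y]
    by simp
qed (use mult_carrier_mat[OF vector_rep_carrier vector_rep_carrier] in auto)

lemma vector_rep_one: "vector_rep n cliff_one = 1\<^sub>m n"
  by (rule mat_eq_by_action[of _ n]) (simp_all add: vector_rep_mult_vec mult_one[OF vec_elem_cliff] coords_vec_elem)

text \<open>
The form is the trace of a product of vectors, and
\<open>tr (x v x\<^sup>* x w x\<^sup>*) = tr (x v w x\<^sup>*) = tr (v w)\<close> because \<open>x\<^sup>* x = 1\<close> and the trace is cyclic.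
\<close>

lemma vector_rep_orth:
  assumes x: "x \<in> spin_set n"
  shows "orth_mat n (vector_rep n x)"
proof -
  have "transpose_mat (vector_rep n x) * vector_rep n x = 1\<^sub>m n"
  proof (rule eq_matI)
    fix i j assume "i < dim_row (1\<^sub>m n :: complex mat)" "j < dim_col (1\<^sub>m n :: complex mat)"
    then have ij: "i < n" "j < n" by auto
    let ?c = "col (vector_rep n x)"
    have c1: "?c j \<in> carrier_vec n" for j
      using col_dim[of "vector_rep n x" j] by simp
    have c2: "vec_elem (?c j) = x \<star> basis_elem {j} \<star> cliff_rev x" if "j < n" for j
    proof -
      have "?c j = vector_rep n x *\<^sub>v unit_vec n j"
        using that by (intro eq_vecI) simp_all
      then show ?thesis
        using vec_elem_vector_rep[OF x unit_vec_carrier] that by (simp add: vec_elem_unit_vec)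
    qed
    note c = c1 c2
    have "(transpose_mat (vector_rep n x) * vector_rep n x) $$ (i, j) = ?c i \<bullet> ?c j"
      using ij by simp
    also have "\<dots> = (vec_elem (?c i) \<star> vec_elem (?c j)) {}"
      by (rule trace_vec_elem_mult[OF c1 c1, symmetric])
    also have "\<dots> = (x \<star> (basis_elem {i} \<star> basis_elem {j} \<star> cliff_rev x)) {}"
      using c ij by (simp add: mult_assoc spin_setD(7)[OF x])
    also have "\<dots> = (basis_elem {i} \<star> basis_elem {j} \<star> (cliff_rev x \<star> x)) {}"
      unfolding trace_mult_commute[of x] by (simp add: mult_assoc)
    also have "\<dots> = (vec_elem (unit_vec n i) \<star> vec_elem (unit_vec n j)) {}"
      using ij by (simp add: spin_setD(5)[OF x] mult_assoc basis_elem_cliff vec_elem_unit_vec)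
    also have "\<dots> = unit_vec n i \<bullet> unit_vec n j" by (rule trace_vec_elem_mult) auto
    also have "\<dots> = 1\<^sub>m n $$ (i, j)" using ij by simp
    finally show "(transpose_mat (vector_rep n x) * vector_rep n x) $$ (i, j) = 1\<^sub>m n $$ (i, j)" .
  qed auto
  then show ?thesis by (simp add: orth_mat_def)
qed

lemma spin_one: "cliff_one \<in> spin_set n"
proof (rule spin_setI)
  show "cliff_one \<in> cliff_parity n True"
    using one_cliff by (auto simp: cliff_parity_def cliff_one_def)
qed (simp_all add: mult_one[OF vec_elem_cliff] vec_elem_vectors)

lemma spin_mult:
  assumes x: "x \<in> spin_set n" and y: "y \<in> spin_set n"
  shows "x \<star> y \<in> spin_set n"
proof (rule spin_setI)
  note X = spin_setD[OF x] and Y = spin_setD[OF y]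
  show "x \<star> y \<in> cliff_parity n True" using mult_parity[OF X(1) Y(1)] by simp
  show "x \<star> y \<star> cliff_rev (x \<star> y) = cliff_one"
    using X Y by (simp add: rev_mult mult_assoc)
  fix v :: "complex vec" assume "v \<in> carrier_vec n"
  then have "x \<star> (y \<star> vec_elem v \<star> cliff_rev y) \<star> cliff_rev x \<in> cliff_vectors n"
    by (intro X(8) Y(8) vec_elem_vectors)
  then show "x \<star> y \<star> vec_elem v \<star> cliff_rev (x \<star> y) \<in> cliff_vectors n"
    using X Y by (simp add: rev_mult mult_assoc)
qed

text \<open>
The inverse \<open>x\<^sup>*\<close> maps vectors to vectors because the action of \<open>x\<close> on vectors, being given by an
orthogonal matrix, is surjective.
\<close>

lemma spin_rev:
  assumes x: "x \<in> spin_set n"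
  shows "cliff_rev x \<in> spin_set n"
proof (rule spin_setI)
  note X = spin_setD[OF x]
  show "cliff_rev x \<in> cliff_parity n True" by (rule rev_parity[OF X(1)])
  show "cliff_rev x \<star> cliff_rev (cliff_rev x) = cliff_one" by (simp add: X(5))
  fix v :: "complex vec" assume v: "v \<in> carrier_vec n"
  note O = orth_matD[OF vector_rep_orth[OF x]]
  define w where "w = transpose_mat (vector_rep n x) *\<^sub>v v"
  have w: "w \<in> carrier_vec n" unfolding w_def by (rule mult_mat_vec_carrier[OF O(2) v])
  have "vector_rep n x *\<^sub>v w = v"
    unfolding w_def assoc_mult_mat_vec[OF O(1,2) v, symmetric] O(4) using v by simp
  then have "vec_elem v = x \<star> vec_elem w \<star> cliff_rev x" using vec_elem_vector_rep[OF x w] by simp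
  then have "cliff_rev x \<star> vec_elem v \<star> cliff_rev (cliff_rev x) = vec_elem w"
    using X(5,7) w by (simp add: mult_assoc mult_one[OF vec_elem_cliff])
  then show "cliff_rev x \<star> vec_elem v \<star> cliff_rev (cliff_rev x) \<in> cliff_vectors n"
    using w by (simp add: vec_elem_vectors)
qed

text \<open>
If \<open>h\<close> acts as \<open>e = \<plusminus>1\<close> on vectors, then \<open>h e\<^sub>i = e e\<^sub>i h\<close>. Passing \<open>h\<close> through a product of an even number
of vectors produces an even power of \<open>e\<close>.
\<close>

lemma vector_rep_scalar_imp_commutes_even:
  assumes h: "h \<in> spin_set n" and e: "e = 1 \<or> e = - 1" and vector_rep: "vector_rep n h = e \<cdot>\<^sub>m 1\<^sub>m n"
    and y: "y \<in> cliff_parity n True"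
  shows "h \<star> y = y \<star> h"
proof -
  have gen: "h \<star> basis_elem {i} = cscale e (basis_elem {i} \<star> h)" if "i < n" for i
  proof -
    have "vector_rep n h *\<^sub>v unit_vec n i = e \<cdot>\<^sub>v unit_vec n i"
      unfolding vector_rep using that by (intro eq_vecI) auto
    then have "h \<star> basis_elem {i} \<star> cliff_rev h = cscale e (basis_elem {i})"
      using vec_elem_vector_rep[OF h, of "unit_vec n i"] that by (simp add: vec_elem_smult vec_elem_unit_vec)
    then have "h \<star> basis_elem {i} \<star> cliff_rev h \<star> h = cscale e (basis_elem {i} \<star> h)" by simp
    then show ?thesis using that by (simp add: mult_assoc spin_setD(5)[OF h] mult_one[OF basis_elem_cliff])
  qed
  have comm: "h \<star> basis_elem S = cscale (e ^ card S) (basis_elem S \<star> h)" if "S \<subseteq> {..<n}" for S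
  proof -
    define Q where "Q S \<longleftrightarrow> h \<star> basis_elem S = cscale (e ^ card S) (basis_elem S \<star> h)" for S
    have "finite S" using that finite_subset by blast
    then have "Q S" using that
    proof (induction S rule: finite_induct)
      case empty
      have "h \<star> basis_elem {} = h" "basis_elem {} \<star> h = h"
        using mult_one[OF spin_setD(2)[OF h]] one_mult[of h] by (simp_all only: cliff_one_eq_basis_elem)
      then show ?case by (simp add: Q_def)
    next
      case (insert i S)
      have IH: "h \<star> basis_elem S = cscale (e ^ card S) (basis_elem S \<star> h)" using insert by (simp add: Q_def)
      have "sym_diff {i} S = insert i S" using insert by auto
      then have "basis_elem {i} \<star> basis_elem S = cscale (cliff_sign {i} S) (basis_elem (insert i S))"
        using insert by (subst basis_elem_mult_basis_elem) auto
      then have "cscale (cliff_sign {i} S) (basis_elem {i} \<star> basis_elem S) = basis_elem (insert i S)" by simp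
      then have b: "basis_elem (insert i S) = cscale (cliff_sign {i} S) (basis_elem {i} \<star> basis_elem S)" ..
      have "h \<star> basis_elem (insert i S) = cscale (cliff_sign {i} S) (h \<star> basis_elem {i} \<star> basis_elem S)"
        by (simp add: b mult_assoc)
      also have "\<dots> = cscale (cliff_sign {i} S * e) (basis_elem {i} \<star> (h \<star> basis_elem S))"
        using insert by (simp add: gen mult_assoc)
      also have "\<dots> = cscale (e ^ card (insert i S)) (basis_elem (insert i S) \<star> h)"
        unfolding IH b using insert by (simp add: mult_assoc mult_ac)
      finally show ?case by (simp only: Q_def)
    qed
    then show ?thesis by (simp only: Q_def)
  qed
  have "h \<star> y = (\<Sum>S\<in>Pow {..<n}. cscale (y S) (h \<star> basis_elem S))"
    by (subst basis_elem_expansion[OF parity_cliff[OF y]]) (simp add: mult_sum_right)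
  also have "\<dots> = (\<Sum>S\<in>Pow {..<n}. cscale (y S) (basis_elem S \<star> h))"
  proof (rule sum.cong[OF refl])
    fix S assume S: "S \<in> Pow {..<n}"
    show "cscale (y S) (h \<star> basis_elem S) = cscale (y S) (basis_elem S \<star> h)"
    proof (cases "y S = 0")
      case False
      then have "even (card S)" using y by (auto simp: cliff_parity_def)
      then have "e ^ card S = 1" using e by auto
      then show ?thesis using comm[of S] S by simp
    qed simp
  qed
  also have "\<dots> = y \<star> h"
    by (subst (2) basis_elem_expansion[OF parity_cliff[OF y]]) (simp add: mult_sum_left)
  finally show ?thesis .
qed

section \<open>Half-turns\<close>

text \<open>
Moving \<open>e\<^sub>i\<close> through \<open>e\<^sub>0 \<dots> e\<^bsub>n-1\<^esub>\<close> costs a sign for each of the \<open>n - 1\<close> other factors.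
\<close>

lemma volume_central:
  assumes "odd n" and v: "v \<in> carrier_vec n"
  shows "basis_elem {..<n} \<star> vec_elem v = vec_elem v \<star> basis_elem {..<n}"
proof -
  have "basis_elem {..<n} \<star> basis_elem {i} = basis_elem {i} \<star> basis_elem {..<n}" if "i < n" for i
  proof -
    have "{(a, b). a \<in> {..<n} \<and> b \<in> {i} \<and> b < a} = (\<lambda>a. (a, i)) ` {i<..<n}" by auto
    then have 1: "cliff_sign {..<n} {i} = (- 1) ^ (n - Suc i)"
      by (simp add: cliff_sign_def card_image inj_on_def)
    have "{(a, b). a \<in> {i} \<and> b \<in> {..<n} \<and> b < a} = Pair i ` {..<i}" using that by auto
    then have 2: "cliff_sign {i} {..<n} = (- 1) ^ i"
      by (simp add: cliff_sign_def card_image inj_on_def)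
    have "even (n - Suc i) \<longleftrightarrow> even i" using \<open>odd n\<close> that by auto
    then have "cliff_sign {..<n} {i} = cliff_sign {i} {..<n}"
      unfolding 1 2 by (cases "even i") auto
    moreover have "sym_diff {..<n} {i} = sym_diff {i} {..<n}" by auto
    ultimately show ?thesis using that by (simp add: basis_elem_mult_basis_elem)
  qed
  then show ?thesis by (simp add: vec_elem_mult[OF v] mult_vec_elem[OF v])
qed

lemma volume_rev: "basis_elem {..<n} \<star> cliff_rev (basis_elem {..<n}) = cliff_one"
proof -
  have "cliff_rev (basis_elem {..<n}) = cscale (cliff_sign {..<n} {..<n}) (basis_elem {..<n})"
    by (auto simp: fun_eq_iff cliff_rev_def basis_elem_def cliff_sign_self)
  then show ?thesis by (simp add: basis_elem_mult_basis_elem cliff_one_eq_basis_elem)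
qed

text \<open>
The volume element has odd degree and commutes with vectors, so multiplying the unit vector \<open>u\<close> by it
gives an even element that acts in the same way as \<open>u\<close>, namely by \<open>w \<mapsto> u w u = 2 (u \<bullet> w) u - w\<close>.
\<close>

lemma half_turn_lift:
  assumes n: "odd n" and u: "u \<in> carrier_vec n" "u \<bullet> u = 1"
  defines "g \<equiv> vec_elem u \<star> basis_elem {..<n}"
  shows "g \<in> spin_set n"
    "w \<in> carrier_vec n \<Longrightarrow> vector_rep n g *\<^sub>v w = (2 * (u \<bullet> w)) \<cdot>\<^sub>v u - w"
proof -
  let ?o = "basis_elem {..<n}"
  have o: "?o \<in> cliff_parity n False"
    using n basis_elem_cliff[of "{..<n}"] by (auto simp: cliff_parity_def basis_elem_def)
  have g: "g \<in> cliff_parity n True"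
    unfolding g_def using mult_parity[OF vectors_parity[OF vec_elem_vectors[OF u(1)]] o] by simp
  have rev: "cliff_rev g = cliff_rev ?o \<star> vec_elem u"
    unfolding g_def using rev_mult[OF vec_elem_cliff[OF u(1)] parity_cliff[OF o]]
    by (simp add: rev_vector[OF vec_elem_vectors[OF u(1)]])
  have cancel: "?o \<star> (cliff_rev ?o \<star> y) = y" for y
    by (simp add: volume_rev flip: mult_assoc)
  have uu: "vec_elem u \<star> vec_elem u = cliff_one" using vec_elem_square[OF u(1)] u(2) by simp
  have conj: "g \<star> vec_elem w \<star> cliff_rev g = vec_elem ((2 * (u \<bullet> w)) \<cdot>\<^sub>v u - w)"
    if w: "w \<in> carrier_vec n" for w
  proof -
    have "g \<star> vec_elem w \<star> cliff_rev g = vec_elem u \<star> (?o \<star> vec_elem w) \<star> (cliff_rev ?o \<star> vec_elem u)"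
      unfolding rev unfolding g_def by (simp add: mult_assoc)
    also have "\<dots> = vec_elem u \<star> vec_elem w \<star> vec_elem u"
      unfolding volume_central[OF n w] by (simp add: mult_assoc cancel)
    also have "vec_elem u \<star> vec_elem w = cscale (2 * (u \<bullet> w)) cliff_one - vec_elem w \<star> vec_elem u"
      unfolding vec_elem_anticommute[OF u(1) w, symmetric] by simp
    also have "\<dots> \<star> vec_elem u = cscale (2 * (u \<bullet> w)) (vec_elem u) - vec_elem w"
      by (simp add: mult_diff_left mult_assoc uu mult_one[OF vec_elem_cliff[OF w]])
    finally show ?thesis using u(1) w by (simp add: vec_elem_diff[of _ n] vec_elem_smult)
  qed
  show "g \<in> spin_set n"
  proof (rule spin_setI[OF g])
    show "g \<star> cliff_rev g = cliff_one"
      unfolding rev unfolding g_def by (simp add: mult_assoc cancel uu)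
    show "g \<star> vec_elem v \<star> cliff_rev g \<in> cliff_vectors n" if "v \<in> carrier_vec n" for v
      unfolding conj[OF that] using u that by (intro vec_elem_vectors) auto
  qed
  show "vector_rep n g *\<^sub>v w = (2 * (u \<bullet> w)) \<cdot>\<^sub>v u - w" if w: "w \<in> carrier_vec n"
    unfolding vector_rep_mult_vec[OF w] conj[OF w] using u(1) w by (intro coords_vec_elem) auto
qed

end

section \<open>Lifting orthogonal matrices to the spin group\<close>

text \<open>
For a unit vector \<open>u\<close>, the reflection in the hyperplane orthogonal to \<open>u\<close>.
\<close>

definition refl_mat :: "nat \<Rightarrow> complex vec \<Rightarrow> complex mat" where
  "refl_mat n u = mat n n (\<lambda>(i, j). (if i = j then 1 else 0) - 2 * u $ i * u $ j)"

lemma refl_mat_carrier [simp]: "refl_mat n u \<in> carrier_mat n n"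
  by (simp add: refl_mat_def)

lemma refl_mat_mult_vec:
  assumes u: "u \<in> carrier_vec n" and w: "w \<in> carrier_vec n"
  shows "refl_mat n u *\<^sub>v w = w - (2 * (u \<bullet> w)) \<cdot>\<^sub>v u"
proof (rule eq_vecI)
  fix i assume "i < dim_vec (w - (2 * (u \<bullet> w)) \<cdot>\<^sub>v u)"
  then have i: "i < n" using u by simp
  have "(refl_mat n u *\<^sub>v w) $ i = (\<Sum>j<n. ((if i = j then 1 else 0) - 2 * u $ i * u $ j) * w $ j)"
    using w i by (simp add: refl_mat_def scalar_prod_def lessThan_atLeast0)
  also have "\<dots> = (\<Sum>j<n. (if i = j then w $ i else 0) - 2 * u $ i * (u $ j * w $ j))"
    by (rule sum.cong) (auto simp: algebra_simps)
  also have "\<dots> = w $ i - 2 * u $ i * (u \<bullet> w)"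
    using i w by (simp add: sum_subtractf scalar_prod_def lessThan_atLeast0 flip: sum_distrib_left)
  also have "\<dots> = (w - (2 * (u \<bullet> w)) \<cdot>\<^sub>v u) $ i"
    using u w i by simp
  finally show "(refl_mat n u *\<^sub>v w) $ i = (w - (2 * (u \<bullet> w)) \<cdot>\<^sub>v u) $ i" .
qed (use u in \<open>simp add: refl_mat_def\<close>)

lemma orth_mat_scalar_prod:
  assumes "orth_mat n P" "v \<in> carrier_vec n" "w \<in> carrier_vec n"
  shows "(P *\<^sub>v v) \<bullet> (P *\<^sub>v w) = v \<bullet> w"
proof -
  note p = orth_matD[OF assms(1)]
  have Pv: "P *\<^sub>v v \<in> carrier_vec n" using p assms by simp
  have "(P *\<^sub>v v) \<bullet> (P *\<^sub>v w) = (transpose_mat P *\<^sub>v (P *\<^sub>v v)) \<bullet> w"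
    by (rule transpose_vec_mult_scalar[OF p(1) assms(3) Pv, symmetric])
  also have "transpose_mat P *\<^sub>v (P *\<^sub>v v) = v"
    unfolding assoc_mult_mat_vec[OF p(2,1) assms(2), symmetric] p(3) using assms by simp
  finally show ?thesis .
qed

lemma refl_mat_orth:
  assumes u: "u \<in> carrier_vec n" "u \<bullet> u = 1"
  shows "orth_mat n (refl_mat n u)"
proof -
  have "transpose_mat (refl_mat n u) = refl_mat n u"
    by (intro eq_matI) (auto simp: refl_mat_def)
  moreover have "refl_mat n u * refl_mat n u = 1\<^sub>m n"
  proof (rule mat_eq_by_action[of _ n])
    fix v :: "complex vec" assume v: "v \<in> carrier_vec n"
    let ?c = "2 * (u \<bullet> v)"
    have w: "v - ?c \<cdot>\<^sub>v u \<in> carrier_vec n" using u v by simp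
    have "u \<bullet> (v - ?c \<cdot>\<^sub>v u) = - (u \<bullet> v)"
      using u v by (simp add: scalar_prod_minus_distrib[of _ n])
    then have "refl_mat n u *\<^sub>v (refl_mat n u *\<^sub>v v) = v"
      using u v w by (simp add: refl_mat_mult_vec) (intro eq_vecI, auto)
    then show "refl_mat n u * refl_mat n u *\<^sub>v v = 1\<^sub>m n *\<^sub>v v"
      using v assoc_mult_mat_vec[OF refl_mat_carrier refl_mat_carrier v, of u u] by simp
  qed (use mult_carrier_mat[OF refl_mat_carrier refl_mat_carrier] in auto)
  ultimately show ?thesis by (simp add: orth_mat_def)
qed

text \<open>
Two distinct unit vectors are exchanged by the reflection along their difference, provided that the
difference is not isotropic; this is the meaning of \<open>w \<bullet> e \<noteq> 1\<close>.
\<close>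

lemma ex_refl_mat_exchange:
  assumes w: "w \<in> carrier_vec n" "w \<bullet> w = 1" and e: "e \<in> carrier_vec n" "e \<bullet> e = 1"
    and ne: "w \<bullet> e \<noteq> 1"
  shows "\<exists>u. u \<in> carrier_vec n \<and> u \<bullet> u = 1 \<and> refl_mat n u *\<^sub>v w = e \<and>
    (\<forall>v\<in>carrier_vec n. v \<bullet> w = 0 \<longrightarrow> v \<bullet> e = 0 \<longrightarrow> refl_mat n u *\<^sub>v v = v)"
proof -
  define d where "d = w - e"
  have d: "d \<in> carrier_vec n" using w e by (simp add: d_def)
  have ew: "e \<bullet> w = w \<bullet> e" by (rule comm_scalar_prod[OF e(1) w(1)])
  have dw: "d \<bullet> w = 1 - w \<bullet> e"
    unfolding d_def using w e by (simp add: minus_scalar_prod_distrib[of _ n] ew)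
  have de: "d \<bullet> e = w \<bullet> e - 1"
    unfolding d_def using w e by (simp add: minus_scalar_prod_distrib[of _ n])
  have "d \<bullet> d = d \<bullet> w - d \<bullet> e"
    using scalar_prod_minus_distrib[OF d w(1) e(1)] by (simp only: d_def)
  then have dd: "d \<bullet> d = 2 * (1 - w \<bullet> e)" by (simp add: dw de)
  then have "d \<bullet> d \<noteq> 0" using ne by simp
  define s where "s = csqrt (d \<bullet> d)"
  have s: "s * s = d \<bullet> d" "s \<noteq> 0"
    using \<open>d \<bullet> d \<noteq> 0\<close> by (auto simp: s_def simp flip: power2_eq_square)
  define u where "u = inverse s \<cdot>\<^sub>v d"
  have u: "u \<in> carrier_vec n" using d by (simp add: u_def)
  have "u \<bullet> u = inverse s * inverse s * (s * s)" using d s(1) by (simp add: u_def)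
  then have uu: "u \<bullet> u = 1" using s(2) by (simp add: field_simps)
  have act: "refl_mat n u *\<^sub>v v = v - (2 * (d \<bullet> v) / (d \<bullet> d)) \<cdot>\<^sub>v d" if v: "v \<in> carrier_vec n" for v
  proof -
    have "(2 * (u \<bullet> v)) \<cdot>\<^sub>v u = (2 * (d \<bullet> v) / (s * s)) \<cdot>\<^sub>v d"
      using d v by (simp add: u_def smult_smult_assoc field_simps)
    then show ?thesis using refl_mat_mult_vec[OF u v] s(1) by simp
  qed
  have "2 * (d \<bullet> w) / (d \<bullet> d) = 1" unfolding dw dd using ne by simp
  then have "refl_mat n u *\<^sub>v w = w - 1 \<cdot>\<^sub>v d" using act[OF w(1)] by simp
  also have "\<dots> = e" unfolding d_def using w e by (intro eq_vecI) auto
  finally have "refl_mat n u *\<^sub>v w = e" .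
  moreover have "refl_mat n u *\<^sub>v v = v" if "v \<in> carrier_vec n" "v \<bullet> w = 0" "v \<bullet> e = 0" for v
  proof -
    have "d \<bullet> v = v \<bullet> d" by (rule comm_scalar_prod[OF d that(1)])
    also have "\<dots> = 0" unfolding d_def using that w e by (simp add: scalar_prod_minus_distrib[of _ n])
    finally show ?thesis using act[OF that(1)] that d by (intro eq_vecI) auto
  qed
  ultimately show ?thesis using u uu by blast
qed

context clifford_algebra
begin

lemma vector_rep_rev:
  assumes x: "x \<in> spin_set n"
  shows "vector_rep n (cliff_rev x) = transpose_mat (vector_rep n x)"
proof -
  note O = orth_matD[OF vector_rep_orth[OF x]]
  have "vector_rep n (cliff_rev x) * vector_rep n x = 1\<^sub>m n"
    using vector_rep_mult[OF spin_rev[OF x] x] spin_setD(5)[OF x] vector_rep_one by simp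
  then have "vector_rep n (cliff_rev x) * (vector_rep n x * transpose_mat (vector_rep n x)) = transpose_mat (vector_rep n x)"
    using O assoc_mult_mat[OF vector_rep_carrier vector_rep_carrier O(2), of "cliff_rev x" x] by simp
  then show ?thesis unfolding O(4) by simp
qed

text \<open>
The sign makes this predicate hold for reflections, which are negatives of half-turns.
\<close>

definition lifts_to_spin :: "complex mat \<Rightarrow> bool" where
  "lifts_to_spin P \<longleftrightarrow> (\<exists>g\<in>spin_set n. \<exists>e. (e = 1 \<or> e = - 1) \<and> vector_rep n g = e \<cdot>\<^sub>m P)"

lemma lifts_to_spin_one: "lifts_to_spin (1\<^sub>m n)"
  unfolding lifts_to_spin_def using spin_one vector_rep_one by (intro bexI[of _ cliff_one] exI[of _ 1]) auto

lemma lifts_to_spin_mult: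
  assumes P: "P \<in> carrier_mat n n" "lifts_to_spin P" and Q: "Q \<in> carrier_mat n n" "lifts_to_spin Q"
  shows "lifts_to_spin (P * Q)"
proof -
  obtain g d h e where g: "g \<in> spin_set n" "d = 1 \<or> d = - 1" "vector_rep n g = d \<cdot>\<^sub>m P"
    and h: "h \<in> spin_set n" "e = 1 \<or> e = - 1" "vector_rep n h = e \<cdot>\<^sub>m Q"
    using P Q by (auto simp: lifts_to_spin_def)
  have "vector_rep n (g \<star> h) = (d * e) \<cdot>\<^sub>m (P * Q)"
    unfolding vector_rep_mult[OF g(1) h(1)] g(3) h(3)
    using P(1) Q(1) by (simp add: mult_smult_distrib[of _ n n] mult_smult_assoc_mat[of _ n n])
      (intro eq_matI, auto)
  moreover have "d * e = 1 \<or> d * e = - 1" using g h by auto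
  ultimately show ?thesis unfolding lifts_to_spin_def using spin_mult[OF g(1) h(1)] by blast
qed

lemma lifts_to_spin_transpose:
  assumes "lifts_to_spin P"
  shows "lifts_to_spin (transpose_mat P)"
proof -
  obtain g e where g: "g \<in> spin_set n" "e = 1 \<or> e = - 1" "vector_rep n g = e \<cdot>\<^sub>m P"
    using assms by (auto simp: lifts_to_spin_def)
  have "vector_rep n (cliff_rev g) = e \<cdot>\<^sub>m transpose_mat P"
    unfolding vector_rep_rev[OF g(1)] g(3) by (intro eq_matI) auto
  then show ?thesis unfolding lifts_to_spin_def using spin_rev[OF g(1)] g(2) by blast
qed

lemma lifts_to_spin_refl_mat:
  assumes n: "odd n" and u: "u \<in> carrier_vec n" "u \<bullet> u = 1"
  shows "lifts_to_spin (refl_mat n u)"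
proof -
  let ?g = "vec_elem u \<star> basis_elem {..<n}"
  have "vector_rep n ?g = (- 1) \<cdot>\<^sub>m refl_mat n u"
  proof (rule mat_eq_by_action[of _ n])
    fix v :: "complex vec" assume v: "v \<in> carrier_vec n"
    have "((- 1) \<cdot>\<^sub>m refl_mat n u) *\<^sub>v v = (- 1) \<cdot>\<^sub>v (refl_mat n u *\<^sub>v v)"
      using v by (intro eq_vecI) (auto simp: refl_mat_def)
    then show "vector_rep n ?g *\<^sub>v v = ((- 1) \<cdot>\<^sub>m refl_mat n u) *\<^sub>v v"
      using half_turn_lift(2)[OF n u v] refl_mat_mult_vec[OF u(1) v] u(1) v
      by (intro eq_vecI) auto
  qed auto
  then show ?thesis unfolding lifts_to_spin_def using half_turn_lift(1)[OF n u] by blast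
qed

text \<open>
If \<open>w\<close> differs from the unit vector \<open>e\<^sub>m\<close> by an isotropic vector, then \<open>w\<close> is first reflected to
\<open>- e\<^sub>m\<close>, from which it does differ by an anisotropic vector, and then \<open>- e\<^sub>m\<close> is reflected to \<open>e\<^sub>m\<close>.
\<close>

lemma lifts_to_spin_unit_vector_exchange:
  assumes n: "odd n" and w: "w \<in> carrier_vec n" "w \<bullet> w = 1" and m: "m < n"
  shows "\<exists>T. orth_mat n T \<and> lifts_to_spin T \<and> T *\<^sub>v w = unit_vec n m \<and>
    (\<forall>i<n. i \<noteq> m \<longrightarrow> w $ i = 0 \<longrightarrow> T *\<^sub>v unit_vec n i = unit_vec n i)"
proof -
  let ?e = "unit_vec n :: nat \<Rightarrow> complex vec"
  have e: "?e m \<in> carrier_vec n" "?e m \<bullet> ?e m = 1" using m by auto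
  show ?thesis
  proof (cases "w \<bullet> ?e m = 1")
    case False
    then obtain u where u: "u \<in> carrier_vec n" "u \<bullet> u = 1" "refl_mat n u *\<^sub>v w = ?e m"
      "\<forall>v\<in>carrier_vec n. v \<bullet> w = 0 \<longrightarrow> v \<bullet> ?e m = 0 \<longrightarrow> refl_mat n u *\<^sub>v v = v"
      using ex_refl_mat_exchange[OF w e] by blast
    have "\<forall>i<n. i \<noteq> m \<longrightarrow> w $ i = 0 \<longrightarrow> refl_mat n u *\<^sub>v ?e i = ?e i"
      using u(4) w(1) m by auto
    then show ?thesis
      using u refl_mat_orth[OF u(1,2)] lifts_to_spin_refl_mat[OF n u(1,2)] by blast
  next
    case True
    let ?f = "- ?e m"
    have f: "?f \<in> carrier_vec n" "?f \<bullet> ?f = 1" "w \<bullet> ?f \<noteq> 1"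
      using True w m by auto
    then obtain u where u: "u \<in> carrier_vec n" "u \<bullet> u = 1" "refl_mat n u *\<^sub>v w = ?f"
      "\<forall>v\<in>carrier_vec n. v \<bullet> w = 0 \<longrightarrow> v \<bullet> ?f = 0 \<longrightarrow> refl_mat n u *\<^sub>v v = v"
      using ex_refl_mat_exchange[OF w f] by blast
    have u': "\<forall>i<n. i \<noteq> m \<longrightarrow> w $ i = 0 \<longrightarrow> refl_mat n u *\<^sub>v ?e i = ?e i"
      using u(4) w(1) m by auto
    have em: "refl_mat n (?e m) *\<^sub>v v = v - (2 * v $ m) \<cdot>\<^sub>v ?e m" if "v \<in> carrier_vec n" for v
      using refl_mat_mult_vec[OF e(1) that] that m by simp
    have emf: "refl_mat n (?e m) *\<^sub>v ?f = ?e m"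
      unfolding em[OF f(1)] using m by (intro eq_vecI) auto
    have emi: "refl_mat n (?e m) *\<^sub>v ?e i = ?e i" if "i < n" "i \<noteq> m" for i
      unfolding em[OF unit_vec_carrier] using m that by (intro eq_vecI) auto
    let ?T = "refl_mat n (?e m) * refl_mat n u"
    have T: "?T *\<^sub>v v = refl_mat n (?e m) *\<^sub>v (refl_mat n u *\<^sub>v v)" if "v \<in> carrier_vec n" for v
      by (rule assoc_mult_mat_vec[OF refl_mat_carrier refl_mat_carrier that])
    have "orth_mat n ?T"
      by (intro orth_mat_mult refl_mat_orth e u)
    moreover have "lifts_to_spin ?T"
      by (intro lifts_to_spin_mult refl_mat_carrier lifts_to_spin_refl_mat n e u)
    moreover have "?T *\<^sub>v w = ?e m" unfolding T[OF w(1)] u(3) by (rule emf)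
    moreover have "\<forall>i<n. i \<noteq> m \<longrightarrow> w $ i = 0 \<longrightarrow> ?T *\<^sub>v ?e i = ?e i"
      using u' emi by (simp add: T)
    ultimately show ?thesis by blast
  qed
qed

text \<open>
A form of the Cartan-Dieudonne theorem: reflections carry the images of the unit vectors back to
the unit vectors one after the other. A reflection used for \<open>e\<^sub>m\<close> keeps the earlier unit vectors
fixed since these are orthogonal both to \<open>e\<^sub>m\<close> and to the image of \<open>e\<^sub>m\<close>.
\<close>

lemma orth_mat_lifts_to_spin:
  assumes n: "odd n" and "orth_mat n P"
  shows "lifts_to_spin P"
proof -
  let ?e = "unit_vec n :: nat \<Rightarrow> complex vec"
  have "orth_mat n P \<Longrightarrow> \<forall>i. i + k < n \<longrightarrow> P *\<^sub>v ?e i = ?e i \<Longrightarrow> k \<le> n \<Longrightarrow> lifts_to_spin P" for k P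
  proof (induction k arbitrary: P)
    case 0
    note p = orth_matD[OF 0(1)]
    have "P = 1\<^sub>m n"
    proof (rule eq_matI)
      fix i j assume "i < dim_row (1\<^sub>m n :: complex mat)" "j < dim_col (1\<^sub>m n :: complex mat)"
      then have ij: "i < n" "j < n" by auto
      have "P $$ (i, j) = (P *\<^sub>v ?e j) $ i" using p ij by simp
      also have "\<dots> = ?e j $ i" using 0(2) ij by simp
      finally show "P $$ (i, j) = 1\<^sub>m n $$ (i, j)" using ij by simp
    qed (use p in auto)
    then show ?case using lifts_to_spin_one by simp
  next
    case (Suc k)
    note p = orth_matD[OF Suc.prems(1)]
    define m where "m = n - Suc k"
    have m: "m < n" "m + Suc k = n" using Suc.prems(3) by (auto simp: m_def)
    define w where "w = P *\<^sub>v ?e m"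
    have w: "w \<in> carrier_vec n" using mult_mat_vec_carrier[OF p(1) unit_vec_carrier] by (simp add: w_def)
    have ww: "w \<bullet> w = 1"
      unfolding w_def using orth_mat_scalar_prod[OF Suc.prems(1), of "?e m" "?e m"] m by simp
    have wi: "w $ i = 0" if "i < m" for i
    proof -
      have i: "i < n" "P *\<^sub>v ?e i = ?e i" using that m Suc.prems(2) by auto
      have "w $ i = w \<bullet> ?e i" using w i by simp
      also have "\<dots> = (P *\<^sub>v ?e m) \<bullet> (P *\<^sub>v ?e i)" by (simp add: w_def i)
      also have "\<dots> = ?e m \<bullet> ?e i" by (rule orth_mat_scalar_prod[OF Suc.prems(1)]) auto
      also have "\<dots> = 0" using that m i by simp
      finally show ?thesis .
    qed
    obtain T where T: "orth_mat n T" "lifts_to_spin T" "T *\<^sub>v w = ?e m"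
      "\<forall>i<n. i \<noteq> m \<longrightarrow> w $ i = 0 \<longrightarrow> T *\<^sub>v ?e i = ?e i"
      using lifts_to_spin_unit_vector_exchange[OF n w ww m(1)] by blast
    note t = orth_matD[OF T(1)]
    have TP: "T * P *\<^sub>v v = T *\<^sub>v (P *\<^sub>v v)" if "v \<in> carrier_vec n" for v
      by (rule assoc_mult_mat_vec[OF t(1) p(1) that])
    have "T * P *\<^sub>v ?e i = ?e i" if "i + k < n" for i
    proof (cases "i = m")
      case True
      then show ?thesis using T(3) by (simp add: TP w_def)
    next
      case False
      then have "i < m" using that m by auto
      then show ?thesis using wi T(4) Suc.prems(2) m by (simp add: TP)
    qed
    then have "lifts_to_spin (T * P)"
      using Suc.IH[OF orth_mat_mult[OF T(1) Suc.prems(1)]] Suc.prems(3) by simp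
    then have "lifts_to_spin (transpose_mat T * (T * P))"
      using lifts_to_spin_mult[OF t(2) lifts_to_spin_transpose[OF T(2)] mult_carrier_mat[OF t(1) p(1)]] by simp
    also have "transpose_mat T * (T * P) = P"
      unfolding assoc_mult_mat[OF t(2,1) p(1), symmetric] t(3) using p by simp
    finally show ?case .
  qed
  \<comment> \<open>for \<open>k = n\<close> no unit vector is required to be fixed\<close>
  from this[of P n] show ?thesis using assms by simp
qed

section \<open>Invariant subspaces and conjugacy in the vector representation\<close>

text \<open>
Adding \<open>w\<close> to its image under the half-turn about a unit vector \<open>u\<close> gives \<open>2 (u \<bullet> w) u\<close>. Hence an
invariant subspace contains every unit vector that is not orthogonal to it: first some \<open>e\<^sub>i\<close>, then
\<open>(e\<^sub>i + e\<^sub>j) / \<surd>2\<close>, and then \<open>e\<^sub>j\<close> for all \<open>j\<close>.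
\<close>

lemma spin_invariant_subspace:
  assumes n: "odd n" and W: "W \<subseteq> carrier_vec n"
    and add: "\<And>v w. v \<in> W \<Longrightarrow> w \<in> W \<Longrightarrow> v + w \<in> W"
    and smult: "\<And>c w. w \<in> W \<Longrightarrow> c \<cdot>\<^sub>v w \<in> W"
    and inv: "\<And>x w. x \<in> spin_set n \<Longrightarrow> w \<in> W \<Longrightarrow> vector_rep n x *\<^sub>v w \<in> W"
    and w: "w \<in> W" "w \<noteq> 0\<^sub>v n"
  shows "W = carrier_vec n"
proof -
  let ?e = "unit_vec n :: nat \<Rightarrow> complex vec"
  have unit_in: "u \<in> W" if u: "u \<in> carrier_vec n" "u \<bullet> u = 1" and w: "w \<in> W" "u \<bullet> w \<noteq> 0" for u w
  proof -
    have wc: "w \<in> carrier_vec n" using w W by auto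
    have "vector_rep n (vec_elem u \<star> basis_elem {..<n}) *\<^sub>v w + w \<in> W"
      using add inv half_turn_lift(1)[OF n u] w by blast
    then have "inverse (2 * (u \<bullet> w)) \<cdot>\<^sub>v (((2 * (u \<bullet> w)) \<cdot>\<^sub>v u - w) + w) \<in> W"
      using half_turn_lift(2)[OF n u wc] smult by simp
    also have "inverse (2 * (u \<bullet> w)) \<cdot>\<^sub>v (((2 * (u \<bullet> w)) \<cdot>\<^sub>v u - w) + w) = u"
      using u wc w(2) by (intro eq_vecI) auto
    finally show ?thesis .
  qed
  have wc: "w \<in> carrier_vec n" using w W by auto
  obtain i where i: "i < n" "w $ i \<noteq> 0"
  proof (rule ccontr)
    assume "\<not> thesis"
    then have "\<forall>i<n. w $ i = 0" using that by blast
    then show False using w(2) wc by (auto intro: eq_vecI)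
  qed
  have ei: "?e i \<in> W" using unit_in[of "?e i" w] w i wc by simp
  have ej: "?e j \<in> W" if j: "j < n" for j
  proof (cases "j = i")
    case False
    define u where "u = (1 / csqrt 2) \<cdot>\<^sub>v (?e i + ?e j)"
    have uc: "u \<in> carrier_vec n" by (simp add: u_def)
    have s2: "csqrt 2 * csqrt 2 = 2" by (metis power2_csqrt power2_eq_square)
    have s: "u \<bullet> v = (v $ i + v $ j) / csqrt 2" if "v \<in> carrier_vec n" for v
      using that i j by (simp add: u_def add_scalar_prod_distrib[of _ n])
    have "u \<bullet> u = 1" unfolding s[OF uc] using i j False s2 by (simp add: u_def)
    moreover have "u \<bullet> ?e i \<noteq> 0" using s[of "?e i"] i j False s2 by auto
    ultimately have "u \<in> W" using unit_in uc ei by blast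
    moreover have "?e j \<bullet> u \<noteq> 0" using i j False s2 uc by (auto simp: u_def)
    ultimately show ?thesis using unit_in[of "?e j" u] j by simp
  qed (use ei in simp)
  have "v \<in> W" if v: "v \<in> carrier_vec n" for v
  proof -
    have "k \<le> n \<Longrightarrow> vec n (\<lambda>i. if i < k then v $ i else 0) \<in> W" for k
    proof (induction k)
      case 0
      have "vec n (\<lambda>i. if i < 0 then v $ i else 0) = 0 \<cdot>\<^sub>v w" using wc by (intro eq_vecI) auto
      then show ?case using smult[OF w(1), of 0] by metis
    next
      case (Suc k)
      have "vec n (\<lambda>i. if i < Suc k then v $ i else 0)
          = vec n (\<lambda>i. if i < k then v $ i else 0) + v $ k \<cdot>\<^sub>v ?e k"
        using Suc.prems by (intro eq_vecI) (auto simp: less_Suc_eq)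
      then show ?case using Suc add smult ej by simp
    qed
    from this[of n] have "vec n (\<lambda>i. if i < n then v $ i else 0) \<in> W" by simp
    also have "vec n (\<lambda>i. if i < n then v $ i else 0) = v" using v by (intro eq_vecI) auto
    finally show ?thesis .
  qed
  then show ?thesis using W by auto
qed

text \<open>
An orthogonal matrix that conjugates \<open>e S\<^sub>2\<close> to \<open>S\<^sub>1\<close> lifts, up to a sign that cancels in the
conjugation, to an element \<open>g\<close>. Then \<open>c = s\<^sub>1 (g s\<^sub>2 g\<^sup>-\<^sup>1)\<^sup>-\<^sup>1\<close> acts as the scalar \<open>e\<close> on vectors.
\<close>

lemma similar_vector_rep_imp_conjugate:
  assumes n: "odd n" and s: "s\<^sub>1 \<in> spin_set n" "s\<^sub>2 \<in> spin_set n"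
    and e: "e = 1 \<or> e = - 1" and sim: "similar_mat (vector_rep n s\<^sub>1) (e \<cdot>\<^sub>m vector_rep n s\<^sub>2)"
  shows "\<exists>g\<in>spin_set n. \<exists>c\<in>spin_set n. (\<forall>y\<in>spin_set n. c \<star> y = y \<star> c) \<and>
    s\<^sub>1 = g \<star> (c \<star> s\<^sub>2) \<star> cliff_rev g"
proof -
  let ?S1 = "vector_rep n s\<^sub>1" and ?S2 = "vector_rep n s\<^sub>2"
  note o1 = vector_rep_orth[OF s(1)] and o2 = vector_rep_orth[OF s(2)]
  have "e * e = 1" using e by auto
  have smult_smult: "a \<cdot>\<^sub>m (b \<cdot>\<^sub>m M) = (a * b) \<cdot>\<^sub>m M" for a b and M :: "complex mat"
    by (intro eq_matI) auto
  have tr: "transpose_mat (a \<cdot>\<^sub>m M) = a \<cdot>\<^sub>m transpose_mat M" for a and M :: "complex mat"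
    by (intro eq_matI) auto
  have sm: "(a \<cdot>\<^sub>m M) * N = a \<cdot>\<^sub>m (M * N)" "M * (a \<cdot>\<^sub>m N) = a \<cdot>\<^sub>m (M * N)"
    if "M \<in> carrier_mat n n" "N \<in> carrier_mat n n" for a and M N :: "complex mat"
    using that by (simp_all add: mult_smult_distrib[of _ n n] mult_smult_assoc_mat[of _ n n])
  have one: "1 \<cdot>\<^sub>m M = M" for M :: "complex mat" by (intro eq_matI) auto
  have "orth_mat n (e \<cdot>\<^sub>m ?S2)"
    using orth_matD[OF o2] \<open>e * e = 1\<close> by (simp add: orth_mat_def tr sm smult_smult one)
  then obtain P where P: "orth_mat n P" "?S1 = P * (e \<cdot>\<^sub>m ?S2) * transpose_mat P"
    using similar_orth_mats_orthogonally_similar[OF o1 _ sim] by blast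
  note p = orth_matD[OF P(1)]
  obtain g d where g: "g \<in> spin_set n" "d = 1 \<or> d = - 1" "vector_rep n g = d \<cdot>\<^sub>m P"
    using orth_mat_lifts_to_spin[OF n P(1)] by (auto simp: lifts_to_spin_def)
  have "d * d = 1" using g(2) by auto
  define t where "t = g \<star> s\<^sub>2 \<star> cliff_rev g"
  have t: "t \<in> spin_set n" unfolding t_def by (intro spin_mult spin_rev g s)
  have PS: "P * ?S2 \<in> carrier_mat n n" using p by simp
  have vt: "vector_rep n t = P * ?S2 * transpose_mat P"
    unfolding t_def vector_rep_mult[OF spin_mult[OF g(1) s(2)] spin_rev[OF g(1)]] vector_rep_mult[OF g(1) s(2)]
      vector_rep_rev[OF g(1)] g(3) tr sm(1)[OF p(1) vector_rep_carrier]
      sm(1)[OF PS smult_carrier_mat[OF p(2)]] sm(2)[OF PS p(2)] smult_smult \<open>d * d = 1\<close> one ..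
  have S1: "?S1 = e \<cdot>\<^sub>m vector_rep n t"
    unfolding vt P(2) sm(2)[OF p(1) vector_rep_carrier] sm(1)[OF PS p(2)] ..
  define c where "c = s\<^sub>1 \<star> cliff_rev t"
  have c: "c \<in> spin_set n" unfolding c_def by (intro spin_mult spin_rev s t)
  have "vector_rep n c = e \<cdot>\<^sub>m 1\<^sub>m n"
    unfolding c_def vector_rep_mult[OF s(1) spin_rev[OF t]] vector_rep_rev[OF t] S1
    using sm(1)[OF vector_rep_carrier orth_matD(2)[OF vector_rep_orth[OF t]], of e t] orth_matD(4)[OF vector_rep_orth[OF t]]
    by simp
  then have central: "c \<star> y = y \<star> c" if "y \<in> spin_set n" for y
    using vector_rep_scalar_imp_commutes_even[OF c e] spin_setD(1)[OF that] by blast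
  have "s\<^sub>1 = c \<star> t"
    unfolding c_def mult_assoc spin_setD(5)[OF t] using mult_one[OF spin_setD(2)[OF s(1)]] by simp
  also have "\<dots> = (c \<star> g) \<star> s\<^sub>2 \<star> cliff_rev g" by (simp add: t_def mult_assoc)
  also have "\<dots> = g \<star> (c \<star> s\<^sub>2) \<star> cliff_rev g" by (simp add: central[OF g(1)] mult_assoc)
  finally show ?thesis using g c central by blast
qed

end

section \<open>Isotropic vectors and root elements\<close>

context clifford_algebra
begin

lemma isotropic_pair:
  assumes "p \<in> cliff n" "m \<in> cliff n" "p \<star> p = 0" "m \<star> m = 0" "p \<star> m + m \<star> p = cliff_one"
  shows "p \<star> (m \<star> p) = p" "m \<star> (p \<star> m) = m"
    "p \<star> (p \<star> y) = 0" "m \<star> (m \<star> y) = 0"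
proof -
  show pp: "p \<star> (p \<star> y) = 0" and mm: "m \<star> (m \<star> y) = 0" for y
    using assms by (simp_all flip: mult_assoc)
  have "p \<star> (p \<star> m + m \<star> p) = p" "m \<star> (p \<star> m + m \<star> p) = m"
    unfolding assms(5) using assms(1,2) by simp_all
  then show "p \<star> (m \<star> p) = p" "m \<star> (p \<star> m) = m"
    using assms(3,4) pp mm by (simp_all add: mult_add_right)
qed

lemma vectors_anticommute:
  assumes "x \<in> cliff_vectors n" "y \<in> cliff_vectors n"
  shows "x \<star> y + y \<star> x = cscale (2 * (\<Sum>i<n. x {i} * y {i})) cliff_one"
proof -
  have "coords n x \<bullet> coords n y = (\<Sum>i<n. x {i} * y {i})"
    by (simp add: coords_def scalar_prod_def lessThan_atLeast0)
  then show ?thesis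
    using vec_elem_anticommute[OF coords_carrier coords_carrier, of x y] assms by (simp add: vec_elem_coords)
qed

lemma orthogonal_vectors_anticommute:
  assumes "x \<in> cliff_vectors n" "y \<in> cliff_vectors n" "(\<Sum>i<n. x {i} * y {i}) = 0"
  shows "x \<star> y = cscale (- 1) (y \<star> x)"
proof
  fix S
  have "(x \<star> y + y \<star> x) S = 0" using vectors_anticommute[OF assms(1,2)] assms(3) by simp
  then show "(x \<star> y) S = cscale (- 1) (y \<star> x) S" by (simp add: eq_neg_iff_add_eq_0)
qed

lemma isotropic_vector_square:
  assumes "x \<in> cliff_vectors n" "(\<Sum>i<n. x {i} * x {i}) = 0"
  shows "x \<star> x = 0"
proof
  fix S
  have "(x \<star> x + x \<star> x) S = 0" using vectors_anticommute[OF assms(1,1)] assms(2) by simp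
  then show "(x \<star> x) S = 0 S" by simp
qed

lemma vector_rep_mult_vector:
  assumes "v \<in> cliff_vectors n"
  shows "vector_rep n x *\<^sub>v coords n v = coords n (x \<star> v \<star> cliff_rev x)"
  using vector_rep_mult_vec[OF coords_carrier] assms by (simp add: vec_elem_coords)

text \<open>
With \<open>X = p w\<close> the reversal of \<open>1 + a X\<close> is \<open>1 - a X\<close>. The two sign changes in moving \<open>v\<close> past \<open>w\<close> and
\<open>p\<close> cancel, so \<open>X\<close> commutes with \<open>v\<close>, and \<open>(1 + a X) (1 - a X) = 1\<close> because \<open>X\<^sup>2 = 0\<close>.
\<close>

lemma root_elem_fixes:
  assumes v: "v \<in> cliff_vectors n" "p \<in> cliff_vectors n" "w \<in> cliff_vectors n"
    and pp: "p \<star> p = 0" and pw: "p \<star> w = cscale (- 1) (w \<star> p)"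
    and pv: "p \<star> v = cscale (- 1) (v \<star> p)" and wv: "w \<star> v = cscale (- 1) (v \<star> w)"
  shows "root_elem (p \<star> w) a \<star> v \<star> cliff_rev (root_elem (p \<star> w) a) = v"
proof -
  define X where "X = p \<star> w"
  have X: "X \<in> cliff n" unfolding X_def using v vectors_cliff mult_cliff by blast
  have el: "root_elem X a = cliff_one + cscale a X" by (simp add: fun_eq_iff root_elem_def)
  have "cliff_rev X = w \<star> p"
    unfolding X_def using v by (simp add: rev_mult vectors_cliff rev_vector)
  also have "\<dots> = cscale (- 1) X" by (simp add: X_def pw)
  finally have rev: "cliff_rev X = cscale (- 1) X" .
  have Xv: "X \<star> v = v \<star> X"
    unfolding X_def by (simp add: mult_assoc wv) (simp add: pv flip: mult_assoc)
  have ppw: "p \<star> (p \<star> w) = 0" using pp by (simp flip: mult_assoc)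
  have "X \<star> X = cscale (- 1) (w \<star> p) \<star> (p \<star> w)"
    using pw by (intro arg_cong2[where f = "cliff_mult n"]) (simp_all only: X_def)
  then have XX: "X \<star> X = 0" by (simp add: mult_assoc ppw)
  have "root_elem X a \<star> v \<star> cliff_rev (root_elem X a)
      = (v + cscale a (v \<star> X)) \<star> (cliff_one + cscale (- a) X)"
    unfolding el by (simp add: rev mult_add_left Xv)
  also have "\<dots> = v"
    using mult_one[OF X] mult_one[OF vectors_cliff[OF v(1)]]
    by (simp add: mult_add_left mult_add_right mult_assoc XX) (simp add: fun_eq_iff)
  finally show ?thesis by (simp add: X_def)
qed

end

section \<open>Representations and Schur's lemma\<close>

lemma Spin_simps:
  "carrier (Spin l) = spin_set (2 * l + 1)" "x \<otimes>\<^bsub>Spin l\<^esub> y = cliff_mult (2 * l + 1) x y"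
  "\<one>\<^bsub>Spin l\<^esub> = cliff_one"
  by (simp_all add: Spin_def)

lemma Spin_group: "group (Spin l)"
proof -
  interpret clifford_algebra "2 * l + 1" .
  show ?thesis
  proof (rule groupI)
    fix x assume "x \<in> carrier (Spin l)"
    then have x: "x \<in> spin_set (2 * l + 1)" by (simp only: Spin_simps)
    show "\<exists>y\<in>carrier (Spin l). y \<otimes>\<^bsub>Spin l\<^esub> x = \<one>\<^bsub>Spin l\<^esub>"
      unfolding Spin_simps using spin_rev[OF x] spin_setD(5)[OF x] by blast
  qed (simp_all only: Spin_simps spin_mult spin_one mult_assoc one_mult)
qed

lemma Spin_inv:
  assumes "g \<in> spin_set (2 * l + 1)"
  shows "inv\<^bsub>Spin l\<^esub> g = cliff_rev g"
proof -
  interpret group "Spin l" by (rule Spin_group)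
  interpret clifford_algebra "2 * l + 1" .
  show ?thesis
    using assms spin_rev[OF assms] spin_setD(5)[OF assms] by (intro inv_equality) (simp_all add: Spin_simps)
qed

lemma GL_carrierI:
  assumes "A \<in> carrier_mat N N" "B \<in> carrier_mat N N" "A * B = 1\<^sub>m N" "B * A = 1\<^sub>m N"
  shows "A \<in> carrier (GL N)"
  using assms by (auto simp: units_of_def Units_def ring_mat_def)

lemma GL_carrierD: "A \<in> carrier (GL N) \<Longrightarrow> A \<in> carrier_mat N N"
  by (auto simp: units_of_def Units_def ring_mat_def)

lemma GL_mult: "A \<otimes>\<^bsub>GL N\<^esub> B = A * B"
  by (simp add: units_of_def ring_mat_def)

lemma rep_facts:
  assumes "\<rho> \<in> hom (Spin l) (GL N)"
  shows "x \<in> carrier (Spin l) \<Longrightarrow> \<rho> x \<in> carrier_mat N N"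
    "x \<in> carrier (Spin l) \<Longrightarrow> y \<in> carrier (Spin l) \<Longrightarrow> \<rho> (x \<otimes>\<^bsub>Spin l\<^esub> y) = \<rho> x * \<rho> y"
    "\<rho> \<one>\<^bsub>Spin l\<^esub> = 1\<^sub>m N"
proof -
  show "x \<in> carrier (Spin l) \<Longrightarrow> \<rho> x \<in> carrier_mat N N"
    using assms by (auto intro!: GL_carrierD simp: hom_def)
  show "x \<in> carrier (Spin l) \<Longrightarrow> y \<in> carrier (Spin l) \<Longrightarrow> \<rho> (x \<otimes>\<^bsub>Spin l\<^esub> y) = \<rho> x * \<rho> y"
    using hom_mult[OF assms] by (simp add: GL_mult)
  interpret G: group "Spin l" by (rule Spin_group)
  interpret R: ring "ring_mat TYPE(complex) N ()" by (rule ring_mat)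
  have "group (GL N)" by (rule R.units_group)
  then interpret group_hom "Spin l" "GL N" \<rho>
    using assms Spin_group by (simp add: group_hom_def group_hom_axioms_def)
  show "\<rho> \<one>\<^bsub>Spin l\<^esub> = 1\<^sub>m N"
    using hom_one by (simp add: units_of_def ring_mat_def)
qed

lemma subspace_module_vec_iff:
  "VectorSpace.subspace class_ring W (module_vec TYPE(complex) N) \<longleftrightarrow>
    W \<subseteq> carrier_vec N \<and> 0\<^sub>v N \<in> W \<and> (\<forall>v\<in>W. \<forall>w\<in>W. v + w \<in> W) \<and> (\<forall>c. \<forall>w\<in>W. c \<cdot>\<^sub>v w \<in> W)"
proof -
  interpret vec_space "TYPE(complex)" N .
  have "vectorspace class_ring (module_vec TYPE(complex) N)" by unfold_locales
  then show ?thesis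
    unfolding VectorSpace.subspace_def submodule_def
    using vec_module[where ?'a = complex, of N] by (auto simp: module_vec_simps)
qed

text \<open>
Schur's lemma: an eigenspace of a central element is an invariant subspace.
\<close>

lemma irreducible_central_scalar:
  assumes irr: "irreducible_rep l N \<rho>" and c: "c \<in> group_center (Spin l)"
  shows "\<exists>t. t \<noteq> 0 \<and> \<rho> c = t \<cdot>\<^sub>m 1\<^sub>m N"
proof -
  interpret G: group "Spin l" by (rule Spin_group)
  have hom: "\<rho> \<in> hom (Spin l) (GL N)" and N: "N > 0"
    using irr by (auto simp: irreducible_rep_def rational_rep_def)
  note R = rep_facts[OF hom]
  have cc: "c \<in> carrier (Spin l)" and comm: "\<And>x. x \<in> carrier (Spin l) \<Longrightarrow> c \<otimes>\<^bsub>Spin l\<^esub> x = x \<otimes>\<^bsub>Spin l\<^esub> c"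
    using c by (auto simp: group_center_def)
  note C = R(1)[OF cc]
  obtain t where "eigenvalue (\<rho> c) t"
    using spectrum_non_empty[OF C N] by (auto simp: spectrum_def)
  then obtain v where v: "v \<in> carrier_vec N" "v \<noteq> 0\<^sub>v N" "\<rho> c *\<^sub>v v = t \<cdot>\<^sub>v v"
    using C by (auto simp: eigenvalue_def eigenvector_def)
  define W where "W = {w \<in> carrier_vec N. \<rho> c *\<^sub>v w = t \<cdot>\<^sub>v w}"
  have "VectorSpace.subspace class_ring W (module_vec TYPE(complex) N)"
    unfolding subspace_module_vec_iff W_def
  proof (intro conjI ballI allI)
    show "0\<^sub>v N \<in> {w \<in> carrier_vec N. \<rho> c *\<^sub>v w = t \<cdot>\<^sub>v w}"
      using C by (auto intro!: eq_vecI simp: scalar_prod_def)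
  next
    fix v w assume "v \<in> {w \<in> carrier_vec N. \<rho> c *\<^sub>v w = t \<cdot>\<^sub>v w}" "w \<in> {w \<in> carrier_vec N. \<rho> c *\<^sub>v w = t \<cdot>\<^sub>v w}"
    then show "v + w \<in> {w \<in> carrier_vec N. \<rho> c *\<^sub>v w = t \<cdot>\<^sub>v w}"
      using C by (auto simp: mult_add_distrib_mat_vec smult_add_distrib_vec[of _ N])
  next
    fix d w assume "w \<in> {w \<in> carrier_vec N. \<rho> c *\<^sub>v w = t \<cdot>\<^sub>v w}"
    then show "d \<cdot>\<^sub>v w \<in> {w \<in> carrier_vec N. \<rho> c *\<^sub>v w = t \<cdot>\<^sub>v w}"
      using C by (simp add: mult_mat_vec smult_smult_assoc mult.commute)
  qed auto
  moreover have "\<rho> x *\<^sub>v w \<in> W" if x: "x \<in> carrier (Spin l)" and "w \<in> W" for x w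
  proof -
    have w: "w \<in> carrier_vec N" "\<rho> c *\<^sub>v w = t \<cdot>\<^sub>v w" using that by (auto simp: W_def)
    have "\<rho> c *\<^sub>v (\<rho> x *\<^sub>v w) = \<rho> c * \<rho> x *\<^sub>v w"
      using R(1)[OF x] C w by simp
    also have "\<rho> c * \<rho> x = \<rho> x * \<rho> c"
      using R(2)[OF cc x] R(2)[OF x cc] comm[OF x] by simp
    also have "\<dots> *\<^sub>v w = t \<cdot>\<^sub>v (\<rho> x *\<^sub>v w)"
      using R(1)[OF x] C w by (simp add: mult_mat_vec)
    finally show ?thesis using R(1)[OF x] w by (simp add: W_def)
  qed
  ultimately have "W = {0\<^sub>v N} \<or> W = carrier_vec N"
    using irr by (auto simp: irreducible_rep_def)
  moreover have "v \<in> W" using v by (simp add: W_def)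
  ultimately have W: "W = carrier_vec N" using v by auto
  have eq: "\<rho> c = t \<cdot>\<^sub>m 1\<^sub>m N"
  proof (rule mat_eq_by_action[OF C])
    fix w :: "complex vec" assume w: "w \<in> carrier_vec N"
    then have "\<rho> c *\<^sub>v w = t \<cdot>\<^sub>v w" using W by (auto simp: W_def)
    also have "\<dots> = (t \<cdot>\<^sub>m 1\<^sub>m N) *\<^sub>v w" using w by (intro eq_vecI) auto
    finally show "\<rho> c *\<^sub>v w = (t \<cdot>\<^sub>m 1\<^sub>m N) *\<^sub>v w" .
  qed simp
  have "t \<noteq> 0"
  proof
    assume "t = 0"
    have inv: "inv\<^bsub>Spin l\<^esub> c \<in> carrier (Spin l)" using cc by simp
    have "1\<^sub>m N = \<rho> c * \<rho> (inv\<^bsub>Spin l\<^esub> c)"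
      using R(2)[OF cc inv] R(3) cc by simp
    also have "\<dots> = 0\<^sub>m N N"
      unfolding eq \<open>t = 0\<close> using R(1)[OF inv] by (intro eq_matI) (auto simp: scalar_prod_def)
    finally have "(1\<^sub>m N :: complex mat) $$ (0, 0) = 0\<^sub>m N N $$ (0, 0)" by simp
    then show False using N by simp
  qed
  then show ?thesis using eq by blast
qed

lemma conj_up_to_center_imp_conj_up_to_constant:
  assumes conj: "conj_up_to_center (Spin l) s\<^sub>1 s\<^sub>2" and s: "s\<^sub>2 \<in> carrier (Spin l)"
    and irr: "irreducible_rep l N \<rho>"
  shows "conj_up_to_constant (\<rho> s\<^sub>1) (\<rho> s\<^sub>2)"
proof -
  interpret G: group "Spin l" by (rule Spin_group)
  have hom: "\<rho> \<in> hom (Spin l) (GL N)"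
    using irr by (auto simp: irreducible_rep_def rational_rep_def)
  note R = rep_facts[OF hom]
  obtain c g where c: "c \<in> group_center (Spin l)" and g: "g \<in> carrier (Spin l)"
    and eq: "s\<^sub>1 = g \<otimes>\<^bsub>Spin l\<^esub> (c \<otimes>\<^bsub>Spin l\<^esub> s\<^sub>2) \<otimes>\<^bsub>Spin l\<^esub> inv\<^bsub>Spin l\<^esub> g"
    using conj by (auto simp: conj_up_to_center_def)
  obtain t where t: "t \<noteq> 0" "\<rho> c = t \<cdot>\<^sub>m 1\<^sub>m N"
    using irreducible_central_scalar[OF irr c] by blast
  have cc: "c \<in> carrier (Spin l)" using c by (simp add: group_center_def)
  have g': "inv\<^bsub>Spin l\<^esub> g \<in> carrier (Spin l)" using g by simp
  have cs: "c \<otimes>\<^bsub>Spin l\<^esub> s\<^sub>2 \<in> carrier (Spin l)" using cc s by simp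
  have "\<rho> s\<^sub>1 = \<rho> g * \<rho> (c \<otimes>\<^bsub>Spin l\<^esub> s\<^sub>2) * \<rho> (inv\<^bsub>Spin l\<^esub> g)"
    unfolding eq using R(2) g g' cs by simp
  also have "\<rho> (c \<otimes>\<^bsub>Spin l\<^esub> s\<^sub>2) = t \<cdot>\<^sub>m \<rho> s\<^sub>2"
    using R(2)[OF cc s] t R(1)[OF s] mult_smult_assoc_mat[OF one_carrier_mat R(1)[OF s], of t] by simp
  finally have 1: "\<rho> s\<^sub>1 = \<rho> g * (t \<cdot>\<^sub>m \<rho> s\<^sub>2) * \<rho> (inv\<^bsub>Spin l\<^esub> g)" .
  have "\<rho> g * \<rho> (inv\<^bsub>Spin l\<^esub> g) = 1\<^sub>m N" "\<rho> (inv\<^bsub>Spin l\<^esub> g) * \<rho> g = 1\<^sub>m N"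
    using R(2)[OF g g'] R(2)[OF g' g] R(3) g by simp_all
  then have "similar_mat_wit (\<rho> s\<^sub>1) (t \<cdot>\<^sub>m \<rho> s\<^sub>2) (\<rho> g) (\<rho> (inv\<^bsub>Spin l\<^esub> g))"
    using 1 R(1)[OF g] R(1)[OF g'] R(1)[OF s]
    by (intro similar_mat_witI[where n = N]) (auto intro!: mult_carrier_mat)
  then show ?thesis using t by (auto simp: conj_up_to_constant_def similar_mat_def)
qed

section \<open>The vector representation as a fundamental representation\<close>

lemma polynomial_fun_sum:
  assumes "\<And>i. i \<in> A \<Longrightarrow> polynomial_fun (f i)"
  shows "polynomial_fun (\<lambda>x. \<Sum>i\<in>A. f i x)"
proof (cases "finite A")
  case True
  then show ?thesis using assms
  proof (induction A rule: finite_induct)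
    case empty
    show ?case using polynomial_fun.const[of 0] by simp
  next
    case (insert i A)
    have "polynomial_fun (\<lambda>x. f i x + (\<Sum>i\<in>A. f i x))"
      using insert by (intro polynomial_fun.add) auto
    then show ?case using insert.hyps by simp
  qed
next
  case False
  then show ?thesis using polynomial_fun.const[of 0] by simp
qed

lemma polynomial_fun_cliff_mult:
  assumes "\<And>S. polynomial_fun (\<lambda>x. f x S)" "\<And>S. polynomial_fun (\<lambda>x. g x S)"
  shows "polynomial_fun (\<lambda>x. cliff_mult n (f x) (g x) S)"
  unfolding cliff_mult_def
  by (intro polynomial_fun_sum polynomial_fun.mult polynomial_fun.const assms)

lemma polynomial_fun_cliff_rev: "polynomial_fun (\<lambda>x. cliff_rev x S)"
  unfolding cliff_rev_def by (intro polynomial_fun.mult polynomial_fun.const polynomial_fun.coeff)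

lemma vector_rep_rational: "rational_rep l (2 * l + 1) (vector_rep (2 * l + 1))"
proof -
  interpret clifford_algebra "2 * l + 1" .
  let ?n = "2 * l + 1"
  have "vector_rep ?n \<in> hom (Spin l) (GL ?n)"
  proof (rule homI)
    fix x assume "x \<in> carrier (Spin l)"
    then have x: "x \<in> spin_set ?n" by (simp add: Spin_simps)
    show "vector_rep ?n x \<in> carrier (GL ?n)"
      using orth_matD[OF vector_rep_orth[OF x]] by (intro GL_carrierI)
    fix y assume "y \<in> carrier (Spin l)"
    then have y: "y \<in> spin_set ?n" by (simp add: Spin_simps)
    show "vector_rep ?n (x \<otimes>\<^bsub>Spin l\<^esub> y) = vector_rep ?n x \<otimes>\<^bsub>GL ?n\<^esub> vector_rep ?n y"
      using vector_rep_mult[OF x y] by (simp only: Spin_simps GL_mult)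
  qed
  moreover have "\<exists>f. polynomial_fun f \<and> (\<forall>x\<in>carrier (Spin l). vector_rep ?n x $$ (i, j) = f x)"
    if "i < ?n" "j < ?n" for i j
  proof (intro exI conjI ballI)
    show "polynomial_fun (\<lambda>x. cliff_mult ?n (cliff_mult ?n x (basis_elem {j})) (cliff_rev x) {i})"
      by (intro polynomial_fun_cliff_mult polynomial_fun.coeff polynomial_fun.const polynomial_fun_cliff_rev)
    show "vector_rep ?n x $$ (i, j) = cliff_mult ?n (cliff_mult ?n x (basis_elem {j})) (cliff_rev x) {i}" for x
      using that by (simp add: vector_rep_def)
  qed
  ultimately show ?thesis unfolding rational_rep_def by blast
qed

lemma vector_rep_irreducible: "irreducible_rep l (2 * l + 1) (vector_rep (2 * l + 1))"
proof -
  interpret clifford_algebra "2 * l + 1" .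
  let ?n = "2 * l + 1"
  have "W = {0\<^sub>v ?n} \<or> W = carrier_vec ?n"
    if "VectorSpace.subspace class_ring W (module_vec TYPE(complex) ?n)"
      and inv: "\<forall>x\<in>carrier (Spin l). \<forall>w\<in>W. vector_rep ?n x *\<^sub>v w \<in> W" for W
  proof (cases "W \<subseteq> {0\<^sub>v ?n}")
    case True
    then show ?thesis using that(1) unfolding subspace_module_vec_iff by blast
  next
    case False
    then obtain w where "w \<in> W" "w \<noteq> 0\<^sub>v ?n" by blast
    then have "W = carrier_vec ?n"
      using that unfolding subspace_module_vec_iff Spin_simps
      by (intro spin_invariant_subspace[of W w]) auto
    then show ?thesis by simp
  qed
  then show ?thesis using vector_rep_rational by (auto simp: irreducible_rep_def)
qed

context clifford_algebra
begin

text \<open>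
The highest weight vector is \<open>p\<^sub>0\<close>. A root element is \<open>1 + a p\<^sub>i w\<close> with \<open>w\<close> one of \<open>m\<^sub>j\<close>, \<open>p\<^sub>j\<close> (\<open>j > i\<close>)
or \<open>e\<^bsub>2l\<^esub>\<close>, so both \<open>p\<^sub>i\<close> and \<open>w\<close> are orthogonal to \<open>p\<^sub>0\<close>. The torus element \<open>h\<^sub>j(z)\<close> commutes with \<open>p\<^sub>0\<close> for
\<open>j \<noteq> 0\<close>, while \<open>h\<^sub>0(z) p\<^sub>0 = z p\<^sub>0 = p\<^sub>0 h\<^sub>0(z)\<^sup>*\<close>.
\<close>

lemma vector_rep_highest_weight_vector:
  assumes n: "n = 2 * l + 1" and "l \<ge> 2"
  shows "highest_weight_vector l n (vector_rep n) 1 (coords n (iso_p 0))"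
proof -
  have vec: "iso_p j \<in> cliff_vectors n" "iso_m j \<in> cliff_vectors n" if "j < l" for j
    using that n by (auto simp: cliff_vectors_def iso_p_def iso_m_def split: if_splits)
  have vec': "last_vec l \<in> cliff_vectors n"
    using n by (auto simp: cliff_vectors_def last_vec_def)
  have dot: "(\<Sum>i<n. iso_p j {i} * f i) = (f (2 * j) + \<i> * f (2 * j + 1)) / 2"
    "(\<Sum>i<n. iso_m j {i} * f i) = (f (2 * j) - \<i> * f (2 * j + 1)) / 2" if "j < l" for j and f :: "nat \<Rightarrow> complex"
  proof -
    have "(\<Sum>i<n. iso_p j {i} * f i) = (\<Sum>i<n. (if i = 2 * j then f (2 * j) / 2 else 0)
        + (if i = 2 * j + 1 then \<i> * f (2 * j + 1) / 2 else 0))"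
      by (rule sum.cong) (auto simp: iso_p_def)
    then show "(\<Sum>i<n. iso_p j {i} * f i) = (f (2 * j) + \<i> * f (2 * j + 1)) / 2"
      using that n by (simp only: sum.distrib) (simp add: add_divide_distrib)
    have "(\<Sum>i<n. iso_m j {i} * f i) = (\<Sum>i<n. (if i = 2 * j then f (2 * j) / 2 else 0)
        + (if i = 2 * j + 1 then - (\<i> * f (2 * j + 1) / 2) else 0))"
      by (rule sum.cong) (auto simp: iso_m_def)
    then show "(\<Sum>i<n. iso_m j {i} * f i) = (f (2 * j) - \<i> * f (2 * j + 1)) / 2"
      using that n by (simp only: sum.distrib) (simp add: diff_divide_distrib)
  qed
  have odd_even: "Suc (2 * j) \<noteq> 2 * k" "2 * k \<noteq> Suc (2 * j)" for j k :: nat by presburger+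
  have pp: "iso_p i \<star> iso_p i = 0" "iso_m i \<star> iso_m i = 0" if "i < l" for i
    using that by (auto intro!: isotropic_vector_square vec simp: dot) (auto simp: iso_p_def iso_m_def odd_even)
  have anti_pp: "iso_p i \<star> iso_p j = cscale (- 1) (iso_p j \<star> iso_p i)" if "i < l" "j < l" for i j
    using that by (intro orthogonal_vectors_anticommute vec) (auto simp: dot, auto simp: iso_p_def odd_even)
  have anti_pm: "iso_p i \<star> iso_m j = cscale (- 1) (iso_m j \<star> iso_p i)"
    "iso_m j \<star> iso_p i = cscale (- 1) (iso_p i \<star> iso_m j)" if "i < l" "j < l" "i \<noteq> j" for i j
    using that by (intro orthogonal_vectors_anticommute vec; auto simp: dot; auto simp: iso_p_def iso_m_def odd_even)+
  have anti_pl: "iso_p i \<star> last_vec l = cscale (- 1) (last_vec l \<star> iso_p i)"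
    "last_vec l \<star> iso_p i = cscale (- 1) (iso_p i \<star> last_vec l)" if "i < l" for i
  proof -
    show "iso_p i \<star> last_vec l = cscale (- 1) (last_vec l \<star> iso_p i)"
      using that by (intro orthogonal_vectors_anticommute vec vec') (auto simp: dot, auto simp: last_vec_def odd_even)
    then show "last_vec l \<star> iso_p i = cscale (- 1) (iso_p i \<star> last_vec l)" by simp
  qed
  have pm: "iso_p j \<star> iso_m j + iso_m j \<star> iso_p j = cliff_one" if "j < l" for j
    using that vectors_anticommute[OF vec(1)[OF that] vec(2)[OF that]]
    by (simp add: dot) (simp add: iso_m_def odd_even)
  define v where "v = coords n (iso_p 0)"
  have l: "0 < l" using assms by simp
  have "v $ 0 = 1 / 2" using n by (simp add: v_def coords_def iso_p_def)
  then have "v \<noteq> 0\<^sub>v n" using n by auto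
  have root: "vector_rep n (root_elem X a) *\<^sub>v v = v" if mem: "X \<in> positive_root_vectors l" for X a
  proof -
    obtain i w where X: "X = iso_p i \<star> w" and i: "i < l" and w: "w \<in> cliff_vectors n"
      "iso_p i \<star> w = cscale (- 1) (w \<star> iso_p i)" "w \<star> iso_p 0 = cscale (- 1) (iso_p 0 \<star> w)"
    proof -
      from mem consider i j where "X = iso_p i \<star> iso_m j" "i < j" "j < l"
        | i j where "X = iso_p i \<star> iso_p j" "i < j" "j < l" | i where "X = iso_p i \<star> last_vec l" "i < l"
        unfolding positive_root_vectors_def n[symmetric] by blast
      then show ?thesis
      proof cases
        case 1
        show ?thesis by (rule that[OF 1(1) _ vec(2) anti_pm(1) anti_pm(2)]) (use 1 l in auto)
      next
        case 2
        show ?thesis by (rule that[OF 2(1) _ vec(1) anti_pp anti_pp]) (use 2 l in auto)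
      next
        case 3
        show ?thesis by (rule that[OF 3(1) _ vec' anti_pl(1) anti_pl(2)]) (use 3 l in auto)
      qed
    qed
    show ?thesis
      unfolding v_def vector_rep_mult_vector[OF vec(1)[OF l]] X
      using root_elem_fixes[OF vec(1)[OF l] vec(1)[OF i] w(1) pp(1)[OF i] w(2) anti_pp[OF i l] w(3)] by simp
  qed
  have torus: "vector_rep n (torus_elem l j z) *\<^sub>v v = (z ^ fundamental_weight l 1 j) \<cdot>\<^sub>v v"
    if j: "j < l" and z: "z \<noteq> 0" for j z
  proof -
    let ?p = "iso_p j" and ?m = "iso_m j"
    have c: "?p \<in> cliff n" "?m \<in> cliff n" using vec[OF j] by (auto intro: vectors_cliff)
    note pm_rules = isotropic_pair[OF c pp[OF j] pm[OF j]]
    define h where "h = torus_elem l j z"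
    have h: "h = cscale z (?p \<star> ?m) + cscale (inverse z) (?m \<star> ?p)"
      unfolding h_def torus_elem_def n[symmetric] by (simp add: fun_eq_iff)
    have rev: "cliff_rev h = cscale z (?m \<star> ?p) + cscale (inverse z) (?p \<star> ?m)"
      unfolding h using c vec[OF j] by (simp add: rev_mult rev_vector)
    have "h \<star> iso_p 0 \<star> cliff_rev h = cscale (z ^ fundamental_weight l 1 j) (iso_p 0)"
    proof (cases "j = 0")
      case True
      have "h \<star> ?p = cscale z ?p" unfolding h by (simp add: mult_add_left mult_assoc pm_rules pp[OF j])
      moreover have "?p \<star> cliff_rev h = cscale z ?p" unfolding rev by (simp add: mult_add_right pm_rules pp[OF j])
      ultimately show ?thesis using True assms(2) by (simp add: fundamental_weight_def power2_eq_square)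
    next
      case False
      have pc: "?p \<star> iso_p 0 = cscale (- 1) (iso_p 0 \<star> ?p)" "?m \<star> iso_p 0 = cscale (- 1) (iso_p 0 \<star> ?m)"
        using anti_pp[OF j l] anti_pm(2)[OF l j] False by auto
      have "?p \<star> (?m \<star> iso_p 0) = iso_p 0 \<star> (?p \<star> ?m)" "?m \<star> (?p \<star> iso_p 0) = iso_p 0 \<star> (?m \<star> ?p)"
        by (simp add: pc) (simp add: pc flip: mult_assoc, simp add: pc, simp add: pc flip: mult_assoc)
      then have "h \<star> iso_p 0 = iso_p 0 \<star> h"
        unfolding h by (simp add: mult_add_left mult_add_right mult_assoc)
      moreover have "h \<star> cliff_rev h = cliff_one"
        unfolding rev unfolding h pm[OF j, symmetric] using z
        by (simp add: mult_add_left mult_add_right mult_assoc pm_rules)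
      ultimately have "h \<star> iso_p 0 \<star> cliff_rev h = iso_p 0"
        using mult_one[OF vectors_cliff[OF vec(1)[OF l]]] by (simp add: mult_assoc)
      then show ?thesis using False assms by (simp add: fundamental_weight_def)
    qed
    then show ?thesis
      unfolding v_def vector_rep_mult_vector[OF vec(1)[OF l]] h_def[symmetric]
      by (intro eq_vecI) (auto simp: coords_def)
  qed
  show ?thesis
    unfolding highest_weight_vector_def using \<open>v \<noteq> 0\<^sub>v n\<close> root torus by (auto simp: v_def)
qed

end

lemma vector_rep_fundamental:
  assumes "l \<ge> 2"
  shows "fundamental_rep l 1 (2 * l + 1) (vector_rep (2 * l + 1))"
  using vector_rep_irreducible clifford_algebra.vector_rep_highest_weight_vector[OF refl assms]
  unfolding fundamental_rep_def by blast

lemma conj_up_to_centerI: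
  assumes "g \<in> spin_set (2 * l + 1)" "c \<in> spin_set (2 * l + 1)"
    and "\<forall>y\<in>spin_set (2 * l + 1). cliff_mult (2 * l + 1) c y = cliff_mult (2 * l + 1) y c"
    and "a = cliff_mult (2 * l + 1) (cliff_mult (2 * l + 1) g (cliff_mult (2 * l + 1) c b)) (cliff_rev g)"
  shows "conj_up_to_center (Spin l) a b"
  unfolding conj_up_to_center_def group_center_def
  using assms by (intro bexI[of _ c] bexI[of _ g]) (auto simp: Spin_simps Spin_inv simp del: One_nat_def)

lemma vector_rep_conj_imp_conj_up_to_center:
  assumes ss: "semisimple_element l s\<^sub>1" "semisimple_element l s\<^sub>2"
    and conj: "conj_up_to_constant (vector_rep (2 * l + 1) s\<^sub>1) (vector_rep (2 * l + 1) s\<^sub>2)"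
  shows "conj_up_to_center (Spin l) s\<^sub>1 s\<^sub>2"
proof -
  interpret clifford_algebra "2 * l + 1" .
  let ?n = "2 * l + 1"
  have s: "s\<^sub>1 \<in> spin_set ?n" "s\<^sub>2 \<in> spin_set ?n"
    and d: "diagonalizable_mat (vector_rep ?n s\<^sub>1)" "diagonalizable_mat (vector_rep ?n s\<^sub>2)"
    using ss vector_rep_rational[of l] by (auto simp: semisimple_element_def Spin_simps)
  have n: "odd ?n" by simp
  obtain t where "t \<noteq> 0" "similar_mat (vector_rep ?n s\<^sub>1) (t \<cdot>\<^sub>m vector_rep ?n s\<^sub>2)"
    using conj by (auto simp: conj_up_to_constant_def)
  then obtain e where "e = 1 \<or> e = - 1" "similar_mat (vector_rep ?n s\<^sub>1) (e \<cdot>\<^sub>m vector_rep ?n s\<^sub>2)"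
    using orth_mat_similar_up_to_constant[OF vector_rep_orth[OF s(1)] vector_rep_orth[OF s(2)] n d] by blast
  then obtain g c where "g \<in> spin_set ?n" "c \<in> spin_set ?n" "\<forall>y\<in>spin_set ?n. cliff_mult ?n c y = cliff_mult ?n y c"
    "s\<^sub>1 = cliff_mult ?n (cliff_mult ?n g (cliff_mult ?n c s\<^sub>2)) (cliff_rev g)"
    using similar_vector_rep_imp_conjugate[OF n s] by blast
  then show ?thesis by (rule conj_up_to_centerI)
qed

section \<open>The spin representation in dimension three\<close>

lemma cliff_sign_eval:
  assumes "finite S" "finite T"
  shows "cliff_sign S T = (- 1) ^ (\<Sum>i\<in>S. \<Sum>j\<in>T. if j < i then 1 else 0)"
proof -
  have "{(i, j). i \<in> S \<and> j \<in> T \<and> j < i} = (SIGMA i:S. {j \<in> T. j < i})" by auto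
  then have "card {(i, j). i \<in> S \<and> j \<in> T \<and> j < i} = (\<Sum>i\<in>S. card {j \<in> T. j < i})"
    using assms by simp
  also have "\<dots> = (\<Sum>i\<in>S. \<Sum>j\<in>T. if j < i then 1 else 0)"
    using assms by (simp add: sum.If_cases Int_def)
  finally show ?thesis by (simp add: cliff_sign_def)
qed

text \<open>
The even Clifford algebra in dimension 3 is four-dimensional; with \<open>e\<^sub>0 e\<^sub>1\<close>, \<open>e\<^sub>0 e\<^sub>2\<close>, \<open>e\<^sub>1 e\<^sub>2\<close> in the
role of the imaginary units it is the algebra of complex quaternions, that is, of 2 by 2 matrices.
\<close>

lemma even_subsets_3: "{S \<in> Pow {..<3::nat}. even (card S)} = {{}, {0, 1}, {0, 2}, {1, 2}}"
  (is "?A = ?B")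
proof
  have "{..<3::nat} = {0, 1, 2}" by auto
  then have Pow: "Pow {..<3::nat} = {{}, {0}, {1}, {2}, {0, 1}, {0, 2}, {1, 2}, {0, 1, 2}}"
    by (simp add: Pow_insert insert_commute)
  show "?B \<subseteq> ?A" unfolding Pow by simp
  show "?A \<subseteq> ?B" unfolding Pow by (rule subsetI) (elim CollectE conjE insertE emptyE; simp)
qed

lemma cliff_mult_3:
  assumes x: "x \<in> cliff_parity 3 True"
  shows "cliff_mult 3 x y {} = x {} * y {} - x {0, 1} * y {0, 1} - x {0, 2} * y {0, 2} - x {1, 2} * y {1, 2}"
    "cliff_mult 3 x y {0, 1} = x {} * y {0, 1} + x {0, 1} * y {} - x {0, 2} * y {1, 2} + x {1, 2} * y {0, 2}"
    "cliff_mult 3 x y {0, 2} = x {} * y {0, 2} + x {0, 2} * y {} + x {0, 1} * y {1, 2} - x {1, 2} * y {0, 1}"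
    "cliff_mult 3 x y {1, 2} = x {} * y {1, 2} + x {1, 2} * y {} - x {0, 1} * y {0, 2} + x {0, 2} * y {0, 1}"
proof -
  have *: "cliff_mult 3 x y U =
      (\<Sum>S\<in>{{}, {0, 1}, {0, 2}, {1, 2}}. cliff_sign S (sym_diff S U) * x S * y (sym_diff S U))" for U
    unfolding cliff_mult_def even_subsets_3[symmetric]
    using x by (intro sum.mono_neutral_right) (auto simp: cliff_parity_def)
  note simps = cliff_sign_eval insert_Diff_if doubleton_eq_iff algebra_simps
  show "cliff_mult 3 x y {} = x {} * y {} - x {0, 1} * y {0, 1} - x {0, 2} * y {0, 2} - x {1, 2} * y {1, 2}"
    unfolding * by (simp add: simps)
  show "cliff_mult 3 x y {0, 1} = x {} * y {0, 1} + x {0, 1} * y {} - x {0, 2} * y {1, 2} + x {1, 2} * y {0, 2}"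
    unfolding * by (simp add: simps insert_commute)
  show "cliff_mult 3 x y {0, 2} = x {} * y {0, 2} + x {0, 2} * y {} + x {0, 1} * y {1, 2} - x {1, 2} * y {0, 1}"
    unfolding * by (simp add: simps insert_commute)
  show "cliff_mult 3 x y {1, 2} = x {} * y {1, 2} + x {1, 2} * y {} - x {0, 1} * y {0, 2} + x {0, 2} * y {0, 1}"
    unfolding * by (simp add: simps insert_commute)
qed

lemma cliff_even_3_eqI:
  assumes "x \<in> cliff_parity 3 True" "y \<in> cliff_parity 3 True"
    and "x {} = y {}" "x {0, 1} = y {0, 1}" "x {0, 2} = y {0, 2}" "x {1, 2} = y {1, 2}"
  shows "x = y"
proof
  fix S
  show "x S = y S"
  proof (cases "S \<in> {S \<in> Pow {..<3}. even (card S)}")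
    case True
    then show ?thesis unfolding even_subsets_3 using assms by auto
  next
    case False
    then have "x S = 0" "y S = 0" using assms(1,2) unfolding cliff_parity_def cliff_def by blast+
    then show ?thesis by simp
  qed
qed

text \<open>
The images of \<open>e\<^sub>0 e\<^sub>1\<close>, \<open>e\<^sub>0 e\<^sub>2\<close> and \<open>e\<^sub>1 e\<^sub>2\<close> are \<open>\<i>\<close> times a Pauli matrix each, up to sign. They are
chosen so that the torus becomes diagonal and the positive root vector strictly upper triangular.
\<close>

definition spin3_rep :: "clifford \<Rightarrow> complex mat" where
  "spin3_rep x = mat 2 2 (\<lambda>(i, j).
     if i = 0 then (if j = 0 then x {} + \<i> * x {0, 1} else x {0, 2} - \<i> * x {1, 2})
     else (if j = 0 then - x {0, 2} - \<i> * x {1, 2} else x {} - \<i> * x {0, 1}))"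

definition spin3_rep_inv :: "complex mat \<Rightarrow> clifford" where
  "spin3_rep_inv A = (\<lambda>S.
     if S = {} then (A $$ (0, 0) + A $$ (1, 1)) / 2
     else if S = {0, 1} then - \<i> * (A $$ (0, 0) - A $$ (1, 1)) / 2
     else if S = {0, 2} then (A $$ (0, 1) - A $$ (1, 0)) / 2
     else if S = {1, 2} then \<i> * (A $$ (0, 1) + A $$ (1, 0)) / 2 else 0)"

lemma spin3_rep_carrier [simp]: "spin3_rep x \<in> carrier_mat 2 2"
  by (simp add: spin3_rep_def)

lemma mat_2_eqI:
  assumes "A \<in> carrier_mat 2 2" "B \<in> carrier_mat 2 2"
    and "A $$ (0, 0) = B $$ (0, 0)" "A $$ (0, 1) = B $$ (0, 1)"
    and "A $$ (1, 0) = B $$ (1, 0)" "A $$ (1, 1) = B $$ (1, 1)"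
  shows "A = B"
  using assms by (intro eq_matI) (auto simp: less_2_cases_iff)

lemma spin3_rep_entries [simp]:
  "spin3_rep x $$ (0, 0) = x {} + \<i> * x {0, 1}" "spin3_rep x $$ (0, 1) = x {0, 2} - \<i> * x {1, 2}"
  "spin3_rep x $$ (1, 0) = - x {0, 2} - \<i> * x {1, 2}" "spin3_rep x $$ (1, 1) = x {} - \<i> * x {0, 1}"
  "spin3_rep x $$ (0, Suc 0) = x {0, 2} - \<i> * x {1, 2}"
  "spin3_rep x $$ (Suc 0, 0) = - x {0, 2} - \<i> * x {1, 2}" "spin3_rep x $$ (Suc 0, Suc 0) = x {} - \<i> * x {0, 1}"
  by (simp_all add: spin3_rep_def)

lemma mult_mat_2_entry:
  assumes "A \<in> carrier_mat 2 2" "B \<in> carrier_mat 2 2" "i < 2" "j < 2"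
  shows "(A * B) $$ (i, j) = A $$ (i, 0) * B $$ (0, j) + A $$ (i, 1) * B $$ (1, j)"
  using assms by (auto simp: scalar_prod_def numeral_2_eq_2)

lemma spin3_rep_mult:
  assumes x: "x \<in> cliff_parity 3 True"
  shows "spin3_rep (cliff_mult 3 x y) = spin3_rep x * spin3_rep y"
proof (rule mat_2_eqI)
  note simps = mult_mat_2_entry[OF spin3_rep_carrier spin3_rep_carrier] cliff_mult_3[OF x]
  show "spin3_rep (cliff_mult 3 x y) $$ (0, 0) = (spin3_rep x * spin3_rep y) $$ (0, 0)"
    by (simp add: simps algebra_simps del: One_nat_def)
  show "spin3_rep (cliff_mult 3 x y) $$ (0, 1) = (spin3_rep x * spin3_rep y) $$ (0, 1)"
    by (simp add: simps algebra_simps del: One_nat_def)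
  show "spin3_rep (cliff_mult 3 x y) $$ (1, 0) = (spin3_rep x * spin3_rep y) $$ (1, 0)"
    by (simp add: simps algebra_simps del: One_nat_def)
  show "spin3_rep (cliff_mult 3 x y) $$ (1, 1) = (spin3_rep x * spin3_rep y) $$ (1, 1)"
    by (simp add: simps algebra_simps del: One_nat_def)
qed (use mult_carrier_mat[OF spin3_rep_carrier spin3_rep_carrier] in auto)

lemma spin3_rep_one: "spin3_rep cliff_one = 1\<^sub>m 2"
  by (rule mat_2_eqI) (simp_all add: cliff_one_def)

lemma spin3_rep_inj:
  assumes "x \<in> cliff_parity 3 True" "y \<in> cliff_parity 3 True" "spin3_rep x = spin3_rep y"
  shows "x = y"
proof -
  have eq: "spin3_rep x $$ (i, j) = spin3_rep y $$ (i, j)" for i j using assms(3) by simp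
  have 1: "x {} + \<i> * x {0, 1} = y {} + \<i> * y {0, 1}" "x {} - \<i> * x {0, 1} = y {} - \<i> * y {0, 1}"
    "x {0, 2} - \<i> * x {1, 2} = y {0, 2} - \<i> * y {1, 2}"
    "- x {0, 2} - \<i> * x {1, 2} = - y {0, 2} - \<i> * y {1, 2}"
    using eq[of 0 0] eq[of 1 1] eq[of 0 1] eq[of 1 0] by (simp_all del: One_nat_def)
  have half: "a = c" "b = d" if "a + b = c + d" "a - b = c - d" for a b c d :: complex
  proof -
    have "2 * a = (a + b) + (a - b)" "2 * b = (a + b) - (a - b)" by simp_all
    then show "a = c" "b = d" unfolding that by simp_all
  qed
  have "- (\<i> * x {1, 2}) + x {0, 2} = - (\<i> * y {1, 2}) + y {0, 2}"
    using 1(3) by (simp only: uminus_add_conv_diff)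
  moreover have "- (\<i> * x {1, 2}) - x {0, 2} = - (\<i> * y {1, 2}) - y {0, 2}"
    using 1(4) by (simp only: diff_conv_add_uminus add.commute)
  ultimately have "- (\<i> * x {1, 2}) = - (\<i> * y {1, 2})" "x {0, 2} = y {0, 2}"
    by (rule half)+
  then show ?thesis
    using half[OF 1(1,2)] assms(1,2) by (intro cliff_even_3_eqI) simp_all
qed

lemma spin3_rep_spin3_rep_inv: "A \<in> carrier_mat 2 2 \<Longrightarrow> spin3_rep (spin3_rep_inv A) = A"
  by (rule mat_2_eqI) (auto simp: spin3_rep_inv_def doubleton_eq_iff field_simps)

lemma spin3_rep_inv_parity: "spin3_rep_inv A \<in> cliff_parity 3 True"
  by (auto simp: cliff_parity_def cliff_def spin3_rep_inv_def split: if_splits)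

lemma cliff_rev_3:
  "cliff_rev x {} = x {}" "cliff_rev x {0, 1} = - x {0, 1}" "cliff_rev x {0, 2} = - x {0, 2}"
  "cliff_rev x {1, 2} = - x {1, 2}"
  by (simp_all add: cliff_rev_def numeral_2_eq_2)

text \<open>
The scalar is the determinant of the image of \<open>x\<close>, which is the quaternion norm of \<open>x\<close>.
\<close>

lemma cliff_norm_3:
  assumes x: "x \<in> cliff_parity 3 True"
  shows "cliff_mult 3 x (cliff_rev x) = cscale (spin3_rep x $$ (0, 0) * spin3_rep x $$ (1, 1) - spin3_rep x $$ (0, 1) * spin3_rep x $$ (1, 0)) cliff_one"
proof (rule cliff_even_3_eqI)
  interpret clifford_algebra 3 .
  show "cliff_mult 3 x (cliff_rev x) \<in> cliff_parity 3 True"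
    using mult_parity[OF x rev_parity[OF x]] by simp
  show "cscale (spin3_rep x $$ (0, 0) * spin3_rep x $$ (1, 1) - spin3_rep x $$ (0, 1) * spin3_rep x $$ (1, 0)) cliff_one \<in> cliff_parity 3 True"
    by (auto simp: cliff_parity_def cliff_def cliff_one_def split: if_splits)
qed (simp_all add: cliff_mult_3[OF x] cliff_rev_3 cliff_one_def algebra_simps del: One_nat_def)

text \<open>
In dimension 3 an even element of norm 1 automatically preserves vectors: \<open>x v x\<^sup>*\<close> is odd and
fixed by reversal, and reversal changes the sign of \<open>e\<^sub>0 e\<^sub>1 e\<^sub>2\<close>, the only other odd basis element.
\<close>

lemma spin_set_3_iff:
  "x \<in> spin_set 3 \<longleftrightarrow> x \<in> cliff_parity 3 True \<and>
    spin3_rep x $$ (0, 0) * spin3_rep x $$ (1, 1) - spin3_rep x $$ (0, 1) * spin3_rep x $$ (1, 0) = 1"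
  (is "_ \<longleftrightarrow> _ \<and> ?d = 1")
proof -
  interpret clifford_algebra 3 .
  show ?thesis
  proof (intro iffI conjI)
    assume x: "x \<in> spin_set 3"
    show p: "x \<in> cliff_parity 3 True" by (rule spin_setD(1)[OF x])
    have "cscale ?d cliff_one {} = cliff_one {}"
      using cliff_norm_3[OF p] spin_setD(4)[OF x] by simp
    then show "?d = 1" by (simp only: cscale_apply) (simp add: cliff_one_def)
  next
    assume a: "x \<in> cliff_parity 3 True \<and> ?d = 1"
    then have p: "x \<in> cliff_parity 3 True" and 1: "cliff_mult 3 x (cliff_rev x) = cliff_one"
      using cliff_norm_3[of x] by simp_all
    show "x \<in> spin_set 3"
    proof (rule spin_setI[OF p 1])
      fix v :: "complex vec" assume v: "v \<in> carrier_vec 3"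
      define y where "y = cliff_mult 3 (cliff_mult 3 x (vec_elem v)) (cliff_rev x)"
      have vp: "vec_elem v \<in> cliff_parity 3 False" by (rule vectors_parity[OF vec_elem_vectors[OF v]])
      have y: "y \<in> cliff_parity 3 False"
        unfolding y_def using mult_parity[OF mult_parity[OF p vp] rev_parity[OF p]] by simp
      have xv: "cliff_mult 3 x (vec_elem v) \<in> cliff 3" using mult_cliff p vp parity_cliff by blast
      have rev: "cliff_rev y = y"
        unfolding y_def rev_mult[OF xv rev_cliff[OF parity_cliff[OF p]]]
          rev_mult[OF parity_cliff[OF p] parity_cliff[OF vp]] rev_vector[OF vec_elem_vectors[OF v]]
        by (simp add: mult_assoc)
      have "\<exists>i<3. S = {i}" if S: "y S \<noteq> 0" for S
      proof -
        have "S \<subseteq> {..<3}" "odd (card S)" using y S by (auto simp: cliff_parity_def cliff_def)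
        moreover have "card S \<le> 3" using card_mono[of "{..<3::nat}" S] \<open>S \<subseteq> {..<3}\<close> by simp
        moreover have "card S \<noteq> 3"
        proof
          assume "card S = 3"
          then have "cliff_rev y S = - y S" by (simp add: cliff_rev_def numeral_3_eq_3 numeral_2_eq_2)
          then show False using rev S by simp
        qed
        ultimately have "card S = 1" by (metis One_nat_def even_zero le_Suc_eq numeral_3_eq_3 numeral_2_eq_2 dvd_refl le_zero_eq)
        then obtain i where "S = {i}" by (auto simp: card_1_singleton_iff)
        then show ?thesis using \<open>S \<subseteq> {..<3}\<close> by auto
      qed
      then show "cliff_mult 3 (cliff_mult 3 x (vec_elem v)) (cliff_rev x) \<in> cliff_vectors 3"
        unfolding y_def[symmetric] cliff_vectors_def by blast
    qed
  qed
qed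

lemma Spin_1_carrier: "carrier (Spin 1) = spin_set 3" "x \<otimes>\<^bsub>Spin 1\<^esub> y = cliff_mult 3 x y"
  by (simp_all add: Spin_def numeral_3_eq_3)

lemma spin3_rep_rep:
  assumes x: "x \<in> spin_set 3"
  shows "spin3_rep x * spin3_rep (cliff_rev x) = 1\<^sub>m 2" "spin3_rep (cliff_rev x) * spin3_rep x = 1\<^sub>m 2"
proof -
  interpret clifford_algebra 3 .
  note X = spin_setD[OF x] and X' = spin_setD[OF spin_rev[OF x]]
  show "spin3_rep x * spin3_rep (cliff_rev x) = 1\<^sub>m 2" "spin3_rep (cliff_rev x) * spin3_rep x = 1\<^sub>m 2"
    using spin3_rep_mult[OF X(1), of "cliff_rev x"] spin3_rep_mult[OF X'(1), of x] X(4,5) spin3_rep_one by simp_all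
qed

lemma spin3_rep_rational: "rational_rep 1 2 spin3_rep"
proof -
  interpret clifford_algebra 3 .
  have "spin3_rep \<in> hom (Spin 1) (GL 2)"
  proof (rule homI)
    fix x assume "x \<in> carrier (Spin 1)"
    then have x: "x \<in> spin_set 3" by (simp only: Spin_1_carrier)
    show "spin3_rep x \<in> carrier (GL 2)"
      using spin3_rep_rep[OF x] by (intro GL_carrierI) auto
    fix y assume "y \<in> carrier (Spin 1)"
    show "spin3_rep (x \<otimes>\<^bsub>Spin 1\<^esub> y) = spin3_rep x \<otimes>\<^bsub>GL 2\<^esub> spin3_rep y"
      using spin3_rep_mult[OF spin_setD(1)[OF x], of y] by (simp only: Spin_1_carrier GL_mult)
  qed
  moreover have "\<exists>f. polynomial_fun f \<and> (\<forall>x\<in>carrier (Spin 1). spin3_rep x $$ (i, j) = f x)"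
    if ij: "i < 2" "j < 2" for i j
  proof -
    have lin: "polynomial_fun (\<lambda>x. a * x S + b * x T)" for a b S T
      by (intro polynomial_fun.intros)
    have "(i = 0 \<or> i = 1) \<and> (j = 0 \<or> j = 1)" using ij by (auto simp: less_2_cases_iff)
    then consider "i = 0" "j = 0" | "i = 0" "j = 1" | "i = 1" "j = 0" | "i = 1" "j = 1" by blast
    then show ?thesis
    proof cases
      case 1
      then show ?thesis using lin[of 1 "{}" \<i> "{0, 1}"] by (intro exI conjI) auto
    next
      case 2
      then show ?thesis using lin[of 1 "{0, 2}" "- \<i>" "{1, 2}"] by (intro exI conjI) auto
    next
      case 3
      then show ?thesis using lin[of "- 1" "{0, 2}" "- \<i>" "{1, 2}"] by (intro exI conjI) auto
    next
      case 4
      then show ?thesis using lin[of 1 "{}" "- \<i>" "{0, 1}"] by (intro exI conjI) auto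
    qed
  qed
  ultimately show ?thesis unfolding rational_rep_def by blast
qed

lemma spin3_rep_surj:
  assumes A: "A \<in> carrier_mat 2 2" "A $$ (0, 0) * A $$ (1, 1) - A $$ (0, 1) * A $$ (1, 0) = 1"
  shows "\<exists>x\<in>spin_set 3. spin3_rep x = A"
  using spin3_rep_inv_parity[of A] spin3_rep_spin3_rep_inv[OF A(1)] A(2) spin_set_3_iff[of "spin3_rep_inv A"] by auto

text \<open>
The image is all of \<open>SL\<^sub>2\<close> and in particular contains the transvections. The difference of a vector and
its image under a transvection is a multiple of a unit vector.
\<close>

lemma spin3_rep_irreducible: "irreducible_rep 1 2 spin3_rep"
proof -
  have "W = {0\<^sub>v 2} \<or> W = carrier_vec 2"
    if W: "VectorSpace.subspace class_ring W (module_vec TYPE(complex) 2)"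
      and inv: "\<forall>x\<in>carrier (Spin 1). \<forall>w\<in>W. spin3_rep x *\<^sub>v w \<in> W" for W
  proof (cases "W \<subseteq> {0\<^sub>v 2}")
    case True
    then show ?thesis using W unfolding subspace_module_vec_iff by blast
  next
    case False
    note W' = W[unfolded subspace_module_vec_iff]
    have sub: "W \<subseteq> carrier_vec 2" and add: "\<And>v w. v \<in> W \<Longrightarrow> w \<in> W \<Longrightarrow> v + w \<in> W"
      and smult: "\<And>c w. w \<in> W \<Longrightarrow> c \<cdot>\<^sub>v w \<in> W" using W' by auto
    define T where "T i j = mat 2 2 (\<lambda>(a, b). if a = b \<or> (a = i \<and> b = j) then 1 else 0 :: complex)" for i j :: nat
    have trans: "unit_vec 2 i \<in> W" if w: "w \<in> W" "w $ j \<noteq> 0" and ij: "i = 0 \<and> j = 1 \<or> i = 1 \<and> j = 0" for i j w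
    proof -
      have wc: "w \<in> carrier_vec 2" using w sub by auto
      have "T i j \<in> carrier_mat 2 2" "T i j $$ (0, 0) * T i j $$ (1, 1) - T i j $$ (0, 1) * T i j $$ (1, 0) = 1"
        using ij by (auto simp: T_def)
      then obtain x where "x \<in> spin_set 3" "spin3_rep x = T i j" using spin3_rep_surj by blast
      then have "T i j *\<^sub>v w \<in> W" using inv w Spin_1_carrier by metis
      then have "inverse (w $ j) \<cdot>\<^sub>v (T i j *\<^sub>v w + (- 1) \<cdot>\<^sub>v w) \<in> W" using add smult w by blast
      also have "inverse (w $ j) \<cdot>\<^sub>v (T i j *\<^sub>v w + (- 1) \<cdot>\<^sub>v w) = unit_vec 2 i"
        using ij wc w(2) by (intro eq_vecI) (auto simp: T_def scalar_prod_def numeral_2_eq_2 less_Suc_eq)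
      finally show ?thesis .
    qed
    obtain w where w: "w \<in> W" "w \<noteq> 0\<^sub>v 2" using False by blast
    have "w $ 0 \<noteq> 0 \<or> w $ 1 \<noteq> 0"
    proof (rule ccontr)
      assume "\<not> ?thesis"
      then have "w = 0\<^sub>v 2" using w(1) sub by (intro eq_vecI) (auto simp: less_2_cases_iff)
      then show False using w by simp
    qed
    then have e: "unit_vec 2 0 \<in> W" "unit_vec 2 1 \<in> W"
      using trans[OF w(1), of 0 1] trans[OF w(1), of 1 0]
        trans[of "unit_vec 2 0" 0 1] trans[of "unit_vec 2 1" 1 0] by auto
    have "v \<in> W" if v: "v \<in> carrier_vec 2" for v
    proof -
      have "v $ 0 \<cdot>\<^sub>v unit_vec 2 0 + v $ 1 \<cdot>\<^sub>v unit_vec 2 1 \<in> W" using add smult e by blast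
      also have "v $ 0 \<cdot>\<^sub>v unit_vec 2 0 + v $ 1 \<cdot>\<^sub>v unit_vec 2 1 = v"
        using v by (intro eq_vecI) (auto simp: less_2_cases_iff)
      finally show ?thesis .
    qed
    then show ?thesis using sub by auto
  qed
  then show ?thesis using spin3_rep_rational by (simp add: irreducible_rep_def)
qed

lemma spin3_rep_fundamental: "fundamental_rep 1 1 2 spin3_rep"
proof -
  interpret clifford_algebra 3 .
  have p: "iso_p 0 = cscale (1 / 2) (basis_elem {0}) + cscale (\<i> / 2) (basis_elem {1})"
    and m: "iso_m 0 = cscale (1 / 2) (basis_elem {0}) + cscale (- \<i> / 2) (basis_elem {1})"
    and e: "last_vec 1 = basis_elem {2}"
    by (auto simp: fun_eq_iff iso_p_def iso_m_def last_vec_def basis_elem_def)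
  let ?e = "unit_vec 2 0 :: complex vec"
  note eval = mult_add_left mult_add_right basis_elem_mult_basis_elem cliff_sign_eval insert_Diff_if cscale_add
  have prod: "cliff_mult 3 (iso_p 0) (last_vec 1) = cscale (1 / 2) (basis_elem {0, 2}) + cscale (\<i> / 2) (basis_elem {1, 2})"
    unfolding p e by (simp add: eval insert_commute)
  have pm: "cliff_mult 3 (iso_p 0) (iso_m 0) = cscale (1 / 2) (basis_elem {}) + cscale (- \<i> / 2) (basis_elem {0, 1})"
    unfolding p m by (simp add: eval) (auto simp: fun_eq_iff basis_elem_def insert_commute)
  have mp: "cliff_mult 3 (iso_m 0) (iso_p 0) = cscale (1 / 2) (basis_elem {}) + cscale (\<i> / 2) (basis_elem {0, 1})"
    unfolding p m by (simp add: eval) (auto simp: fun_eq_iff basis_elem_def insert_commute)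
  have "spin3_rep (root_elem X a) *\<^sub>v ?e = ?e" if X: "X \<in> positive_root_vectors 1" for X a
  proof -
    have "X = cliff_mult 3 (iso_p 0) (last_vec 1)"
      using X by (auto simp: positive_root_vectors_def numeral_3_eq_3)
    then have "root_elem X a = (\<lambda>S. cliff_one S + a * (cscale (1 / 2) (basis_elem {0, 2}) + cscale (\<i> / 2) (basis_elem {1, 2})) S)"
      unfolding root_elem_def prod by simp
    then show ?thesis
      by (intro eq_vecI) (auto simp: spin3_rep_def less_2_cases_iff cliff_one_def basis_elem_def doubleton_eq_iff algebra_simps)
  qed
  moreover have "spin3_rep (torus_elem 1 j z) *\<^sub>v ?e = (z ^ fundamental_weight 1 1 j) \<cdot>\<^sub>v ?e"
    if j: "j < 1" and z: "z \<noteq> 0" for j z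
  proof -
    have "torus_elem 1 j z = (\<lambda>S. z * (cscale (1 / 2) (basis_elem {}) + cscale (- \<i> / 2) (basis_elem {0, 1})) S
        + inverse z * (cscale (1 / 2) (basis_elem {}) + cscale (\<i> / 2) (basis_elem {0, 1})) S)"
      using j pm mp by (simp add: torus_elem_def numeral_3_eq_3)
    then show ?thesis
      by (intro eq_vecI)
        (auto simp: spin3_rep_def less_2_cases_iff basis_elem_def doubleton_eq_iff fundamental_weight_def algebra_simps)
  qed
  moreover have "?e \<noteq> 0\<^sub>v 2" by simp
  ultimately have "highest_weight_vector 1 2 spin3_rep 1 ?e"
    unfolding highest_weight_vector_def by auto
  then show ?thesis using spin3_rep_irreducible unfolding fundamental_rep_def by blast
qed

lemma det_2:
  fixes A :: "complex mat"
  assumes "A \<in> carrier_mat 2 2"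
  shows "det A = A $$ (0, 0) * A $$ (1, 1) - A $$ (0, 1) * A $$ (1, 0)"
proof -
  have "det (mat (Suc 0) (Suc 0) f) = f (0, 0)" for f :: "nat \<times> nat \<Rightarrow> complex"
    using det_single[of "mat (Suc 0) (Suc 0) f"] by simp
  then show ?thesis
    using laplace_expansion_row[OF assms, of 0] assms
    by (simp add: numeral_2_eq_2 cofactor_def mat_delete_def)
qed

text \<open>
Both images have determinant 1, so \<open>t\<^sup>2 = 1\<close> and \<open>t\<close> is the image of the central element \<open>t\<close>. Dividing
the conjugating matrix by a square root of its determinant moves it into \<open>SL\<^sub>2\<close>, where it is the image
of a group element.
\<close>

lemma spin3_rep_conj_imp_conj_up_to_center:
  assumes s: "s\<^sub>1 \<in> spin_set 3" "s\<^sub>2 \<in> spin_set 3"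
    and conj: "conj_up_to_constant (spin3_rep s\<^sub>1) (spin3_rep s\<^sub>2)"
  shows "conj_up_to_center (Spin 1) s\<^sub>1 s\<^sub>2"
proof -
  interpret clifford_algebra 3 .
  have det1: "det (spin3_rep x) = 1" if "x \<in> spin_set 3" for x
    using that spin_set_3_iff[of x] det_2[OF spin3_rep_carrier] by simp
  obtain t where t: "t \<noteq> 0" "similar_mat (spin3_rep s\<^sub>1) (t \<cdot>\<^sub>m spin3_rep s\<^sub>2)"
    using conj by (auto simp: conj_up_to_constant_def)
  have "det (spin3_rep s\<^sub>1) = t ^ 2 * det (spin3_rep s\<^sub>2)"
    using det_similar[OF t(2)] by (simp add: spin3_rep_def)
  then have tt: "t * t = 1" using det1 s by (simp add: power2_eq_square)
  obtain X Y where wit: "similar_mat_wit (spin3_rep s\<^sub>1) (t \<cdot>\<^sub>m spin3_rep s\<^sub>2) X Y"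
    using t(2) by (auto simp: similar_mat_def)
  note d = similar_mat_witD2[OF spin3_rep_carrier wit]
  have "det X * det Y = 1" using det_mult[OF d(6,7)] d(1) by simp
  then have "det X \<noteq> 0" by auto
  define r where "r = csqrt (det X)"
  have r: "r * r = det X" "r \<noteq> 0"
    using \<open>det X \<noteq> 0\<close> by (auto simp: r_def simp flip: power2_eq_square)
  have "det (inverse r \<cdot>\<^sub>m X) = 1"
    using d(6) r by (simp flip: r(1)) (simp add: power2_eq_square field_simps)
  then obtain g where g: "g \<in> spin_set 3" "spin3_rep g = inverse r \<cdot>\<^sub>m X"
    using spin3_rep_surj[of "inverse r \<cdot>\<^sub>m X"] d(6) det_2[of "inverse r \<cdot>\<^sub>m X"] by auto
  have rY: "spin3_rep (cliff_rev g) = r \<cdot>\<^sub>m Y"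
  proof -
    have "spin3_rep g * (r \<cdot>\<^sub>m Y) = 1\<^sub>m 2"
      unfolding g(2) using d(1,6,7) r(2)
      by (simp add: mult_smult_distrib[of _ 2 2] mult_smult_assoc_mat[of _ 2 2]) (intro eq_matI, auto)
    moreover have "spin3_rep (cliff_rev g) * (spin3_rep g * (r \<cdot>\<^sub>m Y)) = r \<cdot>\<^sub>m Y"
      using assoc_mult_mat[OF spin3_rep_carrier spin3_rep_carrier, of "r \<cdot>\<^sub>m Y" 2 "cliff_rev g" g] spin3_rep_rep(2)[OF g(1)] d(7) by simp
    ultimately show ?thesis by (simp add: right_mult_one_mat[OF spin3_rep_carrier])
  qed
  define c where "c = cscale t cliff_one"
  have c_par: "c \<in> cliff_parity 3 True"
    by (auto simp: c_def cliff_parity_def cliff_def cliff_one_def split: if_splits)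
  have c: "c \<in> spin_set 3"
    unfolding spin_set_3_iff using c_par tt by (simp add: c_def cliff_one_def)
  have cy: "cliff_mult 3 c y = cscale t y" for y by (simp add: c_def)
  have central: "\<forall>y\<in>spin_set 3. cliff_mult 3 c y = cliff_mult 3 y c"
    using mult_one spin_setD(2) by (simp add: c_def)
  note G = spin_setD[OF g(1)]
  have gs: "cliff_mult 3 g (cliff_mult 3 c s\<^sub>2) \<in> spin_set 3" by (intro spin_mult g c s)
  have "spin3_rep (cliff_mult 3 (cliff_mult 3 g (cliff_mult 3 c s\<^sub>2)) (cliff_rev g)) = spin3_rep g * spin3_rep (cscale t s\<^sub>2) * spin3_rep (cliff_rev g)"
    unfolding spin3_rep_mult[OF spin_setD(1)[OF gs]] spin3_rep_mult[OF G(1)] unfolding cy ..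
  also have "spin3_rep (cscale t s\<^sub>2) = t \<cdot>\<^sub>m spin3_rep s\<^sub>2"
    by (rule mat_2_eqI) (auto simp: spin3_rep_def algebra_simps)
  also have "spin3_rep g * (t \<cdot>\<^sub>m spin3_rep s\<^sub>2) * spin3_rep (cliff_rev g) = X * (t \<cdot>\<^sub>m spin3_rep s\<^sub>2) * Y"
  proof -
    have XM: "X * (t \<cdot>\<^sub>m spin3_rep s\<^sub>2) \<in> carrier_mat 2 2" by (rule mult_carrier_mat[OF d(6,5)])
    show ?thesis
      unfolding g(2) rY mult_smult_assoc_mat[OF d(6,5)]
        mult_smult_distrib[OF smult_carrier_mat[OF XM] d(7)] mult_smult_assoc_mat[OF XM d(7)]
      using r(2) by (intro eq_matI) auto
  qed
  also have "\<dots> = spin3_rep s\<^sub>1" by (simp add: d(3))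
  finally have "s\<^sub>1 = cliff_mult 3 (cliff_mult 3 g (cliff_mult 3 c s\<^sub>2)) (cliff_rev g)"
    using spin3_rep_inj[OF spin_setD(1)[OF s(1)] spin_setD(1)[OF spin_mult[OF gs spin_rev[OF g(1)]]]] by simp
  then show ?thesis
    using conj_up_to_centerI[of g 1 c s\<^sub>1 s\<^sub>2] g c central by (simp add: numeral_3_eq_3)
qed

section \<open>Conjugacy up to the centre\<close>

theorem proposition3p12:
  fixes l :: nat and s\<^sub>1 s\<^sub>2 :: clifford
  assumes "l \<ge> 1"
    and "semisimple_element l s\<^sub>1" and "semisimple_element l s\<^sub>2"
  shows "conj_up_to_center (Spin l) s\<^sub>1 s\<^sub>2 \<longleftrightarrow>
         (\<forall>k\<in>{1..l}. conj_in_GL_fundamental l k s\<^sub>1 s\<^sub>2)"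
proof
  assume "conj_up_to_center (Spin l) s\<^sub>1 s\<^sub>2"
  then show "\<forall>k\<in>{1..l}. conj_in_GL_fundamental l k s\<^sub>1 s\<^sub>2"
    using conj_up_to_center_imp_conj_up_to_constant assms(3)
    unfolding conj_in_GL_fundamental_def fundamental_rep_def semisimple_element_def by blast
next
  assume "\<forall>k\<in>{1..l}. conj_in_GL_fundamental l k s\<^sub>1 s\<^sub>2"
  then have first: "conj_in_GL_fundamental l 1 s\<^sub>1 s\<^sub>2" using assms(1) by simp
  show "conj_up_to_center (Spin l) s\<^sub>1 s\<^sub>2"
  proof (cases "l = 1")
    case True
    then have "s\<^sub>1 \<in> spin_set 3" "s\<^sub>2 \<in> spin_set 3"
      using assms(2,3) unfolding True semisimple_element_def Spin_1_carrier by auto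
    moreover have "conj_up_to_constant (spin3_rep s\<^sub>1) (spin3_rep s\<^sub>2)"
      using first spin3_rep_fundamental unfolding True conj_in_GL_fundamental_def by blast
    ultimately show ?thesis unfolding True by (rule spin3_rep_conj_imp_conj_up_to_center)
  next
    case False
    then have "l \<ge> 2" using assms(1) by simp
    then have "conj_up_to_constant (vector_rep (2 * l + 1) s\<^sub>1) (vector_rep (2 * l + 1) s\<^sub>2)"
      using first vector_rep_fundamental unfolding conj_in_GL_fundamental_def by blast
    then show ?thesis by (rule vector_rep_conj_imp_conj_up_to_center[OF assms(2,3)])
  qed
qed

end
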